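(* Let $B\subset A$ be an inclusion of simple unital $C^*$-algebras with a conditional expectation of index-finite type. Let $\Delta_{A'\cap A_2}$ be the comultiplication on $A'\cap A_2$ defined by $\langle\Delta_{A'\cap A_2}(w),w'\otimes w''\rangle=\tau^{1/2}\langle w,w'\star_1w''\rangle$ for $w,w',w''\in A'\cap A_2$, where $\star_1$ is the convolution product arising from the inclusion $A\subset A_1$, and let $\Delta^{\mathrm{NV}}_{A'\cap A_2}$ be the comultiplication on $A'\cap A_2$ dual to the product of $B'\cap A_1$ via the pairing $\langle\cdot,\cdot\rangle_{\mathrm{NV}}$. Then $$\Delta_{A'\cap A_2}(w)=d\,\Delta^{\mathrm{NV}}_{A'\cap A_2}(w)\qquad\text{for all } w\in A'\cap A_2.$$
   Context: Setting: $B\subset A$ is a unital inclusion of simple unital $C^*$-algebras with a conditional expectation of index-finite type (i.e. one admitting a finite quasi-basis). $E_0:A\to B$ is the unique minimal conditional expectation, with quasi-basis $\{\lambda_i\}_{i=1}^n\subset A$, i.e. $x=\sum_i\lambda_iE_0(\lambda_i^*x)$ for all $x\in A$; $[A:B]_0=\sum_i\lambda_i\lambda_i^*$ is its (scalar) Watatani index and $\tau=[A:B]_0^{-1}$. Put $A_{-1}=B$, $A_0=A$. $B\subset A\subset A_1\subset A_2\subset A_3\subset\cdots$ is the tower of Watatani's $C^*$-basic constructions: $A_n$ is generated by $A_{n-1}$ and the Jones projection $e_n$, with $e_nxe_n=E_{n-1}(x)e_n$ for $x\in A_{n-1}$ and $e_n$ commuting with $A_{n-2}$; $E_n:A_n\to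 A_{n-1}$ is the dual (minimal) conditional expectation, with $E_n(xe_ny)=\tau xy$ for $x,y\in A_{n-1}$. $C'\cap D$ denotes the relative commutant; $B'\cap A_n$ is a finite-dimensional $C^*$-algebra. $\operatorname{tr}=E_0\circ\cdots\circ E_n$ restricted to $B'\cap A_n$ is a faithful tracial state, compatible with inclusions. $\langle x,y\rangle=\operatorname{tr}(x^*y)$ and $\langle a\otimes b,c\otimes d\rangle=\langle a,c\rangle\langle b,d\rangle$. Convolution $\star_1$ on $A'\cap A_2$: it is the construction for $A\subset A_1$ (same $\tau$), namely $w'\star_1w''=\mathcal G^{-1}(\mathcal G(w'')\mathcal G(w'))$, where $\mathcal G:A'\cap A_2\to A_1'\cap A_3$, $\mathcal G(w)=\tau^{-3/2}E^{A'\cap A_3}_{A_1'\cap A_3}(we_3e_2)$, with $E^{A'\cap A_3}_{A_1'\cap A_3}$ the trace-preserving conditional expectation of $A'\cap A_3$ onto $A_1'\cap A_3$; $\mathcal G$ is bijective with inverse $\mathcal G^{-1}(u)=\tau^{-3/2}E_3(ue_2e_3)$. NV pairing: $\langle x,w\rangle_{\mathrm{NV}}=d\,\tau^{-2}\operatorname{tr}(xe_2e_1w)$ for $x\in B'\cap A_1$, $w\in A'\cap A_2$, where $d=\|\mathrm{Ind}_W(E_1|_{A'\cap A_1})\|_2>0$ is the $2$-norm ($\|x\|_2=\operatorname{tr}(x^*x)^{1/2}$) of the Watatani index of $E_1|_{A'\cap A_1}:A'\cap A_1\to\mathbb C$. This pairing is a nondegenerate duality between $B'\cap A_1$ and $A'\cap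 A_2$. The comultiplication $\Delta^{\mathrm{NV}}_{A'\cap A_2}(w)=w_{(1)}\otimes w_{(2)}$ is determined by $\langle x_1x_2,w\rangle_{\mathrm{NV}}=\langle x_1,w_{(1)}\rangle_{\mathrm{NV}}\langle x_2,w_{(2)}\rangle_{\mathrm{NV}}$ for all $x_1,x_2\in B'\cap A_1$. *)

theory Defs
  imports "HOL-Analysis.Analysis"
begin

section \<open>Unital \<open>C\<^sup>*\<close>-algebras\<close>

text \<open>
  HOL-Analysis has only real normed algebras, so complex scalars and the involution are added here.
  All algebras below are unital \<open>C\<^sup>*\<close>-subalgebras (with the same unit) of one ambient algebra,
  given by the type.
\<close>

class unital_cstar_algebra = real_normed_algebra_1 + banach +
  fixes scaleC :: "complex \<Rightarrow> 'a \<Rightarrow> 'a"  (infixr \<open>*\<^sub>C\<close> 75)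
    and star :: "'a \<Rightarrow> 'a"  (\<open>_\<^sup>\<star>\<close> [1000] 999)
  assumes scaleC_add_right: "c *\<^sub>C (x + y) = c *\<^sub>C x + c *\<^sub>C y"
    and scaleC_add_left: "(c + c') *\<^sub>C x = c *\<^sub>C x + c' *\<^sub>C x"
    and scaleC_scaleC: "c *\<^sub>C c' *\<^sub>C x = (c * c') *\<^sub>C x"
    and scaleC_of_real: "complex_of_real r *\<^sub>C x = r *\<^sub>R x"
    and scaleC_mult_left: "(c *\<^sub>C x) * y = c *\<^sub>C (x * y)"
    and scaleC_mult_right: "x * (c *\<^sub>C y) = c *\<^sub>C (x * y)"
    and norm_scaleC: "norm (c *\<^sub>C x) = cmod c * norm x"
    and star_star: "(x\<^sup>\<star>)\<^sup>\<star> = x"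
    and star_add: "(x + y)\<^sup>\<star> = x\<^sup>\<star> + y\<^sup>\<star>"
    and star_mult: "(x * y)\<^sup>\<star> = y\<^sup>\<star> * x\<^sup>\<star>"
    and star_scaleC: "(c *\<^sub>C x)\<^sup>\<star> = cnj c *\<^sub>C x\<^sup>\<star>"
    and cstar_identity: "norm (x\<^sup>\<star> * x) = (norm x)\<^sup>2"

definition cstar_subalgebra :: "'a::unital_cstar_algebra set \<Rightarrow> bool" where
  "cstar_subalgebra S \<longleftrightarrow> closed S \<and> 1 \<in> S \<and>
     (\<forall>x\<in>S. \<forall>y\<in>S. x + y \<in> S \<and> x * y \<in> S) \<and> (\<forall>x\<in>S. x\<^sup>\<star> \<in> S \<and> (\<forall>c. c *\<^sub>C x \<in> S))"

definition cstar_generated :: "'a::unital_cstar_algebra set \<Rightarrow> 'a set" where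
  "cstar_generated X = \<Inter>{S. cstar_subalgebra S \<and> X \<subseteq> S}"

definition closed_ideal :: "'a::unital_cstar_algebra set \<Rightarrow> 'a set \<Rightarrow> bool" where
  "closed_ideal S J \<longleftrightarrow> J \<subseteq> S \<and> closed J \<and> 0 \<in> J \<and>
     (\<forall>x\<in>J. \<forall>y\<in>J. x + y \<in> J) \<and> (\<forall>x\<in>J. \<forall>s\<in>S. s * x \<in> J \<and> x * s \<in> J)"

definition simple_cstar :: "'a::unital_cstar_algebra set \<Rightarrow> bool" where
  "simple_cstar S \<longleftrightarrow> cstar_subalgebra S \<and> (\<forall>J. closed_ideal S J \<longrightarrow> J = {0} \<or> J = S)"

definition rel_commutant :: "'a::unital_cstar_algebra set \<Rightarrow> 'a set \<Rightarrow> 'a set" where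
  "rel_commutant C D = {x \<in> D. \<forall>c\<in>C. x * c = c * x}"

text \<open>Positivity does not depend on the \<open>C\<^sup>*\<close>-subalgebra in which it is tested.\<close>

definition cstar_positive :: "'a::unital_cstar_algebra \<Rightarrow> bool" where
  "cstar_positive x \<longleftrightarrow> (\<exists>y. x = y\<^sup>\<star> * y)"

definition scalar_value :: "'a::unital_cstar_algebra \<Rightarrow> complex" where
  "scalar_value x = (THE c. x = c *\<^sub>C 1)"


section \<open>Conditional expectations and the Watatani index\<close>

text \<open>
  A map \<open>E\<close> from \<open>A\<close> to \<open>B\<close> is a function on the ambient type; its values outside \<open>A\<close> are irrelevant.
\<close>

definition conditional_expectation ::
    "'a::unital_cstar_algebra set \<Rightarrow> 'a set \<Rightarrow> ('a \<Rightarrow> 'a) \<Rightarrow> bool" where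
  "conditional_expectation A B E \<longleftrightarrow>
     B \<subseteq> A \<and> (\<forall>x\<in>A. E x \<in> B) \<and> (\<forall>b\<in>B. E b = b) \<and>
     (\<forall>x\<in>A. \<forall>y\<in>A. E (x + y) = E x + E y) \<and> (\<forall>c. \<forall>x\<in>A. E (c *\<^sub>C x) = c *\<^sub>C E x) \<and>
     (\<forall>b\<in>B. \<forall>b'\<in>B. \<forall>x\<in>A. E (b * x * b') = b * E x * b') \<and>
     (\<forall>x\<in>A. cstar_positive (E (x\<^sup>\<star> * x)))"

definition quasi_basis ::
    "'a::unital_cstar_algebra set \<Rightarrow> ('a \<Rightarrow> 'a) \<Rightarrow> nat \<Rightarrow> (nat \<Rightarrow> 'a) \<Rightarrow> bool" where
  "quasi_basis A E n l \<longleftrightarrow>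
     (\<forall>i<n. l i \<in> A) \<and> (\<forall>x\<in>A. x = (\<Sum>i<n. l i * E ((l i)\<^sup>\<star> * x)))"

definition index_finite_type ::
    "'a::unital_cstar_algebra set \<Rightarrow> 'a set \<Rightarrow> ('a \<Rightarrow> 'a) \<Rightarrow> bool" where
  "index_finite_type A B E \<longleftrightarrow> conditional_expectation A B E \<and> (\<exists>n l. quasi_basis A E n l)"

text \<open>The index does not depend on the quasi-basis.\<close>

definition watatani_index :: "'a::unital_cstar_algebra set \<Rightarrow> ('a \<Rightarrow> 'a) \<Rightarrow> 'a" where
  "watatani_index A E = (THE z. \<exists>n l. quasi_basis A E n l \<and> z = (\<Sum>i<n. l i * (l i)\<^sup>\<star>))"

definition minimal_expectation ::
    "'a::unital_cstar_algebra set \<Rightarrow> 'a set \<Rightarrow> ('a \<Rightarrow> 'a) \<Rightarrow> bool" where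
  "minimal_expectation A B E \<longleftrightarrow> index_finite_type A B E \<and>
     (\<forall>E'. index_finite_type A B E' \<longrightarrow> cstar_positive (watatani_index A E' - watatani_index A E))"

text \<open>\<open>A\<close> and \<open>E\<close> are to be read as \<open>A\<^sub>0\<close> and \<open>E\<^sub>0\<close>; the index is a scalar by simplicity of \<open>A\<^sub>0\<close>.\<close>

definition tau :: "'a::unital_cstar_algebra set \<Rightarrow> ('a \<Rightarrow> 'a) \<Rightarrow> real" where
  "tau A E = inverse (Re (scalar_value (watatani_index A E)))"


section \<open>The basic construction and the tower\<close>

text \<open>
  For \<open>E\<close> of index-finite type, \<open>A\<close> with \<open>\<langle>x, y\<rangle> = E (x\<^sup>\<star> * y)\<close> is already a (complete) Hilbert
  \<open>B\<close>-module.  Watatani's basic construction is the \<open>C\<^sup>*\<close>-algebra of adjointable operators on it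
  generated by the left multiplications by elements of \<open>A\<close> and the projection \<open>x \<mapsto> E x\<close>.
  It is determined here up to an isomorphism fixing \<open>A\<close>: \<open>A1\<close> is generated by \<open>A\<close> and \<open>e\<close>, and \<open>\<pi>\<close>
  is a faithful \<open>*\<close>-representation of \<open>A1\<close> by adjointable operators, with \<open>\<pi> a\<close> the left
  multiplication by \<open>a\<close> and \<open>\<pi> e = E\<close>.  A faithful \<open>*\<close>-representation is isometric.
\<close>

definition module_representation ::
    "'a::unital_cstar_algebra set \<Rightarrow> ('a \<Rightarrow> 'a) \<Rightarrow> 'a set \<Rightarrow> ('a \<Rightarrow> 'a \<Rightarrow> 'a) \<Rightarrow> bool" where
  "module_representation A E A1 \<pi> \<longleftrightarrow>
     (\<forall>s\<in>A1. \<forall>x\<in>A. \<pi> s x \<in> A) \<and>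
     (\<forall>s\<in>A1. \<forall>t\<in>A1. \<forall>x\<in>A. \<pi> (s + t) x = \<pi> s x + \<pi> t x \<and> \<pi> (s * t) x = \<pi> s (\<pi> t x)) \<and>
     (\<forall>c. \<forall>s\<in>A1. \<forall>x\<in>A. \<pi> (c *\<^sub>C s) x = c *\<^sub>C \<pi> s x) \<and>
     (\<forall>s\<in>A1. \<forall>x\<in>A. \<forall>y\<in>A. E ((\<pi> s x)\<^sup>\<star> * y) = E (x\<^sup>\<star> * \<pi> (s\<^sup>\<star>) y))"

definition basic_construction ::
    "'a::unital_cstar_algebra set \<Rightarrow> ('a \<Rightarrow> 'a) \<Rightarrow> 'a set \<Rightarrow> 'a \<Rightarrow> bool" where
  "basic_construction A E A1 e \<longleftrightarrow> A1 = cstar_generated (insert e A) \<and>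
     (\<exists>\<pi>. module_representation A E A1 \<pi> \<and>
        (\<forall>s\<in>A1. (\<forall>x\<in>A. \<pi> s x = 0) \<longrightarrow> s = 0) \<and>
        (\<forall>a\<in>A. \<forall>x\<in>A. \<pi> a x = a * x) \<and> (\<forall>x\<in>A. \<pi> e x = E x))"

definition dual_expectation ::
    "real \<Rightarrow> 'a::unital_cstar_algebra set \<Rightarrow> 'a set \<Rightarrow> 'a \<Rightarrow> ('a \<Rightarrow> 'a) \<Rightarrow> bool" where
  "dual_expectation t A A1 e E1 \<longleftrightarrow> conditional_expectation A1 A E1 \<and>
     (\<forall>x\<in>A. \<forall>y\<in>A. E1 (x * e * y) = t *\<^sub>R (x * y))"

text \<open>
  \<open>A n\<close> is \<open>A\<^sub>n\<close>, so \<open>A 0\<close> is the given algebra \<open>A\<close>; \<open>E 0\<close> maps \<open>A 0\<close> to \<open>B\<close> and \<open>E (Suc n)\<close> maps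
  \<open>A (Suc n)\<close> to \<open>A n\<close>.  The Jones projections are \<open>e 1, e 2, \<dots>\<close>; \<open>e 0\<close> is not used.
\<close>

locale jones_tower =
  fixes B :: "'a::unital_cstar_algebra set" and A :: "nat \<Rightarrow> 'a set"
    and e :: "nat \<Rightarrow> 'a" and E :: "nat \<Rightarrow> 'a \<Rightarrow> 'a"
  assumes simple_B: "simple_cstar B"
    and simple_A: "simple_cstar (A 0)"
    and B_sub_A: "B \<subseteq> A 0"
    and minimal: "minimal_expectation (A 0) B (E 0)"
    and basic: "\<And>n. basic_construction (A n) (E n) (A (Suc n)) (e (Suc n))"
    and dual: "\<And>n. dual_expectation (tau (A 0) (E 0)) (A n) (A (Suc n)) (e (Suc n)) (E (Suc n))"

text \<open>The usual relations for the Jones projection follow from the above definition.\<close>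

lemma cstar_generated_superset: "X \<subseteq> cstar_generated X"
  by (auto simp: cstar_generated_def)

lemma cstar_subalgebra_cstar_generated: "cstar_subalgebra (cstar_generated X)"
  unfolding cstar_generated_def cstar_subalgebra_def[of "\<Inter>_"]
  by (auto simp: cstar_subalgebra_def intro!: closed_Inter)

lemma basic_construction_subset: "basic_construction A E A1 e \<Longrightarrow> insert e A \<subseteq> A1"
  unfolding basic_construction_def using cstar_generated_superset by metis

lemma jones_projection_relations:
  assumes bc: "basic_construction A E A1 e"
    and ce: "conditional_expectation A B E"
    and A: "cstar_subalgebra A" and B: "cstar_subalgebra B"
  shows "e * e = e"
    and "x \<in> A \<Longrightarrow> e * x * e = E x * e"
    and "b \<in> B \<Longrightarrow> e * b = b * e"
proof -
  obtain \<pi> where \<pi>: "module_representation A E A1 \<pi>"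
    and inj: "\<And>s. s \<in> A1 \<Longrightarrow> (\<And>x. x \<in> A \<Longrightarrow> \<pi> s x = 0) \<Longrightarrow> s = 0"
    and \<pi>A: "\<And>a x. a \<in> A \<Longrightarrow> x \<in> A \<Longrightarrow> \<pi> a x = a * x"
    and \<pi>e: "\<And>x. x \<in> A \<Longrightarrow> \<pi> e x = E x"
    using bc unfolding basic_construction_def by blast
  have A1: "cstar_subalgebra A1"
    using bc cstar_subalgebra_cstar_generated unfolding basic_construction_def by metis
  have sub: "e \<in> A1" "\<And>a. a \<in> A \<Longrightarrow> a \<in> A1" using basic_construction_subset[OF bc] by auto
  have EB: "\<And>x. x \<in> A \<Longrightarrow> E x \<in> B" and Eid: "\<And>b. b \<in> B \<Longrightarrow> E b = b"
    and BA: "\<And>b. b \<in> B \<Longrightarrow> b \<in> A"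
    and bim: "\<And>b b' x. b \<in> B \<Longrightarrow> b' \<in> B \<Longrightarrow> x \<in> A \<Longrightarrow> E (b * x * b') = b * E x * b'"
    using ce unfolding conditional_expectation_def by auto
  have mult: "\<And>s t. s \<in> A1 \<Longrightarrow> t \<in> A1 \<Longrightarrow> s * t \<in> A1"
    and add: "\<And>s t. s \<in> A1 \<Longrightarrow> t \<in> A1 \<Longrightarrow> s + t \<in> A1"
    and sc: "\<And>c s. s \<in> A1 \<Longrightarrow> c *\<^sub>C s \<in> A1"
    and multA: "\<And>s t. s \<in> A \<Longrightarrow> t \<in> A \<Longrightarrow> s * t \<in> A" and oneB: "1 \<in> B"
    using A1 A B unfolding cstar_subalgebra_def by auto
  have \<pi>m: "\<And>s t x. s \<in> A1 \<Longrightarrow> t \<in> A1 \<Longrightarrow> x \<in> A \<Longrightarrow> \<pi> (s * t) x = \<pi> s (\<pi> t x)"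
    and \<pi>a: "\<And>s t x. s \<in> A1 \<Longrightarrow> t \<in> A1 \<Longrightarrow> x \<in> A \<Longrightarrow> \<pi> (s + t) x = \<pi> s x + \<pi> t x"
    and \<pi>c: "\<And>c s x. s \<in> A1 \<Longrightarrow> x \<in> A \<Longrightarrow> \<pi> (c *\<^sub>C s) x = c *\<^sub>C \<pi> s x"
    using \<pi> unfolding module_representation_def by auto
  have EL: "E (b * x) = b * E x" if "b \<in> B" "x \<in> A" for b x
    using bim[OF that(1) oneB that(2)] by simp
  have ER: "E (x * b) = E x * b" if "b \<in> B" "x \<in> A" for b x
    using bim[OF oneB that(1) that(2)] by simp
  have neg: "(- 1) *\<^sub>C y = - y" for y :: 'a
    using scaleC_of_real[of "- 1" y] by simp
  have eqI: "s = t" if "s \<in> A1" "t \<in> A1" "\<And>x. x \<in> A \<Longrightarrow> \<pi> s x = \<pi> t x" for s t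
  proof -
    have "s + (- 1) *\<^sub>C t = 0"
    proof (rule inj)
      show "s + (- 1) *\<^sub>C t \<in> A1" by (intro add sc that)
      fix x assume x: "x \<in> A"
      have "\<pi> (s + (- 1) *\<^sub>C t) x = \<pi> s x + (- 1) *\<^sub>C \<pi> t x"
        unfolding \<pi>a[OF that(1) sc[OF that(2)] x] \<pi>c[OF that(2) x] ..
      then show "\<pi> (s + (- 1) *\<^sub>C t) x = 0"
        unfolding that(3)[OF x] neg by simp
    qed
    then show ?thesis unfolding neg by simp
  qed
  show "e * e = e"
    by (rule eqI) (simp_all add: mult sub \<pi>m \<pi>e EB BA Eid)
  show "e * x * e = E x * e" if "x \<in> A"
    by (rule eqI) (simp_all add: mult multA sub \<pi>m \<pi>e \<pi>A EB BA ER that)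
  show "e * b = b * e" if "b \<in> B"
    by (rule eqI) (simp_all add: mult multA sub \<pi>m \<pi>e \<pi>A EB BA EL that)
qed


section \<open>Trace, convolution and the pairing\<close>

primrec iterated_expectation :: "(nat \<Rightarrow> 'a \<Rightarrow> 'a) \<Rightarrow> nat \<Rightarrow> 'a \<Rightarrow> 'a::unital_cstar_algebra" where
  "iterated_expectation E 0 x = E 0 x"
| "iterated_expectation E (Suc n) x = iterated_expectation E n (E (Suc n) x)"

text \<open>\<open>tower_trace E n\<close> is meant on \<open>rel_commutant B (A n)\<close>, where \<open>E\<^sub>0 \<circ> \<cdots> \<circ> E\<^sub>n\<close> is scalar-valued.\<close>

definition tower_trace :: "(nat \<Rightarrow> 'a \<Rightarrow> 'a) \<Rightarrow> nat \<Rightarrow> 'a::unital_cstar_algebra \<Rightarrow> complex" where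
  "tower_trace E n x = scalar_value (iterated_expectation E n x)"

definition trace_inner ::
    "(nat \<Rightarrow> 'a \<Rightarrow> 'a) \<Rightarrow> nat \<Rightarrow> 'a::unital_cstar_algebra \<Rightarrow> 'a \<Rightarrow> complex" where
  "trace_inner E n x y = tower_trace E n (x\<^sup>\<star> * y)"

definition trace_norm2 :: "(nat \<Rightarrow> 'a \<Rightarrow> 'a) \<Rightarrow> nat \<Rightarrow> 'a::unital_cstar_algebra \<Rightarrow> real" where
  "trace_norm2 E n x = sqrt (Re (tower_trace E n (x\<^sup>\<star> * x)))"

text \<open>The choice is unique on \<open>P\<close> when \<open>t\<close> is a faithful trace.\<close>

definition trace_preserving_expectation ::
    "('a \<Rightarrow> complex) \<Rightarrow> 'a::unital_cstar_algebra set \<Rightarrow> 'a set \<Rightarrow> 'a \<Rightarrow> 'a" where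
  "trace_preserving_expectation t P Q =
     (SOME F. conditional_expectation P Q F \<and> (\<forall>x\<in>P. t (F x) = t x))"

definition fourier1 ::
    "(nat \<Rightarrow> 'a set) \<Rightarrow> (nat \<Rightarrow> 'a) \<Rightarrow> (nat \<Rightarrow> 'a \<Rightarrow> 'a) \<Rightarrow> 'a \<Rightarrow> 'a::unital_cstar_algebra" where
  "fourier1 A e E w = (tau (A 0) (E 0) powr (- 3 / 2)) *\<^sub>R
     trace_preserving_expectation (tower_trace E 3)
       (rel_commutant (A 0) (A 3)) (rel_commutant (A 1) (A 3)) (w * e 3 * e 2)"

definition conv1 ::
    "(nat \<Rightarrow> 'a set) \<Rightarrow> (nat \<Rightarrow> 'a) \<Rightarrow> (nat \<Rightarrow> 'a \<Rightarrow> 'a) \<Rightarrow> 'a \<Rightarrow> 'a \<Rightarrow> 'a::unital_cstar_algebra" where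
  "conv1 A e E w' w'' =
     inv_into (rel_commutant (A 0) (A 2)) (fourier1 A e E) (fourier1 A e E w'' * fourier1 A e E w')"

definition nv_const :: "(nat \<Rightarrow> 'a::unital_cstar_algebra set) \<Rightarrow> (nat \<Rightarrow> 'a \<Rightarrow> 'a) \<Rightarrow> real" where
  "nv_const A E = trace_norm2 E 1 (watatani_index (rel_commutant (A 0) (A 1)) (E 1))"

definition nv_pairing ::
    "(nat \<Rightarrow> 'a set) \<Rightarrow> (nat \<Rightarrow> 'a) \<Rightarrow> (nat \<Rightarrow> 'a \<Rightarrow> 'a) \<Rightarrow> 'a::unital_cstar_algebra \<Rightarrow> 'a \<Rightarrow> complex" where
  "nv_pairing A e E x w = complex_of_real (nv_const A E * tau (A 0) (E 0) powr (- 2)) *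
     tower_trace E 2 (x * e 2 * e 1 * w)"


section \<open>Algebraic tensor products and the two comultiplications\<close>

text \<open>
  For a complex subspace \<open>V\<close>, the algebraic tensor product \<open>V \<otimes> V\<close> is realised inside the dual of the
  space of bilinear forms on \<open>V\<close>, the tensor \<open>\<Sum>a\<^sub>i \<otimes> b\<^sub>i\<close> being the functional
  \<open>\<beta> \<mapsto> \<Sum>\<beta> a\<^sub>i b\<^sub>i\<close>.  Bilinear forms separate the points of \<open>V \<otimes> V\<close>, so two sums of elementary
  tensors are equal in \<open>V \<otimes> V\<close> iff these functionals agree.
\<close>

definition bilinear_form_on :: "'a::unital_cstar_algebra set \<Rightarrow> ('a \<Rightarrow> 'a \<Rightarrow> complex) \<Rightarrow> bool" where
  "bilinear_form_on V \<beta> \<longleftrightarrow>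
     (\<forall>x\<in>V. \<forall>y\<in>V. \<forall>z\<in>V. \<beta> (x + y) z = \<beta> x z + \<beta> y z \<and> \<beta> z (x + y) = \<beta> z x + \<beta> z y) \<and>
     (\<forall>c. \<forall>x\<in>V. \<forall>y\<in>V. \<beta> (c *\<^sub>C x) y = c * \<beta> x y \<and> \<beta> x (c *\<^sub>C y) = c * \<beta> x y)"

type_synonym 'a tensor = "('a \<Rightarrow> 'a \<Rightarrow> complex) \<Rightarrow> complex"

definition tensor_sum :: "'a::unital_cstar_algebra set \<Rightarrow> ('a \<times> 'a) list \<Rightarrow> 'a tensor" where
  "tensor_sum V xs = (\<lambda>\<beta>. if bilinear_form_on V \<beta> then (\<Sum>(a, b)\<leftarrow>xs. \<beta> a b) else 0)"

definition tensor_scale :: "complex \<Rightarrow> 'a tensor \<Rightarrow> 'a tensor" where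
  "tensor_scale c T = (\<lambda>\<beta>. c * T \<beta>)"

text \<open>
  In both definitions \<open>xs\<close> lists the pairs \<open>(a, b)\<close> of a representation \<open>\<Sum>a \<otimes> b\<close> of the comultiplied
  element, and \<open>V\<close> is \<open>A' \<inter> A\<^sub>2\<close>.
\<close>

definition comult ::
    "(nat \<Rightarrow> 'a set) \<Rightarrow> (nat \<Rightarrow> 'a) \<Rightarrow> (nat \<Rightarrow> 'a \<Rightarrow> 'a) \<Rightarrow> 'a \<Rightarrow> 'a::unital_cstar_algebra tensor" where
  "comult A e E w = (let V = rel_commutant (A 0) (A 2) in
     THE T. \<exists>xs. set xs \<subseteq> V \<times> V \<and> T = tensor_sum V xs \<and>
       (\<forall>w'\<in>V. \<forall>w''\<in>V.
          (\<Sum>(a, b)\<leftarrow>xs. trace_inner E 2 a w' * trace_inner E 2 b w'') =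
          complex_of_real (sqrt (tau (A 0) (E 0))) * trace_inner E 2 w (conv1 A e E w' w'')))"

definition comult_NV ::
    "'a set \<Rightarrow> (nat \<Rightarrow> 'a set) \<Rightarrow> (nat \<Rightarrow> 'a) \<Rightarrow> (nat \<Rightarrow> 'a \<Rightarrow> 'a) \<Rightarrow> 'a \<Rightarrow>
      'a::unital_cstar_algebra tensor" where
  "comult_NV B A e E w = (let V = rel_commutant (A 0) (A 2) in
     THE T. \<exists>xs. set xs \<subseteq> V \<times> V \<and> T = tensor_sum V xs \<and>
       (\<forall>x1\<in>rel_commutant B (A 1). \<forall>x2\<in>rel_commutant B (A 1).
          nv_pairing A e E (x1 * x2) w =
          (\<Sum>(a, b)\<leftarrow>xs. nv_pairing A e E x1 a * nv_pairing A e E x2 b)))"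

end

theory Submission
  imports Defs
begin

text \<open>
  Write \<open>t\<close> for \<open>\<tau>\<close>, \<open>U = B' \<inter> A\<^sub>1\<close>, \<open>V = A\<^sub>0' \<inter> A\<^sub>2\<close>, and let \<open>l\<^sub>i\<close> be a quasi-basis of \<open>E\<^sub>0\<close>.  Both comultiplications are
  compared through the linear map
    \<open>\<Psi>(y) = t \<Sum>\<^sub>i l\<^sub>i e\<^sub>1 e\<^sub>2 y l\<^sub>i\<^sup>*\<close>,
  the trace preserving expectation of \<open>e\<^sub>1 e\<^sub>2 y\<close> onto the commutant of \<open>A\<^sub>0\<close>.  It is a bijection from \<open>U\<close> onto \<open>V\<close>, with
  inverse \<open>w \<mapsto> t\<^sup>-\<^sup>3 E\<^sub>2(e\<^sub>2 e\<^sub>1 w)\<close> by the pushdown formula, and it turns the pairing into the inner product: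
    \<open>tr(y\<^sup>* e\<^sub>2 e\<^sub>1 a) = \<langle>\<Psi>(y), a\<rangle>\<close>   (\<open>trace_\<Psi>\<close>).
  Let \<open>G(w)\<close> be the expectation of \<open>w e\<^sub>3 e\<^sub>2\<close> onto \<open>A\<^sub>1' \<inter> A\<^sub>3\<close>, which is \<open>t\<^sup>3\<^sup>/\<^sup>2\<close> times the Fourier transform.  Then
  \<open>G(\<Psi>(y)) = t \<Sum>\<^sub>i l\<^sub>i e\<^sub>1 e\<^sub>2 y e\<^sub>3 e\<^sub>2 e\<^sub>1 l\<^sub>i\<^sup>*\<close> is a multiple of the canonical shift, and the Temperley-Lieb relations show
  that this is a homomorphism up to a scalar (\<open>G_\<Psi>_mult\<close>).  Hence
    \<open>\<Psi>(y) \<star>\<^sub>1 \<Psi>(z) = t\<^sup>3\<^sup>/\<^sup>2 \<Psi>(z y)\<close>   (\<open>conv_\<Psi>\<close>),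
  that is, the convolution is the opposite product of \<open>U\<close> transported by \<open>\<Psi>\<close>.  Inserting \<open>x\<^sub>1 = y\<^sup>*\<close>, \<open>x\<^sub>2 = z\<^sup>*\<close>,
  \<open>w' = \<Psi>(y)\<close>, \<open>w'' = \<Psi>(z)\<close>, the two defining identities become complex conjugates of each other, with the powers
  of \<open>t\<close> cancelling and one factor \<open>d\<close> left over (\<open>pairing_condition_iff\<close>).

  The conditions determine a tensor, and \<open>d\<close> is nonzero, because \<open>A\<^sub>0' \<inter> A\<^sub>n\<close> is a finite-dimensional algebra on which the
  trace is faithful.  This is derived from one property of an expectation \<open>F : S \<rightarrow> R\<close> with quasi-basis \<open>l\<^sub>i\<close> and
  trivial centre of \<open>R\<close>, called balance: \<open>\<Sum>\<^sub>i l\<^sub>i c l\<^sub>i\<^sup>*\<close> is a fixed multiple of \<open>F(c)\<close> for \<open>c \<in> R' \<inter> S\<close>.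
  Minimality of the index implies balance by differentiating the index of the perturbed expectations
  \<open>F(exp(s c / 2) \<cdot> exp(s c / 2))\<close> at \<open>s = 0\<close> (\<open>minimal_expectation_balanced\<close>).  Balance passes to the basic construction
  (\<open>dual_balanced\<close>) and to composites (\<open>balanced_compose\<close>).  It makes the restriction of \<open>F\<close> to \<open>R' \<inter> S\<close> a faithful
  trace (\<open>F_faithful\<close>, \<open>F_trace\<close>) and bounds the size of an orthonormal family there by the index
  (\<open>orthonormal_bound\<close>).  It also makes \<open>x \<mapsto> t \<Sum>\<^sub>i l\<^sub>i x l\<^sub>i\<^sup>*\<close> trace preserving (\<open>average_trace\<close>), so that this formula gives
  the trace preserving expectations of relative commutants.

  The underlying facts on \<open>C\<^sup>*\<close>-algebras are that \<open>x\<^sup>* x\<close> has a square root in every subalgebra containing it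
  (\<open>positive_star_mult_self\<close>, \<open>positive_sqrt\<close>) and that a simple algebra has trivial centre (\<open>simple_central_scalar\<close>).
\<close>

section \<open>Complex scalars, the involution and subalgebras\<close>

lemma scaleC_one [simp]: "1 *\<^sub>C (x::'a::unital_cstar_algebra) = x"
  using scaleC_of_real[of 1 x] by simp

lemma scaleC_zero_left [simp]: "0 *\<^sub>C (x::'a::unital_cstar_algebra) = 0"
  using scaleC_of_real[of 0 x] by simp

lemma scaleC_zero_right [simp]: "c *\<^sub>C (0::'a::unital_cstar_algebra) = 0"
  using scaleC_scaleC[of c 0 0] by simp

lemma scaleC_minus_left: "(- c) *\<^sub>C (x::'a::unital_cstar_algebra) = - (c *\<^sub>C x)"
  using scaleC_add_left[of c "- c" x] by (simp add: eq_neg_iff_add_eq_0 add.commute)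

lemma scaleC_minus_right: "c *\<^sub>C (- x) = - (c *\<^sub>C (x::'a::unital_cstar_algebra))"
  using scaleC_add_right[of c x "- x"] by (simp add: eq_neg_iff_add_eq_0 add.commute)

lemma scaleC_diff_right: "c *\<^sub>C (x - y) = c *\<^sub>C x - c *\<^sub>C (y::'a::unital_cstar_algebra)"
  using scaleC_add_right[of c x "- y"] by (simp add: scaleC_minus_right)

lemma scaleC_diff_left: "(c - c') *\<^sub>C (x::'a::unital_cstar_algebra) = c *\<^sub>C x - c' *\<^sub>C x"
  using scaleC_add_left[of c "- c'" x] by (simp add: scaleC_minus_left)

lemma scaleC_sum_right: "c *\<^sub>C (\<Sum>i\<in>I. f i) = (\<Sum>i\<in>I. c *\<^sub>C (f i :: 'a::unital_cstar_algebra))"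
  by (induction I rule: infinite_finite_induct) (simp_all add: scaleC_add_right)

lemma scaleC_eq_0_iff [simp]: "c *\<^sub>C (x::'a::unital_cstar_algebra) = 0 \<longleftrightarrow> c = 0 \<or> x = 0"
  using norm_scaleC[of c x] by (metis mult_eq_0_iff norm_eq_zero)

lemma scaleC_scalar_eq_iff [simp]:
  "c *\<^sub>C (1::'a::unital_cstar_algebra) = c' *\<^sub>C 1 \<longleftrightarrow> c = c'"
  using scaleC_eq_0_iff[of "c - c'" "1::'a"] by (simp add: scaleC_diff_left)

lemma scaleR_one_eq_scaleC: "r *\<^sub>R (1::'a::unital_cstar_algebra) = complex_of_real r *\<^sub>C 1"
  by (simp add: scaleC_of_real)

lemma scalar_value_scaleC [simp]: "scalar_value (c *\<^sub>C (1::'a::unital_cstar_algebra)) = c"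
  unfolding scalar_value_def by (rule the_equality) auto

lemma star_zero [simp]: "(0::'a::unital_cstar_algebra)\<^sup>\<star> = 0"
  using star_scaleC[of 0 "0::'a"] by simp

lemma star_one [simp]: "(1::'a::unital_cstar_algebra)\<^sup>\<star> = 1"
  using star_mult[of "(1::'a)\<^sup>\<star>" 1] by (simp add: star_star)

lemma star_minus: "(- x)\<^sup>\<star> = - (x::'a::unital_cstar_algebra)\<^sup>\<star>"
  using star_add[of x "- x"] by (simp add: eq_neg_iff_add_eq_0 add.commute)

lemma star_diff: "(x - y)\<^sup>\<star> = x\<^sup>\<star> - (y::'a::unital_cstar_algebra)\<^sup>\<star>"
  using star_add[of x "- y"] by (simp add: star_minus)

lemma star_scaleR: "(r *\<^sub>R x)\<^sup>\<star> = r *\<^sub>R (x::'a::unital_cstar_algebra)\<^sup>\<star>"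
  using star_scaleC[of "complex_of_real r" x] by (simp add: scaleC_of_real)

lemma star_sum: "(\<Sum>i\<in>I. f i)\<^sup>\<star> = (\<Sum>i\<in>I. (f i :: 'a::unital_cstar_algebra)\<^sup>\<star>)"
  by (induction I rule: infinite_finite_induct) (simp_all add: star_add)

lemma star_power: "(x ^ n)\<^sup>\<star> = (x::'a::unital_cstar_algebra)\<^sup>\<star> ^ n"
  by (induction n) (simp_all add: star_mult power_commutes)

lemmas star_simps = star_add star_diff star_minus star_mult star_scaleR star_scaleC star_sum star_star

lemma norm_star [simp]: "norm (x\<^sup>\<star>) = norm (x::'a::unital_cstar_algebra)"
proof (rule antisym)
  have le: "norm y \<le> norm (y\<^sup>\<star>)" for y :: 'a
  proof (cases "y = 0")
    case False
    have "norm y * norm y \<le> norm (y\<^sup>\<star>) * norm y"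
      using cstar_identity[of y] norm_mult_ineq[of "y\<^sup>\<star>" y] by (simp add: power2_eq_square)
    then show ?thesis using False by simp
  qed simp
  show "norm (x\<^sup>\<star>) \<le> norm x" using le[of "x\<^sup>\<star>"] by (simp add: star_star)
  show "norm x \<le> norm (x\<^sup>\<star>)" by (rule le)
qed

lemma star_mult_eq_0_iff: "x\<^sup>\<star> * x = 0 \<longleftrightarrow> (x::'a::unital_cstar_algebra) = 0"
  using cstar_identity[of x] by auto

lemma bounded_linear_star: "bounded_linear (star :: 'a \<Rightarrow> 'a::unital_cstar_algebra)"
  by (rule bounded_linear_intro[where K = 1]) (simp_all add: star_simps)

lemma closed_selfadjoint: "closed {x::'a::unital_cstar_algebra. x\<^sup>\<star> = x}"
  by (intro closed_Collect_eq continuous_intros linear_continuous_on bounded_linear_star)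

lemma closed_commuting: "closed {x::'a::unital_cstar_algebra. y * x = x * y}"
  by (intro closed_Collect_eq continuous_intros)

context
  fixes S :: "'a::unital_cstar_algebra set"
  assumes S: "cstar_subalgebra S"
begin

lemma subalg_closed: "closed S"
  and subalg_one: "1 \<in> S"
  and subalg_add: "x \<in> S \<Longrightarrow> y \<in> S \<Longrightarrow> x + y \<in> S"
  and subalg_mult: "x \<in> S \<Longrightarrow> y \<in> S \<Longrightarrow> x * y \<in> S"
  and subalg_star: "x \<in> S \<Longrightarrow> x\<^sup>\<star> \<in> S"
  and subalg_scaleC: "x \<in> S \<Longrightarrow> c *\<^sub>C x \<in> S"
  using S by (auto simp: cstar_subalgebra_def)

lemma subalg_scaleR: "x \<in> S \<Longrightarrow> r *\<^sub>R x \<in> S"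
  using subalg_scaleC[of x "complex_of_real r"] by (simp add: scaleC_of_real)

lemma subalg_zero: "0 \<in> S"
  using subalg_scaleR[OF subalg_one, of 0] by simp

lemma subalg_minus: "x \<in> S \<Longrightarrow> - x \<in> S"
  using subalg_scaleR[of x "- 1"] by simp

lemma subalg_diff: "x \<in> S \<Longrightarrow> y \<in> S \<Longrightarrow> x - y \<in> S"
  using subalg_add[of x "- y"] subalg_minus[of y] by simp

lemma subalg_sum: "(\<And>i. i \<in> I \<Longrightarrow> f i \<in> S) \<Longrightarrow> (\<Sum>i\<in>I. f i) \<in> S"
  by (induction I rule: infinite_finite_induct) (simp_all add: subalg_zero subalg_add)

lemma subalg_power: "x \<in> S \<Longrightarrow> x ^ n \<in> S"
  by (induction n) (simp_all add: subalg_one subalg_mult)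

lemmas subalg_intros = subalg_one subalg_zero subalg_add subalg_diff subalg_minus subalg_mult
  subalg_star subalg_scaleC subalg_scaleR subalg_sum subalg_power

end

lemma cstar_subalgebra_rel_commutant:
  assumes D: "cstar_subalgebra D" and C: "\<And>c. c \<in> C \<Longrightarrow> c\<^sup>\<star> \<in> C"
  shows "cstar_subalgebra (rel_commutant C D)"
  unfolding cstar_subalgebra_def
proof (intro conjI ballI allI)
  have "rel_commutant C D = D \<inter> (\<Inter>c\<in>C. {x. c * x = x * c})"
    by (auto simp: rel_commutant_def)
  then show "closed (rel_commutant C D)"
    by (simp add: closed_Int closed_INT closed_commuting subalg_closed[OF D])
  fix x assume x: "x \<in> rel_commutant C D"
  have comm: "x * c = c * x" if "c \<in> C" for c using x that by (simp add: rel_commutant_def)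
  show "x\<^sup>\<star> \<in> rel_commutant C D"
  proof -
    have "x\<^sup>\<star> * c = c * x\<^sup>\<star>" if "c \<in> C" for c
      using comm[OF C[OF that]] by (metis star_mult star_star)
    then show ?thesis using x by (simp add: rel_commutant_def subalg_star[OF D])
  qed
  show "k *\<^sub>C x \<in> rel_commutant C D" for k
    using x by (auto simp: rel_commutant_def subalg_scaleC[OF D] scaleC_mult_left scaleC_mult_right)
  fix y assume y: "y \<in> rel_commutant C D"
  show "x + y \<in> rel_commutant C D"
    using x y by (auto simp: rel_commutant_def subalg_add[OF D] algebra_simps)
  have "x * y * c = c * (x * y)" if "c \<in> C" for c
    using comm[OF that] y that by (metis (mono_tags, lifting) mem_Collect_eq mult.assoc rel_commutant_def)
  then show "x * y \<in> rel_commutant C D"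
    using x y by (simp add: rel_commutant_def subalg_mult[OF D])
qed (simp_all add: rel_commutant_def subalg_one[OF D])

section \<open>Square roots and positivity\<close>

text \<open>The binomial series of \<open>sqrt (1 - x)\<close> still converges absolutely on the boundary \<open>norm x = 1\<close>,
  because all coefficients but the constant one are nonpositive and their partial sums telescope.\<close>

lemma sqrt_coeff_sum_le: "(\<Sum>k<n. \<bar>(- 1) ^ Suc k * ((1/2::real) gchoose Suc k)\<bar>) \<le> 1"
proof -
  have pos: "0 < (- 1) ^ m * ((-1/2::real) gchoose m)" for m
  proof (induction m)
    case (Suc m)
    have "((-1/2::real) gchoose Suc m) = (-1/2 - real m) / real (Suc m) * ((-1/2) gchoose m)"
      using gbinomial_absorb_comp[of "-1/2::real" m] gbinomial_absorption[of m "-1/2::real"]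
      by (simp add: field_simps)
    then have "(- 1) ^ Suc m * ((-1/2::real) gchoose Suc m) =
        (- 1) ^ Suc m * ((-1/2 - real m) / real (Suc m) * ((-1/2) gchoose m))"
      by (simp only:)
    also have "\<dots> = (1/2 + real m) / real (Suc m) * ((- 1) ^ m * ((-1/2) gchoose m))"
      by (simp add: field_simps)
    finally have "(- 1) ^ Suc m * ((-1/2::real) gchoose Suc m) =
        (1/2 + real m) / real (Suc m) * ((- 1) ^ m * ((-1/2) gchoose m))" .
    then show ?case using Suc by simp
  qed simp
  have neg: "(- 1) ^ Suc k * ((1/2::real) gchoose Suc k) < 0" for k
  proof -
    have "real (Suc k) * ((- 1) ^ Suc k * ((1/2::real) gchoose Suc k)) =
        (- 1) ^ Suc k * ((1/2) * ((1/2 - 1) gchoose k))"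
      by (simp only: gbinomial_absorption[symmetric] mult.left_commute)
    also have "\<dots> = - ((1/2) * ((- 1) ^ k * ((-1/2) gchoose k)))" by simp
    also have "\<dots> < 0" using pos[of k] by simp
    finally show ?thesis by (simp only: mult_less_0_iff of_nat_less_0_iff simp_thms)
  qed
  have "(\<Sum>k<n. \<bar>(- 1) ^ Suc k * ((1/2::real) gchoose Suc k)\<bar>) =
      - (\<Sum>k<n. (- 1) ^ Suc k * ((1/2::real) gchoose Suc k))"
    using neg by (simp add: sum_negf[symmetric] abs_of_neg del: power_Suc)
  also have "\<dots> = 1 - (\<Sum>k<Suc n. (- 1) ^ k * ((1/2::real) gchoose k))"
    by (subst sum.lessThan_Suc_shift) simp
  also have "(\<Sum>k<Suc n. (- 1) ^ k * ((1/2::real) gchoose k)) = (- 1) ^ n * ((-1/2) gchoose n)"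
    using gbinomial_sum_lower_neg[of "1/2::real" n] by (simp add: lessThan_Suc_atMost mult.commute)
  finally show ?thesis using pos[of n] by linarith
qed

text \<open>The root is the sum of the binomial series; Vandermonde's identity evaluates its Cauchy square.\<close>

lemma subalgebra_sqrt_one_minus:
  fixes x :: "'a::unital_cstar_algebra"
  assumes S: "cstar_subalgebra S" and x: "x \<in> S" "x\<^sup>\<star> = x" "norm x \<le> 1"
  obtains s where "s \<in> S" "s\<^sup>\<star> = s" "s * s = 1 - x" "norm (1 - s) \<le> 1"
    "\<And>y. y * x = x * y \<Longrightarrow> y * s = s * y"
proof -
  define c :: "nat \<Rightarrow> real" where "c k = (- 1) ^ k * ((1/2) gchoose k)" for k
  define f where "f k = c k *\<^sub>R x ^ k" for k
  have bound: "norm (f k) \<le> \<bar>c k\<bar>" for k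
  proof -
    have "norm (x ^ k) \<le> norm x ^ k" by (rule norm_power_ineq)
    also have "\<dots> \<le> 1" using x by (simp add: power_le_one)
    finally show ?thesis by (simp add: f_def mult_left_le)
  qed
  have sumc': "summable (\<lambda>k. \<bar>c (Suc k)\<bar>)"
    using sqrt_coeff_sum_le by (intro summableI_nonneg_bounded[where x = 1]) (simp_all add: c_def)
  then have sumc: "summable (\<lambda>k. \<bar>c k\<bar>)" by (simp only: summable_Suc_iff[of "\<lambda>k. \<bar>c k\<bar>"])
  have sumn: "summable (\<lambda>k. norm (f k))"
    by (rule summable_comparison_test'[OF sumc]) (simp add: bound)
  then have sumf: "summable f" by (rule summable_norm_cancel)
  define s where "s = suminf f"
  have lim: "(\<lambda>n. \<Sum>k<n. f k) \<longlonglongrightarrow> s"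
    unfolding s_def by (rule summable_LIMSEQ[OF sumf])
  have fS: "(\<Sum>k<n. f k) \<in> S" for n
    unfolding f_def by (intro subalg_intros[OF S] x)
  show thesis
  proof
    show "s \<in> S"
      by (rule closed_sequentially[OF subalg_closed[OF S] _ lim]) (simp add: fS)
    have "(\<Sum>k<n. f k)\<^sup>\<star> = (\<Sum>k<n. f k)" for n
      by (simp add: f_def star_simps star_power x)
    then show "s\<^sup>\<star> = s"
      using closed_sequentially[OF closed_selfadjoint _ lim] by simp
    show "y * s = s * y" if y: "y * x = x * y" for y
    proof -
      have "y * x ^ k = x ^ k * y" for k
        by (induction k) (simp_all, metis y mult.assoc)
      then have "y * (\<Sum>k<n. f k) = (\<Sum>k<n. f k) * y" for n
        by (simp add: f_def sum_distrib_left sum_distrib_right)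
      then show ?thesis
        using closed_sequentially[OF closed_commuting[of y] _ lim] by simp
    qed
    have "s - 1 = (\<Sum>k. f (Suc k))"
      using suminf_split_head[OF sumf] by (simp add: s_def f_def c_def)
    then have "norm (1 - s) = norm (\<Sum>k. f (Suc k))" by (metis norm_minus_commute)
    also have "\<dots> \<le> (\<Sum>k. norm (f (Suc k)))"
      using sumn by (intro summable_norm) (simp only: summable_Suc_iff[of "\<lambda>k. norm (f k)"])
    also have "\<dots> \<le> (\<Sum>k. \<bar>c (Suc k)\<bar>)"
      using sumn by (intro suminf_le sumc' bound) (simp only: summable_Suc_iff[of "\<lambda>k. norm (f k)"])
    also have "\<dots> \<le> 1"
      using sqrt_coeff_sum_le by (intro suminf_le_const[OF sumc']) (simp add: c_def)
    finally show "norm (1 - s) \<le> 1" .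
    have conv: "(\<Sum>i\<le>k. c (k - i) * c i) = (- 1) ^ k * (1 gchoose k)" for k
    proof -
      have "(\<Sum>i\<le>k. c (k - i) * c i) = (\<Sum>i\<le>k. (- 1) ^ k * (((1/2) gchoose i) * ((1/2) gchoose (k - i))))"
        by (intro sum.cong) (auto simp: c_def power_add[symmetric] mult.assoc mult.left_commute)
      also have "\<dots> = (- 1) ^ k * (1 gchoose k)"
        using gbinomial_Vandermonde[of "1/2::real" "1/2" k] by (simp add: sum_distrib_left[symmetric] atLeast0AtMost)
      finally show ?thesis .
    qed
    have "(\<lambda>k. \<Sum>i\<le>k. f i * f (k - i)) sums (s * s)"
      unfolding s_def by (rule Cauchy_product_sums[OF sumn sumn])
    moreover have "(\<Sum>i\<le>k. f i * f (k - i)) = ((- 1) ^ k * (1 gchoose k)) *\<^sub>R x ^ k" for k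
      by (simp add: f_def power_add[symmetric] scaleR_sum_left[symmetric] conv)
    ultimately have "(\<lambda>k. ((- 1) ^ k * (1 gchoose k)) *\<^sub>R x ^ k) sums (s * s)" by simp
    moreover have "(1 gchoose k) = (if k \<le> 1 then 1 else 0 :: real)" for k
    proof -
      have "(1 gchoose k :: real) = of_nat (1 choose k)" using binomial_gbinomial[of 1 k, where 'a = real] by simp
      then show ?thesis by (cases k) (auto simp: binomial_eq_0)
    qed
    then have "(\<lambda>k. ((- 1) ^ k * (1 gchoose k)) *\<^sub>R x ^ k) sums
        (\<Sum>k<2. ((- 1) ^ k * (1 gchoose k)) *\<^sub>R x ^ k)"
      by (intro sums_finite) auto
    ultimately show "s * s = 1 - x"
      using sums_unique2 by (fastforce simp: eval_nat_numeral)
  qed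
qed

text \<open>Positivity is encoded by a norm condition, from which closure under sums is evident; that it
  agrees with the existence of a square root is proved below.\<close>

definition positive :: "'a::unital_cstar_algebra \<Rightarrow> bool" where
  "positive h \<longleftrightarrow> h\<^sup>\<star> = h \<and> (\<exists>T. norm (T *\<^sub>R 1 - h) \<le> T)"

lemma positive_selfadjoint: "positive h \<Longrightarrow> h\<^sup>\<star> = h"
  by (simp add: positive_def)

lemma positive_add: assumes "positive h" "positive k" shows "positive (h + k)"
proof -
  obtain T U where "norm (T *\<^sub>R 1 - h) \<le> T" "norm (U *\<^sub>R 1 - k) \<le> U"
    using assms by (auto simp: positive_def)
  then have "norm ((T + U) *\<^sub>R 1 - (h + k)) \<le> T + U"
    using norm_triangle_ineq[of "T *\<^sub>R 1 - h" "U *\<^sub>R 1 - k"] by (simp add: algebra_simps)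
  then show ?thesis using assms by (auto simp: positive_def star_simps)
qed

lemma positive_scaleR: assumes "positive h" "0 \<le> r" shows "positive (r *\<^sub>R h)"
proof -
  obtain T where "norm (T *\<^sub>R 1 - h) \<le> T" using assms by (auto simp: positive_def)
  then have "norm (r *\<^sub>R (T *\<^sub>R 1 - h)) \<le> r * T" using assms(2) by (simp add: mult_left_mono)
  then have "norm ((r * T) *\<^sub>R 1 - r *\<^sub>R h) \<le> r * T" by (simp add: scaleR_diff_right)
  then show ?thesis using assms(1) by (auto simp: positive_def star_simps)
qed

lemma positive_zero [simp]: "positive 0"
  by (auto simp: positive_def intro!: exI[of _ 0])

lemma positive_sum: "(\<And>i. i \<in> I \<Longrightarrow> positive (f i)) \<Longrightarrow> positive (\<Sum>i\<in>I. f i)"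
  by (induction I rule: infinite_finite_induct) (simp_all add: positive_add)

lemma positive_norm_diff: "x\<^sup>\<star> = x \<Longrightarrow> norm x \<le> r \<Longrightarrow> positive (r *\<^sub>R 1 - x)"
  by (auto simp: positive_def star_simps intro!: exI[of _ r])

lemma positive_scalar:
  assumes "positive (c *\<^sub>C (1::'a::unital_cstar_algebra))"
  shows "Im c = 0" "0 \<le> Re c"
proof -
  have "cnj c = c" using assms by (simp add: positive_def star_simps)
  then show im: "Im c = 0" by (simp add: complex_eq_iff)
  obtain T where "norm (T *\<^sub>R 1 - c *\<^sub>C (1::'a)) \<le> T" using assms by (auto simp: positive_def)
  then have "cmod (of_real T - c) \<le> T"
    by (simp add: scaleR_one_eq_scaleC scaleC_diff_left[symmetric] norm_scaleC)
  then show "0 \<le> Re c" using abs_Re_le_cmod[of "of_real T - c"] by simp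
qed

lemma positive_sqrt:
  fixes h :: "'a::unital_cstar_algebra"
  assumes S: "cstar_subalgebra S" and h: "h \<in> S" "positive h"
  obtains s where "s \<in> S" "positive s" "s * s = h" "\<And>y. y * h = h * y \<Longrightarrow> y * s = s * y"
proof -
  obtain T where T: "norm (T *\<^sub>R 1 - h) \<le> T" using h by (auto simp: positive_def)
  have sa: "h\<^sup>\<star> = h" using h by (simp add: positive_def)
  show thesis
  proof (cases "T = 0")
    case True
    then have "h = 0" using T by simp
    then show thesis using that[of 0] subalg_zero[OF S] by simp
  next
    case False
    have T0: "0 < T" using T False norm_ge_zero[of "T *\<^sub>R 1 - h"] by linarith
    define x where "x = 1 - (1 / T) *\<^sub>R h"
    have "x = (1 / T) *\<^sub>R (T *\<^sub>R 1 - h)" using T0 by (simp add: x_def scaleR_diff_right)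
    then have "norm x = norm (T *\<^sub>R 1 - h) / T" using T0 by simp
    then have nx: "norm x \<le> 1" using T T0 by simp
    have xS: "x \<in> S" unfolding x_def by (intro subalg_intros[OF S] h)
    have xs: "x\<^sup>\<star> = x" by (simp add: x_def star_simps sa)
    obtain s where s: "s \<in> S" "s\<^sup>\<star> = s" "s * s = 1 - x" "norm (1 - s) \<le> 1"
      and comm: "\<And>y. y * x = x * y \<Longrightarrow> y * s = s * y"
      using subalgebra_sqrt_one_minus[OF S xS xs nx] by blast
    show thesis
    proof (rule that[of "sqrt T *\<^sub>R s"])
      show "sqrt T *\<^sub>R s \<in> S" by (intro subalg_intros[OF S] s)
      have "positive s" using s by (auto simp: positive_def intro!: exI[of _ 1])
      then show "positive (sqrt T *\<^sub>R s)" using T0 by (intro positive_scaleR) simp_all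
      show "sqrt T *\<^sub>R s * sqrt T *\<^sub>R s = h" using T0 by (simp add: s x_def)
      show "y * sqrt T *\<^sub>R s = sqrt T *\<^sub>R s * y" if "y * h = h * y" for y
        using comm[of y] that by (simp add: x_def algebra_simps)
    qed
  qed
qed

lemma cstar_subalgebra_UNIV: "cstar_subalgebra UNIV"
  by (simp add: cstar_subalgebra_def)

text \<open>The element \<open>u = s + i t\<close> satisfies \<open>u\<^sup>* u = s\<^sup>2 + t\<^sup>2\<close>.\<close>

lemma norm_pair_le:
  fixes s t :: "'a::unital_cstar_algebra"
  assumes "s\<^sup>\<star> = s" "t\<^sup>\<star> = t" "s * t = t * s" "norm (s * s + t * t) \<le> r\<^sup>2" "0 \<le> r"
  shows "norm s \<le> r" "norm t \<le> r"
proof -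
  define u where "u = s + \<i> *\<^sub>C t"
  have us: "u\<^sup>\<star> = s - \<i> *\<^sub>C t" using assms by (simp add: u_def star_simps scaleC_minus_left)
  have "u\<^sup>\<star> * u = s * s + t * t"
    unfolding us using assms(3)
    by (simp add: u_def algebra_simps scaleC_mult_left scaleC_mult_right scaleC_scaleC
        scaleC_minus_left scaleC_diff_right scaleC_add_right)
  then have "(norm u)\<^sup>2 \<le> r\<^sup>2" using cstar_identity[of u] assms(4) by simp
  then have nu: "norm u \<le> r" using assms(5) by (simp add: power2_le_iff_abs_le)
  have "2 *\<^sub>R s = u + u\<^sup>\<star>" unfolding us by (simp add: u_def scaleR_2)
  then have "2 * norm s \<le> norm u + norm (u\<^sup>\<star>)"
    using norm_triangle_ineq[of u "u\<^sup>\<star>"] by (metis abs_numeral norm_scaleR)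
  then show "norm s \<le> r" using nu by simp
  have "2 *\<^sub>R (\<i> *\<^sub>C t) = u - u\<^sup>\<star>" unfolding us by (simp add: u_def scaleR_2)
  then have "2 * norm (\<i> *\<^sub>C t) \<le> norm u + norm (u\<^sup>\<star>)"
    using norm_triangle_ineq4[of u "u\<^sup>\<star>"] by (metis abs_numeral norm_scaleR)
  then show "norm t \<le> r" using nu by (simp add: norm_scaleC)
qed

text \<open>For a self-adjoint contraction \<open>b\<close>, the element \<open>b + i sqrt (1 - b\<^sup>2)\<close> is unitary, so that
  \<open>norm (1 - b\<^sup>2) \<le> 1\<close>.\<close>

lemma positive_square:
  fixes a :: "'a::unital_cstar_algebra"
  assumes "a\<^sup>\<star> = a"
  shows "positive (a * a)"
proof (cases "a = 0")
  case False
  define b where "b = (1 / norm a) *\<^sub>R a"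
  have b: "b\<^sup>\<star> = b" "norm b = 1" using False assms by (simp_all add: b_def star_simps)
  have "norm (b * b) \<le> 1" using norm_mult_ineq[of b b] b by simp
  then obtain s where s: "s\<^sup>\<star> = s" "s * s = 1 - b * b" "s * b = b * s"
    using subalgebra_sqrt_one_minus[OF cstar_subalgebra_UNIV, of "b * b"] b
    by (metis (no_types, lifting) UNIV_I mult.assoc star_mult)
  have "norm s \<le> 1" using norm_pair_le(1)[of s b 1] s b by simp
  then have "norm (s * s) \<le> 1"
    using norm_mult_ineq[of s s] by (metis dual_order.trans mult_le_one norm_ge_zero)
  then have "positive (b * b)"
    using b by (auto simp: positive_def star_simps s intro!: exI[of _ 1])
  from positive_scaleR[OF this, of "(norm a)\<^sup>2"] False show ?thesis
    by (simp add: b_def power2_eq_square)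
qed simp

text \<open>Commuting square roots \<open>s\<close>, \<open>t\<close> of \<open>r - c\<close> and \<open>r + c\<close> satisfy \<open>s\<^sup>2 + t\<^sup>2 = 2 r\<close>.\<close>

lemma norm_le_of_positive:
  fixes c :: "'a::unital_cstar_algebra"
  assumes p: "positive (r *\<^sub>R 1 - c)" "positive (r *\<^sub>R 1 + c)"
  shows "norm c \<le> 2 * r"
proof -
  obtain s where sp: "positive s" and s2: "s * s = r *\<^sub>R 1 - c"
    and sc: "\<And>y. y * (r *\<^sub>R 1 - c) = (r *\<^sub>R 1 - c) * y \<Longrightarrow> y * s = s * y"
    using positive_sqrt[OF cstar_subalgebra_UNIV UNIV_I p(1)] by blast
  obtain t where tp: "positive t" and t2: "t * t = r *\<^sub>R 1 + c"
    and tc: "\<And>y. y * (r *\<^sub>R 1 + c) = (r *\<^sub>R 1 + c) * y \<Longrightarrow> y * t = t * y"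
    using positive_sqrt[OF cstar_subalgebra_UNIV UNIV_I p(2)] by blast
  note s = positive_selfadjoint[OF sp] s2 and t = positive_selfadjoint[OF tp] t2
  have "c * s = s * c" by (rule sc) (simp add: algebra_simps)
  then have st: "s * t = t * s" by (intro tc) (simp add: algebra_simps)
  have sum: "s * s + t * t = (2 * r) *\<^sub>R 1" by (simp add: s t scaleR_2 flip: scaleR_scaleR)
  have "positive ((2 * r) *\<^sub>R (1::'a))" using positive_add[OF p] by (simp add: scaleR_2 flip: scaleR_scaleR)
  then have r0: "0 \<le> r" using positive_scalar(2)[of "complex_of_real (2 * r)"] by (simp only: scaleR_one_eq_scaleC) simp
  have n: "norm s \<le> sqrt (2 * r)" "norm t \<le> sqrt (2 * r)"
    using norm_pair_le[OF s(1) t(1) st, of "sqrt (2 * r)"] r0 by (simp_all add: sum)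
  have "2 *\<^sub>R c = t * t - s * s" by (simp add: s t scaleR_2)
  then have "2 * norm c \<le> norm (t * t) + norm (s * s)"
    using norm_triangle_ineq4[of "t * t" "s * s"] by (metis abs_numeral norm_scaleR)
  also have "\<dots> \<le> sqrt (2 * r) * sqrt (2 * r) + sqrt (2 * r) * sqrt (2 * r)"
    by (intro add_mono order.trans[OF norm_mult_ineq] mult_mono n) (use r0 in auto)
  finally show ?thesis using r0 by simp
qed

lemma positive_antisym: "positive h \<Longrightarrow> positive (- h) \<Longrightarrow> h = 0"
  using norm_le_of_positive[of 0 h] by simp

lemma absolute_value:
  fixes h :: "'a::unital_cstar_algebra"
  assumes S: "cstar_subalgebra S" and h: "h \<in> S" "h\<^sup>\<star> = h"
  obtains r where "r \<in> S" "positive r" "r * r = h * h" "\<And>y. y * h = h * y \<Longrightarrow> y * r = r * y"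
proof (rule positive_sqrt[OF S subalg_mult[OF S h(1) h(1)] positive_square[OF h(2)]])
  fix r assume r: "r \<in> S" "positive r" "r * r = h * h"
    and comm: "\<And>y. y * (h * h) = h * h * y \<Longrightarrow> y * r = r * y"
  have "y * r = r * y" if "y * h = h * y" for y
    by (rule comm) (metis that mult.assoc)
  with r show thesis by (intro that)
qed

text \<open>This is half the sum of the squares of \<open>y + y\<^sup>*\<close> and \<open>i (y - y\<^sup>*)\<close>.\<close>

lemma positive_symmetrized: "positive (y * y\<^sup>\<star> + y\<^sup>\<star> * (y::'a::unital_cstar_algebra))"
proof -
  define a b where "a = y + y\<^sup>\<star>" and "b = \<i> *\<^sub>C (y - y\<^sup>\<star>)"
  have ab: "a\<^sup>\<star> = a" "b\<^sup>\<star> = b"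
    by (simp_all add: a_def b_def star_simps scaleC_minus_left scaleC_diff_right)
  have "a * a + b * b = 2 *\<^sub>R (y * y\<^sup>\<star> + y\<^sup>\<star> * y)"
    by (simp add: a_def b_def algebra_simps scaleC_mult_left scaleC_mult_right scaleC_scaleC
        scaleC_minus_left scaleC_diff_right scaleR_2)
  then have "y * y\<^sup>\<star> + y\<^sup>\<star> * y = (1 / 2) *\<^sub>R (a * a + b * b)" by simp
  also have "positive \<dots>"
    by (intro positive_scaleR positive_add positive_square ab) simp
  finally show ?thesis .
qed

text \<open>If the negative part of \<open>h = x\<^sup>* x\<close> did not vanish, compressing by it would give an element \<open>y\<close> with \<open>y\<^sup>* y\<close>
  negative, and then \<open>y y\<^sup>*\<close> is positive by the previous lemma.  The element \<open>z = y q\<close>, with \<open>q\<^sup>2 = - y\<^sup>* y\<close>, has both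
  \<open>z\<^sup>* z\<close> and \<open>z z\<^sup>*\<close> negative, and the previous lemma forces them to vanish.  This replaces the usual comparison
  of the spectra of \<open>y\<^sup>* y\<close> and \<open>y y\<^sup>*\<close>.\<close>

lemma positive_star_mult_self:
  fixes x :: "'a::unital_cstar_algebra"
  shows "positive (x\<^sup>\<star> * x)"
proof -
  define h where "h = x\<^sup>\<star> * x"
  have hs: "h\<^sup>\<star> = h" by (simp add: h_def star_simps)
  obtain r where r: "positive r" "r * r = h * h" "\<And>y. y * h = h * y \<Longrightarrow> y * r = r * y"
  proof (rule absolute_value[OF cstar_subalgebra_UNIV UNIV_I hs])
    fix r assume "r \<in> UNIV" "positive r" "r * r = h * h" "\<And>y. y * h = h * y \<Longrightarrow> y * r = r * y"
    then show thesis by (intro that)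
  qed
  have rs: "r\<^sup>\<star> = r" using r(1) by (simp add: positive_def)
  have rh: "h * r = r * h" by (rule r(3)) (rule refl)
  obtain t where t: "t\<^sup>\<star> = t" "t * t = r" "\<And>y. y * r = r * y \<Longrightarrow> y * t = t * y"
  proof (rule positive_sqrt[OF cstar_subalgebra_UNIV UNIV_I r(1)])
    fix t assume "t \<in> UNIV" "positive t" "t * t = r" "\<And>y. y * r = r * y \<Longrightarrow> y * t = t * y"
    then show thesis by (intro that positive_selfadjoint)
  qed
  \<comment> \<open>\<open>m\<close> is twice the negative part of \<open>h\<close>; it satisfies \<open>h m = - r m\<close>.\<close>
  define m where "m = r - h"
  have ms: "m\<^sup>\<star> = m" by (simp add: m_def star_simps hs rs)
  have hm: "h * m = - (r * m)" by (simp add: m_def algebra_simps rh r(2))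
  have tm: "m * t = t * m" using t(3)[of m] by (simp add: m_def algebra_simps rh)
  define q where "q = t * m"
  have qs: "q\<^sup>\<star> = q" by (simp add: q_def star_simps t ms tm)
  define y where "y = x * m"
  have yy: "y\<^sup>\<star> * y = - (q * q)"
  proof -
    have "y\<^sup>\<star> * y = m * (h * m)" by (simp add: y_def star_simps ms h_def mult.assoc)
    also have "\<dots> = - (m * (t * t * m))" by (simp add: hm t)
    also have "m * (t * t * m) = q * q" by (simp add: q_def mult.assoc) (metis tm mult.assoc)
    finally show ?thesis .
  qed
  have "y * y\<^sup>\<star> = (y * y\<^sup>\<star> + y\<^sup>\<star> * y) + q * q" by (simp add: yy)
  also have "positive \<dots>" by (intro positive_add positive_symmetrized positive_square qs)
  finally have "positive (y * y\<^sup>\<star>)" .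
  then obtain p where p: "p\<^sup>\<star> = p" "p * p = y * y\<^sup>\<star>"
    using positive_sqrt[OF cstar_subalgebra_UNIV UNIV_I] positive_selfadjoint by metis

  define z where "z = y * q"
  define P Q where "P = p * p" and "Q = q * q"
  have PQ: "P\<^sup>\<star> = P" "Q\<^sup>\<star> = Q" by (simp_all add: P_def Q_def star_simps p qs)
  have zz: "z\<^sup>\<star> * z = - (Q * Q)"
  proof -
    have "z\<^sup>\<star> * z = q * (y\<^sup>\<star> * y) * q" by (simp add: z_def star_simps qs mult.assoc)
    then show ?thesis by (simp add: yy Q_def mult.assoc)
  qed
  have zz': "z * z\<^sup>\<star> = - (P * P)"
  proof -
    have "z * z\<^sup>\<star> = y * (q * q) * y\<^sup>\<star>" by (simp add: z_def star_simps qs mult.assoc)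
    also have "q * q = - (y\<^sup>\<star> * y)" by (simp add: yy)
    finally show ?thesis by (simp add: P_def p mult.assoc)
  qed
  have "- (P * P) = (z * z\<^sup>\<star> + z\<^sup>\<star> * z) + Q * Q" by (simp add: zz zz')
  also have "positive \<dots>" by (intro positive_add positive_symmetrized positive_square PQ)
  finally have "positive (- (P * P))" .
  then have "P * P = 0" using positive_antisym[OF positive_square[OF PQ(1)]] by simp
  then have "P = 0" using star_mult_eq_0_iff[of P] PQ by simp
  then have "y = 0" using star_mult_eq_0_iff[of "y\<^sup>\<star>"] p
    by (metis P_def star_star star_zero)
  then have "q = 0" using yy star_mult_eq_0_iff[of q] qs by simp
  \<comment> \<open>Hence \<open>m\<^sup>3 = 2 r m\<^sup>2\<close> vanishes, so that \<open>h\<close> is its own absolute value.\<close>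
  then have rm: "r * m = 0" using t(2) by (metis q_def mult.assoc mult_zero_right)
  have "m * m = r * m - h * m" by (simp add: m_def algebra_simps)
  then have "m * m = 0" by (simp add: hm rm)
  then have "m = 0" using star_mult_eq_0_iff[of m] ms by simp
  then have "h = r" by (simp add: m_def)
  then show ?thesis using r(1) by (simp add: h_def)
qed

lemma cstar_positive_iff: "cstar_positive h \<longleftrightarrow> positive h"
proof
  assume "positive h"
  then show "cstar_positive h"
    using positive_sqrt[OF cstar_subalgebra_UNIV UNIV_I] positive_selfadjoint by (metis cstar_positive_def)
qed (auto simp: cstar_positive_def positive_star_mult_self)

lemma positive_mult_star_self: "positive (x * (x::'a::unital_cstar_algebra)\<^sup>\<star>)"
  using positive_star_mult_self[of "x\<^sup>\<star>"] by (simp add: star_star)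

lemma sum_star_mult_eq_0D:
  fixes x :: "'i \<Rightarrow> 'a::unital_cstar_algebra"
  assumes fin: "finite I" and sum: "(\<Sum>i\<in>I. (x i)\<^sup>\<star> * x i) = 0" and i: "i \<in> I"
  shows "x i = 0"
proof -
  have "(\<Sum>j\<in>I - {i}. (x j)\<^sup>\<star> * x j) = - ((x i)\<^sup>\<star> * x i)"
    using sum sum.remove[OF fin i, of "\<lambda>j. (x j)\<^sup>\<star> * x j"]
    by (metis add.commute eq_neg_iff_add_eq_0)
  moreover have "positive (\<Sum>j\<in>I - {i}. (x j)\<^sup>\<star> * x j)"
    by (intro positive_sum positive_star_mult_self)
  ultimately have "positive (- ((x i)\<^sup>\<star> * x i))" by simp
  then have "(x i)\<^sup>\<star> * x i = 0" by (rule positive_antisym[OF positive_star_mult_self])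
  then show ?thesis by (simp add: star_mult_eq_0_iff)
qed

section \<open>The centre of a simple algebra\<close>

text \<open>If \<open>z\<close> is central and self-adjoint and \<open>r\<close> is its absolute value, then \<open>(r + z) (r - z) = 0\<close>, so the
  annihilator of \<open>r - z\<close> is a closed ideal which contains \<open>r + z\<close>; by simplicity one factor vanishes,
  and every central self-adjoint element is comparable with \<open>0\<close>.  Applied to the translates of \<open>z\<close>
  this makes \<open>z\<close> a scalar, by a Dedekind cut.\<close>

lemma simple_central_selfadjoint:
  fixes z :: "'a::unital_cstar_algebra"
  assumes simple: "simple_cstar S" and z: "z \<in> S" "z\<^sup>\<star> = z" and central: "\<And>x. x \<in> S \<Longrightarrow> x * z = z * x"
  shows "\<exists>k. z = k *\<^sub>R 1"
proof -
  have S: "cstar_subalgebra S" using simple by (simp add: simple_cstar_def)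
  have cmp: "positive (z - k *\<^sub>R 1) \<or> positive (k *\<^sub>R 1 - z)" for k
  proof -
    define h where "h = z - k *\<^sub>R 1"
    have h: "h \<in> S" "h\<^sup>\<star> = h" and hc: "\<And>x. x \<in> S \<Longrightarrow> x * h = h * x"
      using z central by (simp_all add: h_def star_simps subalg_intros[OF S] algebra_simps)
    obtain r where r: "r \<in> S" "positive r" "r * r = h * h" and comm: "\<And>y. y * h = h * y \<Longrightarrow> y * r = r * y"
      using absolute_value[OF S h] by blast
    define m where "m = r - h"
    have mc: "x * m = m * x" if "x \<in> S" for x
      using hc[OF that] comm[of x] by (simp add: m_def algebra_simps)
    define J where "J = {x \<in> S. x * m = 0}"
    have "closed_ideal S J"
      unfolding closed_ideal_def
    proof (intro conjI ballI)
      have "J = S \<inter> {x. x * m = 0}" by (auto simp: J_def)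
      then show "closed J"
        by (auto intro!: closed_Int subalg_closed[OF S] closed_Collect_eq continuous_intros)
      fix x s assume "x \<in> J" "s \<in> S"
      then show "s * x \<in> J" "x * s \<in> J"
        by (auto simp: J_def subalg_mult[OF S] mult.assoc mc) (metis mc mult.assoc mult_zero_left)
    qed (auto simp: J_def subalg_zero[OF S] subalg_add[OF S] distrib_right)
    then consider "J = {0}" | "J = S" using simple by (auto simp: simple_cstar_def)
    then show ?thesis
    proof cases
      case 1
      have "(r + h) * m = 0" using comm[of h] by (simp add: m_def algebra_simps r)
      then have "r + h \<in> J" by (simp add: J_def r h subalg_add[OF S])
      then have "- h = r" using 1 by (simp add: add_eq_0_iff2)
      then show ?thesis using r(2) by (simp add: h_def)
    next
      case 2
      then have "1 \<in> J" using subalg_one[OF S] by simp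
      then have "h = r" by (simp add: J_def m_def)
      then show ?thesis using r(2) by (simp add: h_def)
    qed
  qed
  define L where "L = {k. positive (z - k *\<^sub>R 1)}"
  have L0: "- norm z \<in> L"
    using positive_norm_diff[of "- z" "norm z"] z by (simp add: L_def star_simps add.commute)
  have up: "k \<le> norm z" if "k \<in> L" for k
  proof -
    have "positive ((norm z *\<^sub>R 1 - z) + (z - k *\<^sub>R 1))"
      using that z by (intro positive_add positive_norm_diff) (simp_all add: L_def)
    then have "positive (complex_of_real (norm z - k) *\<^sub>C (1::'a))"
      by (simp add: scaleC_diff_left scaleC_of_real)
    from positive_scalar(2)[OF this] show ?thesis by simp
  qed
  then have bdd: "bdd_above L" by (auto simp: bdd_above_def)
  define k where "k = Sup L"
  have "norm (z - k *\<^sub>R 1) \<le> 2 * \<epsilon>" if \<epsilon>: "0 < \<epsilon>" for \<epsilon>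
  proof (rule norm_le_of_positive)
    have "k + \<epsilon> \<notin> L" using cSup_upper[OF _ bdd, of "k + \<epsilon>"] \<epsilon> by (auto simp: k_def)
    then show "positive (\<epsilon> *\<^sub>R 1 - (z - k *\<^sub>R 1))"
      using cmp[of "k + \<epsilon>"] by (simp add: L_def algebra_simps)
    obtain k' where k': "k' \<in> L" "k - \<epsilon> < k'"
      using less_cSupE[of "k - \<epsilon>" L] L0 \<epsilon> by (auto simp: k_def)
    have "positive ((z - k' *\<^sub>R 1) + (k' - (k - \<epsilon>)) *\<^sub>R 1)"
      using k' positive_square[of "1::'a"] by (intro positive_add positive_scaleR) (simp_all add: L_def)
    then show "positive (\<epsilon> *\<^sub>R 1 + (z - k *\<^sub>R 1))" by (simp add: algebra_simps)
  qed
  then have "norm (z - k *\<^sub>R 1) \<le> \<delta>" if "0 < \<delta>" for \<delta> using that by (metis half_gt_zero mult_2 field_sum_of_halves)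
  then have "norm (z - k *\<^sub>R 1) \<le> 0" by (rule field_le_epsilon) simp
  then show ?thesis by auto
qed

lemma simple_central_scalar:
  fixes z :: "'a::unital_cstar_algebra"
  assumes simple: "simple_cstar S" and z: "z \<in> S" and central: "\<And>x. x \<in> S \<Longrightarrow> x * z = z * x"
  shows "\<exists>k. z = k *\<^sub>C 1"
proof -
  have S: "cstar_subalgebra S" using simple by (simp add: simple_cstar_def)
  have cs: "x * z\<^sup>\<star> = z\<^sup>\<star> * x" if "x \<in> S" for x
    using central[OF subalg_star[OF S that]] by (metis star_mult star_star)
  obtain k where k: "z + z\<^sup>\<star> = k *\<^sub>R 1"
    using simple_central_selfadjoint[OF simple, of "z + z\<^sup>\<star>"]
    by (auto simp: subalg_intros[OF S] z star_simps central cs algebra_simps)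
  have "\<exists>k. \<i> *\<^sub>C (z - z\<^sup>\<star>) = k *\<^sub>R 1"
  proof (rule simple_central_selfadjoint[OF simple])
    show "\<i> *\<^sub>C (z - z\<^sup>\<star>) \<in> S" by (intro subalg_intros[OF S] z)
    show "(\<i> *\<^sub>C (z - z\<^sup>\<star>))\<^sup>\<star> = \<i> *\<^sub>C (z - z\<^sup>\<star>)" by (simp add: star_simps scaleC_minus_left scaleC_diff_right)
    show "x * \<i> *\<^sub>C (z - z\<^sup>\<star>) = \<i> *\<^sub>C (z - z\<^sup>\<star>) * x" if "x \<in> S" for x
      using central[OF that] cs[OF that] by (simp add: scaleC_mult_left scaleC_mult_right algebra_simps)
  qed
  then obtain k' where k': "\<i> *\<^sub>C (z - z\<^sup>\<star>) = k' *\<^sub>R 1" by blast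
  have "z = (1/2) *\<^sub>R ((z + z\<^sup>\<star>) - \<i> *\<^sub>C \<i> *\<^sub>C (z - z\<^sup>\<star>))"
    by (simp add: scaleC_scaleC scaleC_minus_left scaleR_2[symmetric])
  also have "\<dots> = ((of_real k - \<i> * of_real k') / 2) *\<^sub>C 1"
    by (simp add: k k' scaleR_one_eq_scaleC scaleC_scaleC scaleC_diff_left[symmetric]
        flip: scaleC_of_real)
  finally show ?thesis by blast
qed


section \<open>Conditional expectations with a quasi-basis\<close>

locale index_expectation =
  fixes S R :: "'a::unital_cstar_algebra set" and F :: "'a \<Rightarrow> 'a" and I :: "'i set" and l :: "'i \<Rightarrow> 'a"
  assumes subalgebra_S: "cstar_subalgebra S" and subalgebra_R: "cstar_subalgebra R"
    and expectation: "conditional_expectation S R F"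
    and finite_I: "finite I" and basis_in: "\<And>i. i \<in> I \<Longrightarrow> l i \<in> S"
    and basis: "\<And>x. x \<in> S \<Longrightarrow> (\<Sum>i\<in>I. l i * F ((l i)\<^sup>\<star> * x)) = x"
begin

lemma R_sub_S: "b \<in> R \<Longrightarrow> b \<in> S"
  and F_in: "x \<in> S \<Longrightarrow> F x \<in> R"
  and F_id: "b \<in> R \<Longrightarrow> F b = b"
  and F_add: "x \<in> S \<Longrightarrow> y \<in> S \<Longrightarrow> F (x + y) = F x + F y"
  and F_scaleC: "x \<in> S \<Longrightarrow> F (c *\<^sub>C x) = c *\<^sub>C F x"
  and F_bimodule: "b \<in> R \<Longrightarrow> b' \<in> R \<Longrightarrow> x \<in> S \<Longrightarrow> F (b * x * b') = b * F x * b'"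
  and F_positive: "x \<in> S \<Longrightarrow> positive (F (x\<^sup>\<star> * x))"
  using expectation by (auto simp: conditional_expectation_def cstar_positive_iff)

lemmas S_intros = subalg_intros[OF subalgebra_S] F_in F_in[THEN R_sub_S] basis_in
lemmas S_simps = S_intros R_sub_S
lemmas R_intros = subalg_intros[OF subalgebra_R]

lemma F_left: "b \<in> R \<Longrightarrow> x \<in> S \<Longrightarrow> F (b * x) = b * F x"
  using F_bimodule[of b 1 x] by (simp add: R_intros)

lemma F_right: "b \<in> R \<Longrightarrow> x \<in> S \<Longrightarrow> F (x * b) = F x * b"
  using F_bimodule[of 1 b x] by (simp add: R_intros)

lemma F_scaleR: "x \<in> S \<Longrightarrow> F (r *\<^sub>R x) = r *\<^sub>R F x"
  using F_scaleC[of x "complex_of_real r"] by (simp add: scaleC_of_real)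

lemma F_zero: "F 0 = 0"
  by (rule F_id) (rule R_intros)

lemma F_one: "F 1 = 1"
  by (rule F_id) (rule R_intros)

lemma F_minus: "x \<in> S \<Longrightarrow> F (- x) = - F x"
  using F_scaleR[of x "- 1"] by simp

lemma F_diff: "x \<in> S \<Longrightarrow> y \<in> S \<Longrightarrow> F (x - y) = F x - F y"
  using F_add[of x "- y"] by (simp add: F_minus S_simps)

lemma F_sum: "(\<And>j. j \<in> J \<Longrightarrow> f j \<in> S) \<Longrightarrow> F (\<Sum>j\<in>J. f j) = (\<Sum>j\<in>J. F (f j))"
  by (induction J rule: infinite_finite_induct) (simp_all add: F_zero F_add S_intros)

text \<open>Polarization: \<open>F\<close> maps \<open>(x + 1)\<^sup>* (x + 1)\<close> and \<open>(x + i)\<^sup>* (x + i)\<close> to self-adjoint elements.\<close>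

lemma F_star: assumes x: "x \<in> S" shows "F (x\<^sup>\<star>) = (F x)\<^sup>\<star>"
proof -
  have xs: "x\<^sup>\<star> \<in> S" "x\<^sup>\<star> * x \<in> S" by (intro S_intros x)+
  have sa: "(F (y\<^sup>\<star> * y))\<^sup>\<star> = F (y\<^sup>\<star> * y)" if "y \<in> S" for y
    using F_positive[OF that] by (simp add: positive_def)
  have a: "(F x)\<^sup>\<star> + (F (x\<^sup>\<star>))\<^sup>\<star> = F x + F (x\<^sup>\<star>)"
  proof -
    have "F ((x + 1)\<^sup>\<star> * (x + 1)) = F (x\<^sup>\<star> * x) + (F x + F (x\<^sup>\<star>)) + 1"
      using x xs by (simp add: star_simps algebra_simps F_add F_one S_simps)
    with sa[of "x + 1"] sa[OF x] show ?thesis by (simp add: star_simps S_simps x add.commute)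
  qed
  have b: "(F (x\<^sup>\<star>))\<^sup>\<star> - (F x)\<^sup>\<star> = F x - F (x\<^sup>\<star>)"
  proof -
    have "(x + \<i> *\<^sub>C 1)\<^sup>\<star> * (x + \<i> *\<^sub>C 1) = x\<^sup>\<star> * x + \<i> *\<^sub>C (x\<^sup>\<star> - x) + 1"
      by (simp add: star_simps algebra_simps scaleC_mult_left scaleC_mult_right scaleC_scaleC
          scaleC_minus_left scaleC_diff_right scaleC_add_right)
    then have e: "F ((x + \<i> *\<^sub>C 1)\<^sup>\<star> * (x + \<i> *\<^sub>C 1)) = F (x\<^sup>\<star> * x) + \<i> *\<^sub>C (F (x\<^sup>\<star>) - F x) + 1"
      using x xs by (simp add: F_add F_diff F_scaleC F_one S_simps)
    have "(\<i> *\<^sub>C (F (x\<^sup>\<star>) - F x))\<^sup>\<star> = \<i> *\<^sub>C (F (x\<^sup>\<star>) - F x)"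
      using sa[of "x + \<i> *\<^sub>C 1"] sa[OF x] unfolding e by (simp add: star_add S_simps x)
    then have "\<i> *\<^sub>C ((F x)\<^sup>\<star> - (F (x\<^sup>\<star>))\<^sup>\<star>) = \<i> *\<^sub>C (F (x\<^sup>\<star>) - F x)"
      by (simp add: star_simps scaleC_minus_left scaleC_diff_right)
    then have "\<i> *\<^sub>C (((F x)\<^sup>\<star> - (F (x\<^sup>\<star>))\<^sup>\<star>) - (F (x\<^sup>\<star>) - F x)) = 0"
      by (simp add: scaleC_diff_right)
    then have "((F x)\<^sup>\<star> - (F (x\<^sup>\<star>))\<^sup>\<star>) - (F (x\<^sup>\<star>) - F x) = 0" by (simp only: scaleC_eq_0_iff) simp
    then show ?thesis by (simp add: algebra_simps)
  qed
  have "2 *\<^sub>R (F x)\<^sup>\<star> = ((F x)\<^sup>\<star> + (F (x\<^sup>\<star>))\<^sup>\<star>) - ((F (x\<^sup>\<star>))\<^sup>\<star> - (F x)\<^sup>\<star>)"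
    by (simp add: scaleR_2)
  also have "\<dots> = 2 *\<^sub>R F (x\<^sup>\<star>)" unfolding a b by (simp add: scaleR_2)
  finally show ?thesis by simp
qed

lemma basis': assumes x: "x \<in> S" shows "(\<Sum>i\<in>I. F (x * l i) * (l i)\<^sup>\<star>) = x"
proof -
  have "(\<Sum>i\<in>I. F (x * l i) * (l i)\<^sup>\<star>) = (\<Sum>i\<in>I. l i * F ((l i)\<^sup>\<star> * x\<^sup>\<star>))\<^sup>\<star>"
    unfolding star_sum using x by (intro sum.cong refl) (simp add: star_simps F_star[symmetric] S_simps)
  also have "\<dots> = x" using basis[of "x\<^sup>\<star>"] x by (simp add: star_star S_simps)
  finally show ?thesis .
qed

lemma F_eqI:
  assumes "u \<in> S" "v \<in> S" "\<And>z. z \<in> S \<Longrightarrow> F (z * u) = F (z * v)"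
  shows "u = v"
proof -
  have "(\<Sum>i\<in>I. l i * F ((l i)\<^sup>\<star> * u)) = (\<Sum>i\<in>I. l i * F ((l i)\<^sup>\<star> * v))"
    by (intro sum.cong refl arg_cong2[of _ _ _ _ "(*)"] assms(3) S_intros)
  then show ?thesis by (simp only: basis[OF assms(1)] basis[OF assms(2)])
qed

abbreviation average :: "'a \<Rightarrow> 'a" where
  "average x \<equiv> (\<Sum>i\<in>I. l i * x * (l i)\<^sup>\<star>)"

lemma F_commute: "c \<in> rel_commutant R S \<Longrightarrow> b \<in> R \<Longrightarrow> F c * b = b * F c"
  using F_left[of b c] F_right[of b c] by (simp add: rel_commutant_def)

text \<open>The tensor \<open>\<Sum>\<^sub>i l\<^sub>i \<otimes>\<^sub>R l\<^sub>i\<^sup>*\<close> commutes with \<open>S\<close>.\<close>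

lemma average_commute:
  assumes x: "\<And>b. b \<in> R \<Longrightarrow> b * x = x * b" and y: "y \<in> S"
  shows "y * average x = average x * y"
proof -
  have "y * average x = (\<Sum>i\<in>I. (\<Sum>j\<in>I. l j * F ((l j)\<^sup>\<star> * (y * l i))) * (x * (l i)\<^sup>\<star>))"
    unfolding sum_distrib_left by (intro sum.cong refl) (simp add: basis S_simps y mult.assoc)
  also have "\<dots> = (\<Sum>i\<in>I. \<Sum>j\<in>I. l j * x * (F ((l j)\<^sup>\<star> * y * l i) * (l i)\<^sup>\<star>))"
    unfolding sum_distrib_right
  proof (intro sum.cong refl)
    fix i j assume "i \<in> I" "j \<in> I"
    then have "F ((l j)\<^sup>\<star> * (y * l i)) * x = x * F ((l j)\<^sup>\<star> * (y * l i))"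
      by (intro x S_intros y)
    then show "l j * F ((l j)\<^sup>\<star> * (y * l i)) * (x * (l i)\<^sup>\<star>) = l j * x * (F ((l j)\<^sup>\<star> * y * l i) * (l i)\<^sup>\<star>)"
      by (metis mult.assoc)
  qed
  also have "\<dots> = (\<Sum>j\<in>I. l j * x * (\<Sum>i\<in>I. F ((l j)\<^sup>\<star> * y * l i) * (l i)\<^sup>\<star>))"
    by (subst sum.swap) (simp add: sum_distrib_left)
  also have "\<dots> = (\<Sum>j\<in>I. l j * x * ((l j)\<^sup>\<star> * y))"
    by (intro sum.cong refl) (simp add: basis' S_simps y)
  also have "\<dots> = average x * y" by (simp add: sum_distrib_right mult.assoc)
  finally show ?thesis .
qed

lemma average_in: "x \<in> S \<Longrightarrow> average x \<in> S"
  by (intro S_intros)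

lemma index_unique:
  assumes fin: "finite J" and m: "\<And>j. j \<in> J \<Longrightarrow> m j \<in> S"
    and bas: "\<And>x. x \<in> S \<Longrightarrow> (\<Sum>j\<in>J. m j * F ((m j)\<^sup>\<star> * x)) = x"
  shows "(\<Sum>j\<in>J. m j * (m j)\<^sup>\<star>) = (\<Sum>i\<in>I. l i * (l i)\<^sup>\<star>)"
proof -
  have "(\<Sum>i\<in>I. l i * (l i)\<^sup>\<star>) = (\<Sum>i\<in>I. (\<Sum>j\<in>J. m j * F ((m j)\<^sup>\<star> * l i)) * (l i)\<^sup>\<star>)"
    by (intro sum.cong refl) (simp add: bas basis_in)
  also have "\<dots> = (\<Sum>j\<in>J. m j * (\<Sum>i\<in>I. F ((m j)\<^sup>\<star> * l i) * (l i)\<^sup>\<star>))"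
    unfolding sum_distrib_right sum_distrib_left by (subst sum.swap) (simp add: mult.assoc)
  also have "\<dots> = (\<Sum>j\<in>J. m j * (m j)\<^sup>\<star>)"
    by (intro sum.cong refl) (simp add: basis' S_simps m)
  finally show ?thesis ..
qed

lemma average_one_nonzero: "average 1 \<noteq> 0"
proof
  assume "average 1 = 0"
  then have "(\<Sum>i\<in>I. ((l i)\<^sup>\<star>)\<^sup>\<star> * (l i)\<^sup>\<star>) = 0" by (simp add: star_star)
  then have "(l i)\<^sup>\<star> = 0" if "i \<in> I" for i
    using sum_star_mult_eq_0D[OF finite_I _ that, of "\<lambda>i. (l i)\<^sup>\<star>"] by blast
  then have "(\<Sum>i\<in>I. l i * F ((l i)\<^sup>\<star> * 1)) = 0" by (simp add: F_zero)
  then show False using basis[OF S_intros(1)] by simp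
qed

end

lemma index_expectation_of_quasi_basis:
  assumes "cstar_subalgebra S" "cstar_subalgebra R" "conditional_expectation S R F" "quasi_basis S F n l"
  shows "index_expectation S R F {..<n} l"
  using assms by unfold_locales (auto simp: quasi_basis_def)

lemma (in index_expectation) watatani_index_eq:
  assumes "quasi_basis S F n m"
  shows "watatani_index S F = (\<Sum>i\<in>I. l i * (l i)\<^sup>\<star>)"
proof -
  have uniq: "(\<Sum>i<k. p i * (p i)\<^sup>\<star>) = (\<Sum>i\<in>I. l i * (l i)\<^sup>\<star>)" if "quasi_basis S F k p" for k p
    using that by (intro index_unique) (auto simp: quasi_basis_def)
  show ?thesis
    unfolding watatani_index_def
    by (rule the_equality) (use uniq assms in \<open>auto intro: uniq[symmetric]\<close>)
qed


section \<open>Balanced expectations and their traces\<close>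

text \<open>For an inclusion of simple algebras, minimality of the index amounts to the requirement that
  \<open>c \<mapsto> \<Sum>\<^sub>i l\<^sub>i c l\<^sub>i\<^sup>*\<close> is a multiple of \<open>F\<close> on the relative commutant.  This form
  passes to basic constructions and to composites, and everything that is needed about the trace
  is derived from it.\<close>

locale balanced_expectation = index_expectation S R F I l
  for S R :: "'a::unital_cstar_algebra set" and F :: "'a \<Rightarrow> 'a" and I :: "'i set" and l :: "'i \<Rightarrow> 'a" +
  fixes t :: real
  assumes t_pos: "0 < t"
    and centre_R: "\<And>c. c \<in> R \<Longrightarrow> (\<And>b. b \<in> R \<Longrightarrow> c * b = b * c) \<Longrightarrow> \<exists>k. c = k *\<^sub>C 1"
    and balance: "\<And>c. c \<in> rel_commutant R S \<Longrightarrow> average c = (1 / t) *\<^sub>R F c"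
begin

abbreviation P :: "'a set" where "P \<equiv> rel_commutant R S"

lemma P_S: "c \<in> P \<Longrightarrow> c \<in> S"
  and P_comm: "c \<in> P \<Longrightarrow> b \<in> R \<Longrightarrow> c * b = b * c"
  by (auto simp: rel_commutant_def)

lemma subalgebra_P: "cstar_subalgebra P"
  using subalgebra_S subalg_star[OF subalgebra_R] by (rule cstar_subalgebra_rel_commutant)

lemmas P_intros = subalg_intros[OF subalgebra_P]

lemma F_scalar: assumes c: "c \<in> P" shows "\<exists>k. F c = k *\<^sub>C 1"
proof (rule centre_R)
  show "F c \<in> R" by (intro F_in P_S c)
  show "F c * b = b * F c" if "b \<in> R" for b
    using c that by (rule F_commute)
qed

text \<open>If \<open>F (x\<^sup>* x) = 0\<close>, then by balance the sum of the positive elements \<open>l\<^sub>i x\<^sup>* x l\<^sub>i\<^sup>*\<close> vanishes.\<close>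

lemma F_faithful: assumes x: "x \<in> P" and F0: "F (x\<^sup>\<star> * x) = 0" shows "x = 0"
proof -
  have "average (x\<^sup>\<star> * x) = 0" using balance[of "x\<^sup>\<star> * x"] by (simp add: F0 P_intros x)
  then have s0: "(\<Sum>i\<in>I. (x * (l i)\<^sup>\<star>)\<^sup>\<star> * (x * (l i)\<^sup>\<star>)) = 0" by (simp add: star_simps mult.assoc)
  have z: "x * (l i)\<^sup>\<star> = 0" if "i \<in> I" for i
    by (rule sum_star_mult_eq_0D[OF finite_I s0 that])
  have "x = x * (\<Sum>i\<in>I. F (1 * l i) * (l i)\<^sup>\<star>)" by (simp only: basis'[OF S_intros(1)] mult_1_right)
  also have "\<dots> = (\<Sum>i\<in>I. F (l i) * (x * (l i)\<^sup>\<star>))"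
    unfolding sum_distrib_left
    by (intro sum.cong refl) (simp add: P_comm[OF x] S_simps flip: mult.assoc)
  also have "\<dots> = 0" using z by simp
  finally show ?thesis .
qed

lemma F_norm_nonneg:
  assumes "x \<in> P"
  shows "F (x\<^sup>\<star> * x) = Re (scalar_value (F (x\<^sup>\<star> * x))) *\<^sub>R 1" "0 \<le> Re (scalar_value (F (x\<^sup>\<star> * x)))"
proof -
  obtain k where k: "F (x\<^sup>\<star> * x) = k *\<^sub>C 1" using F_scalar[of "x\<^sup>\<star> * x"] assms by (auto simp: P_intros)
  have p: "positive (k *\<^sub>C (1::'a))" using F_positive[OF P_S[OF assms]] by (simp add: k)
  show "0 \<le> Re (scalar_value (F (x\<^sup>\<star> * x)))" using positive_scalar(2)[OF p] by (simp add: k)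
  have "k = of_real (Re k)" using positive_scalar(1)[OF p] by (simp add: complex_eq_iff)
  then show "F (x\<^sup>\<star> * x) = Re (scalar_value (F (x\<^sup>\<star> * x))) *\<^sub>R 1"
    by (metis k scalar_value_scaleC scaleC_of_real)
qed

text \<open>\<open>\<theta>\<close> below is the modular map, \<open>F (y z) = F (z \<theta>(y))\<close>.  The balance condition gives
  \<open>F (x y) = F (\<theta>(y) x)\<close>, hence \<open>\<theta>\<^sup>2 = id\<close>.  Since \<open>F (z\<^sup>* \<theta>(z)) = F (z z\<^sup>*)\<close> is nonnegative, \<open>-1\<close> is not an
  eigenvalue, and \<open>\<theta>\<close> is the identity.\<close>

lemma F_trace: assumes y: "y \<in> P" and z: "z \<in> S" shows "F (y * z) = F (z * y)"
proof -
  define \<theta> where "\<theta> y = (\<Sum>i\<in>I. l i * F (y * (l i)\<^sup>\<star>))" for y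
  have \<theta>S: "\<theta> y \<in> S" if "y \<in> S" for y
    unfolding \<theta>_def by (intro S_intros that)
  have mod: "F (z * \<theta> y) = F (y * z)" if y: "y \<in> S" and yc: "y \<in> P" and z: "z \<in> S" for y z
  proof -
    have "F (z * \<theta> y) = (\<Sum>i\<in>I. F (z * l i * F (y * (l i)\<^sup>\<star>)))"
      unfolding \<theta>_def sum_distrib_left by (subst F_sum) (auto simp: mult.assoc intro!: S_intros y z)
    also have "\<dots> = (\<Sum>i\<in>I. F (y * (F (z * l i) * (l i)\<^sup>\<star>)))"
    proof (intro sum.cong refl)
      fix i assume i: "i \<in> I"
      have "F (z * l i * F (y * (l i)\<^sup>\<star>)) = F (z * l i) * F (y * (l i)\<^sup>\<star>)"
        by (intro F_right S_intros y z i)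
      also have "\<dots> = F (F (z * l i) * (y * (l i)\<^sup>\<star>))"
        by (intro F_left[symmetric] S_intros y z i)
      also have "F (z * l i) * (y * (l i)\<^sup>\<star>) = y * (F (z * l i) * (l i)\<^sup>\<star>)"
        using P_comm[OF yc, of "F (z * l i)"] by (simp add: S_simps z i flip: mult.assoc)
      finally show "F (z * l i * F (y * (l i)\<^sup>\<star>)) = F (y * (F (z * l i) * (l i)\<^sup>\<star>))" .
    qed
    also have "\<dots> = F (y * (\<Sum>i\<in>I. F (z * l i) * (l i)\<^sup>\<star>))"
      unfolding sum_distrib_left by (rule F_sum[symmetric]) (intro S_intros y z)
    also have "\<dots> = F (y * z)" by (simp only: basis'[OF z])
    finally show ?thesis .
  qed
  have \<theta>P: "\<theta> y \<in> P" if y: "y \<in> P" for y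
  proof -
    have "\<theta> y * b = b * \<theta> y" if b: "b \<in> R" for b
    proof (rule F_eqI)
      note yS = P_S[OF y]
      fix z assume zS: "z \<in> S"
      have "F (z * (\<theta> y * b)) = F (y * z) * b"
        using mod[OF yS y zS] by (simp add: F_right b S_simps \<theta>S yS zS flip: mult.assoc)
      also have "\<dots> = F (y * (z * b))" by (simp add: F_right b S_simps yS zS flip: mult.assoc)
      also have "\<dots> = F (z * (b * \<theta> y))"
        using mod[OF yS y, of "z * b"] by (simp add: S_simps b zS mult.assoc)
      finally show "F (z * (\<theta> y * b)) = F (z * (b * \<theta> y))" .
    qed (auto intro!: S_intros \<theta>S P_S[OF y] R_sub_S[OF b])
    then show ?thesis by (simp add: rel_commutant_def \<theta>S P_S[OF y])
  qed
  have swap: "F (x * y) = F (\<theta> y * x)" if x: "x \<in> P" and y: "y \<in> P" for x y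
  proof -
    note xS = P_S[OF x] and yS = P_S[OF y]
    have "average (\<theta> y * x) = (\<Sum>j\<in>I. (\<Sum>i\<in>I. l i * F ((l i)\<^sup>\<star> * (l j * \<theta> y))) * (x * (l j)\<^sup>\<star>))"
      by (intro sum.cong refl) (simp add: basis S_simps \<theta>S yS mult.assoc)
    also have "\<dots> = (\<Sum>j\<in>I. \<Sum>i\<in>I. l i * x * (F (y * (l i)\<^sup>\<star> * l j) * (l j)\<^sup>\<star>))"
      unfolding sum_distrib_right
    proof (intro sum.cong refl)
      fix i j assume i: "i \<in> I" and j: "j \<in> I"
      have "F ((l i)\<^sup>\<star> * (l j * \<theta> y)) = F (y * (l i)\<^sup>\<star> * l j)"
        using mod[OF yS y, of "(l i)\<^sup>\<star> * l j"] by (simp add: S_simps i j mult.assoc)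
      moreover have "x * F (y * (l i)\<^sup>\<star> * l j) = F (y * (l i)\<^sup>\<star> * l j) * x"
        by (intro P_comm x S_intros yS i j)
      ultimately show "l i * F ((l i)\<^sup>\<star> * (l j * \<theta> y)) * (x * (l j)\<^sup>\<star>) =
          l i * x * (F (y * (l i)\<^sup>\<star> * l j) * (l j)\<^sup>\<star>)" by (metis mult.assoc)
    qed
    also have "\<dots> = (\<Sum>i\<in>I. l i * x * (\<Sum>j\<in>I. F (y * (l i)\<^sup>\<star> * l j) * (l j)\<^sup>\<star>))"
      by (subst sum.swap) (simp add: sum_distrib_left)
    also have "\<dots> = average (x * y)"
    proof (intro sum.cong refl)
      fix i assume i: "i \<in> I"
      have "(\<Sum>j\<in>I. F (y * (l i)\<^sup>\<star> * l j) * (l j)\<^sup>\<star>) = y * (l i)\<^sup>\<star>"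
        by (intro basis' S_intros yS i)
      then show "l i * x * (\<Sum>j\<in>I. F (y * (l i)\<^sup>\<star> * l j) * (l j)\<^sup>\<star>) = l i * (x * y) * (l i)\<^sup>\<star>"
        by (simp add: mult.assoc)
    qed
    finally have "average (\<theta> y * x) = average (x * y)" .
    then show ?thesis
      using balance[of "\<theta> y * x"] balance[of "x * y"] t_pos by (simp add: P_intros x y \<theta>P)
  qed
  have inv: "\<theta> (\<theta> y) = y" if y: "y \<in> P" for y
  proof -
    define d where "d = \<theta> (\<theta> y) - y"
    have d: "d \<in> P" unfolding d_def by (intro P_intros \<theta>P y)
    have eq: "F (x * \<theta> (\<theta> y)) = F (x * y)" if x: "x \<in> P" for x
      using mod[OF P_S[OF \<theta>P[OF y]] \<theta>P[OF y] P_S[OF x]] swap[OF x y] by simp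
    have "F (d\<^sup>\<star> * d) = F (d\<^sup>\<star> * \<theta> (\<theta> y)) - F (d\<^sup>\<star> * y)"
      using P_S[OF d] P_S[OF y]
      by (subst F_diff[symmetric]) (auto simp: d_def right_diff_distrib intro!: S_intros \<theta>S)
    then have "F (d\<^sup>\<star> * d) = 0" using eq[of "d\<^sup>\<star>"] d by (simp add: P_intros)
    then show ?thesis using F_faithful[OF d] by (simp add: d_def)
  qed
  have fixed: "\<theta> y = y" if y: "y \<in> P" for y
  proof -
    define d where "d = \<theta> y - y"
    have d: "d \<in> P" unfolding d_def by (intro P_intros \<theta>P y)
    have "\<theta> d = (\<Sum>i\<in>I. l i * (F (\<theta> y * (l i)\<^sup>\<star>) - F (y * (l i)\<^sup>\<star>)))"
      unfolding d_def \<theta>_def[of "\<theta> y - y"]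
      by (intro sum.cong refl) (simp add: left_diff_distrib F_diff S_simps \<theta>S P_S[OF y])
    also have "\<dots> = \<theta> (\<theta> y) - \<theta> y"
      unfolding \<theta>_def[of "\<theta> y"]
      by (simp add: right_diff_distrib sum_subtractf \<theta>_def[of y, symmetric])
    finally have "\<theta> d = - d" by (simp add: inv[OF y] d_def)
    then have "F (d * d\<^sup>\<star>) = - F (d\<^sup>\<star> * d)"
      using mod[OF P_S[OF d] d, of "d\<^sup>\<star>"] P_S[OF d] by (simp add: F_minus S_simps)
    moreover have "positive (F (d * d\<^sup>\<star>))"
      using F_positive[of "d\<^sup>\<star>"] P_S[OF d] by (simp add: star_star S_simps)
    ultimately have "F (d\<^sup>\<star> * d) = 0"
      using positive_antisym[OF F_positive[OF P_S[OF d]]] by simp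
    then show ?thesis using F_faithful[OF d] by (simp add: d_def)
  qed
  show ?thesis using mod[OF P_S[OF y] y z] by (simp add: fixed[OF y])
qed

definition orthonormal :: "nat \<Rightarrow> (nat \<Rightarrow> 'a) \<Rightarrow> bool" where
  "orthonormal N v \<longleftrightarrow> (\<forall>i<N. v i \<in> P) \<and> (\<forall>i<N. \<forall>j<N. F ((v i)\<^sup>\<star> * v j) = (if i = j then 1 else 0))"

text \<open>Let \<open>q\<close> be the projection of the Hilbert module \<open>S\<close> onto the complement of the submodule spanned
  by the \<open>v\<^sub>a\<close>.  Then \<open>\<Sum>\<^sub>i q(l\<^sub>i) q(l\<^sub>i)\<^sup>* = \<Sum>\<^sub>i l\<^sub>i l\<^sub>i\<^sup>* - \<Sum>\<^sub>a v\<^sub>a v\<^sub>a\<^sup>*\<close>, and by the trace property \<open>F\<close> maps this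
  positive element to \<open>1 / t - N\<close>.\<close>

lemma orthonormal_bound: assumes on: "orthonormal N v" shows "real N \<le> 1 / t"
proof -
  have v: "v a \<in> P" "v a \<in> S" if "a < N" for a using on that by (auto simp: orthonormal_def P_S)
  have ip: "F ((v a)\<^sup>\<star> * v b) = (if a = b then 1 else 0)" if "a < N" "b < N" for a b
    using on that by (auto simp: orthonormal_def)
  define p where "p i = (\<Sum>a<N. v a * F ((v a)\<^sup>\<star> * l i))" for i
  define q where "q i = l i - p i" for i
  have pS: "p i \<in> S" if "i \<in> I" for i
    unfolding p_def using that by (auto intro!: S_intros v)
  have ps: "(p i)\<^sup>\<star> = (\<Sum>a<N. F ((l i)\<^sup>\<star> * v a) * (v a)\<^sup>\<star>)" if "i \<in> I" for i
    unfolding p_def star_sum using that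
    by (intro sum.cong refl) (simp add: star_simps S_simps v flip: F_star)
  have lp: "(\<Sum>i\<in>I. l i * (p i)\<^sup>\<star>) = (\<Sum>a<N. v a * (v a)\<^sup>\<star>)"
  proof -
    have "(\<Sum>i\<in>I. l i * (p i)\<^sup>\<star>) = (\<Sum>i\<in>I. \<Sum>a<N. l i * F ((l i)\<^sup>\<star> * v a) * (v a)\<^sup>\<star>)"
      by (intro sum.cong refl) (simp add: ps sum_distrib_left mult.assoc)
    also have "\<dots> = (\<Sum>a<N. (\<Sum>i\<in>I. l i * F ((l i)\<^sup>\<star> * v a)) * (v a)\<^sup>\<star>)"
      by (subst sum.swap) (simp add: sum_distrib_right)
    also have "\<dots> = (\<Sum>a<N. v a * (v a)\<^sup>\<star>)"
      by (intro sum.cong refl) (simp add: basis v)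
    finally show ?thesis .
  qed
  have pl: "(\<Sum>i\<in>I. p i * (l i)\<^sup>\<star>) = (\<Sum>a<N. v a * (v a)\<^sup>\<star>)"
    using arg_cong[OF lp, of star] by (simp add: star_simps)
  have pp: "(\<Sum>i\<in>I. p i * (p i)\<^sup>\<star>) = (\<Sum>a<N. v a * (v a)\<^sup>\<star>)"
  proof -
    have "(\<Sum>i\<in>I. p i * (p i)\<^sup>\<star>) = (\<Sum>i\<in>I. \<Sum>a<N. v a * (F ((v a)\<^sup>\<star> * l i) * (p i)\<^sup>\<star>))"
      unfolding p_def[of "_::'i"] sum_distrib_right by (simp add: mult.assoc)
    also have "\<dots> = (\<Sum>a<N. v a * (\<Sum>i\<in>I. F ((v a)\<^sup>\<star> * l i) * (p i)\<^sup>\<star>))"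
      by (subst sum.swap) (simp add: sum_distrib_left)
    also have "\<dots> = (\<Sum>a<N. v a * (v a)\<^sup>\<star>)"
    proof (intro sum.cong refl arg_cong2[of _ _ _ _ "(*)"])
      fix a assume "a \<in> {..<N}"
      then have a: "a < N" by simp
      have "(\<Sum>i\<in>I. F ((v a)\<^sup>\<star> * l i) * (p i)\<^sup>\<star>) =
          (\<Sum>i\<in>I. \<Sum>b<N. F ((v a)\<^sup>\<star> * l i) * F ((l i)\<^sup>\<star> * v b) * (v b)\<^sup>\<star>)"
        by (intro sum.cong refl) (simp add: ps sum_distrib_left mult.assoc)
      also have "\<dots> = (\<Sum>b<N. (\<Sum>i\<in>I. F ((v a)\<^sup>\<star> * l i) * F ((l i)\<^sup>\<star> * v b)) * (v b)\<^sup>\<star>)"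
        by (subst sum.swap) (simp add: sum_distrib_right)
      also have "\<dots> = (\<Sum>b<N. F ((v a)\<^sup>\<star> * v b) * (v b)\<^sup>\<star>)"
      proof (intro sum.cong refl arg_cong2[of _ _ _ _ "(*)"])
        fix b assume "b \<in> {..<N}"
        then have b: "b < N" by simp
        have "(\<Sum>i\<in>I. F ((v a)\<^sup>\<star> * l i) * F ((l i)\<^sup>\<star> * v b)) = (\<Sum>i\<in>I. F ((v a)\<^sup>\<star> * (l i * F ((l i)\<^sup>\<star> * v b))))"
          by (intro sum.cong refl) (simp add: F_right S_simps v a b flip: mult.assoc)
        also have "\<dots> = F ((v a)\<^sup>\<star> * (\<Sum>i\<in>I. l i * F ((l i)\<^sup>\<star> * v b)))"
          unfolding sum_distrib_left by (rule F_sum[symmetric]) (intro S_intros v a b)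
        also have "\<dots> = F ((v a)\<^sup>\<star> * v b)" by (simp add: basis v b)
        finally show "(\<Sum>i\<in>I. F ((v a)\<^sup>\<star> * l i) * F ((l i)\<^sup>\<star> * v b)) = F ((v a)\<^sup>\<star> * v b)" .
      qed
      also have "\<dots> = (\<Sum>b<N. if a = b then (v b)\<^sup>\<star> else 0)"
        by (intro sum.cong refl) (simp add: ip a)
      also have "\<dots> = (v a)\<^sup>\<star>" using a by (simp add: sum.delta')
      finally show "(\<Sum>i\<in>I. F ((v a)\<^sup>\<star> * l i) * (p i)\<^sup>\<star>) = (v a)\<^sup>\<star>" .
    qed
    finally show ?thesis .
  qed
  have "(\<Sum>i\<in>I. q i * (q i)\<^sup>\<star>) = (\<Sum>i\<in>I. l i * (l i)\<^sup>\<star>) - (\<Sum>a<N. v a * (v a)\<^sup>\<star>)"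
  proof -
    have "(\<Sum>i\<in>I. q i * (q i)\<^sup>\<star>) = (\<Sum>i\<in>I. l i * (l i)\<^sup>\<star>) - (\<Sum>i\<in>I. l i * (p i)\<^sup>\<star>)
        - (\<Sum>i\<in>I. p i * (l i)\<^sup>\<star>) + (\<Sum>i\<in>I. p i * (p i)\<^sup>\<star>)"
      by (simp add: q_def star_simps algebra_simps sum.distrib sum_subtractf)
    then show ?thesis by (simp add: lp pl pp)
  qed
  also have "(\<Sum>i\<in>I. l i * (l i)\<^sup>\<star>) = (1 / t) *\<^sub>R 1"
    using balance[of 1] by (simp add: P_intros F_one)
  finally have "F (\<Sum>i\<in>I. q i * (q i)\<^sup>\<star>) = F ((1 / t) *\<^sub>R 1) - F (\<Sum>a<N. v a * (v a)\<^sup>\<star>)"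
    by (simp only:) (intro F_diff, auto intro!: S_intros v)
  also have "F (\<Sum>a<N. v a * (v a)\<^sup>\<star>) = (\<Sum>a<N. F (v a * (v a)\<^sup>\<star>))"
    by (intro F_sum) (auto intro!: S_intros v)
  also have "\<dots> = (\<Sum>a<N. 1)"
    by (intro sum.cong refl) (simp add: F_trace[of "v _" "(v _)\<^sup>\<star>"] v S_simps ip)
  also have "\<dots> = real N *\<^sub>R 1" by (simp add: scaleR_conv_of_real)
  also have "F ((1 / t) *\<^sub>R 1) = (1 / t) *\<^sub>R 1" by (intro F_id R_intros)
  finally have "F (\<Sum>i\<in>I. q i * (q i)\<^sup>\<star>) = complex_of_real (1 / t - real N) *\<^sub>C 1"
    by (simp only: scaleC_of_real scaleR_left_diff_distrib)
  moreover have "positive (F (\<Sum>i\<in>I. q i * (q i)\<^sup>\<star>))"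
  proof -
    have "F (\<Sum>i\<in>I. q i * (q i)\<^sup>\<star>) = (\<Sum>i\<in>I. F (((q i)\<^sup>\<star>)\<^sup>\<star> * (q i)\<^sup>\<star>))"
      by (subst F_sum) (auto simp: star_star q_def intro!: S_intros pS)
    also have "positive \<dots>"
      by (intro positive_sum F_positive) (auto simp: q_def intro!: S_intros pS)
    finally show ?thesis .
  qed
  ultimately show ?thesis using positive_scalar(2)[of "complex_of_real (1 / t - real N)"] by simp
qed

text \<open>A longest orthonormal family spans, by the Gram-Schmidt step.\<close>

lemma orthonormal_basis:
  obtains N v where "orthonormal N v" "\<And>x. x \<in> P \<Longrightarrow> (\<Sum>a<N. v a * F ((v a)\<^sup>\<star> * x)) = x"
proof -
  define L where "L = {N. \<exists>v. orthonormal N v}"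
  have "0 \<in> L" by (simp add: L_def orthonormal_def)
  moreover have "L \<subseteq> {..nat \<lfloor>1 / t\<rfloor>}"
    using orthonormal_bound by (auto simp: L_def intro: le_nat_floor)
  then have fin: "finite L" by (rule finite_subset) simp
  ultimately obtain N where N: "N \<in> L" "Suc N \<notin> L"
    by (metis Max_ge Max_in Suc_n_not_le_n empty_iff)
  then obtain v where on: "orthonormal N v" by (auto simp: L_def)
  have v: "v a \<in> P" if "a < N" for a using on that by (auto simp: orthonormal_def)
  have ip: "F ((v a)\<^sup>\<star> * v b) = (if a = b then 1 else 0)" if "a < N" "b < N" for a b
    using on that by (auto simp: orthonormal_def)
  show thesis
  proof (rule that[OF on])
    fix x assume x: "x \<in> P"
    define y where "y = x - (\<Sum>a<N. v a * F ((v a)\<^sup>\<star> * x))"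
    have coef: "F ((v a)\<^sup>\<star> * x) \<in> P" if a: "a < N" for a
    proof -
      obtain k where "F ((v a)\<^sup>\<star> * x) = k *\<^sub>C 1"
        using F_scalar[of "(v a)\<^sup>\<star> * x"] by (auto simp: P_intros v a x)
      then show ?thesis by (simp add: P_intros)
    qed
    have yP: "y \<in> P" unfolding y_def by (auto intro!: P_intros x v coef)
    have orth: "F ((v b)\<^sup>\<star> * y) = 0" if b: "b < N" for b
    proof -
      have "F ((v b)\<^sup>\<star> * y) = F ((v b)\<^sup>\<star> * x) - F (\<Sum>a<N. (v b)\<^sup>\<star> * v a * F ((v a)\<^sup>\<star> * x))"
        unfolding y_def right_diff_distrib sum_distrib_left mult.assoc
        by (intro F_diff) (auto intro!: S_intros P_S[OF v] b P_S[OF x])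
      also have "F (\<Sum>a<N. (v b)\<^sup>\<star> * v a * F ((v a)\<^sup>\<star> * x)) = (\<Sum>a<N. F ((v b)\<^sup>\<star> * v a) * F ((v a)\<^sup>\<star> * x))"
        by (subst F_sum) (auto simp: F_right P_S v b x S_intros intro!: S_intros)
      also have "\<dots> = (\<Sum>a<N. if a = b then F ((v a)\<^sup>\<star> * x) else 0)"
        by (intro sum.cong refl) (simp add: ip b)
      also have "\<dots> = F ((v b)\<^sup>\<star> * x)" using b by (simp add: sum.delta)
      finally show ?thesis by simp
    qed
    have "y = 0"
    proof (rule ccontr)
      assume y0: "y \<noteq> 0"
      define r where "r = Re (scalar_value (F (y\<^sup>\<star> * y)))"
      have r: "F (y\<^sup>\<star> * y) = r *\<^sub>R 1" "0 \<le> r"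
        using F_norm_nonneg[OF yP] by (simp_all add: r_def)
      then have r0: "0 < r" using F_faithful[OF yP] y0 by (cases "r = 0") auto
      define u where "u = (1 / sqrt r) *\<^sub>R y"
      have u: "u \<in> P" unfolding u_def by (intro P_intros yP)
      have uu: "F (u\<^sup>\<star> * u) = 1"
        using r0 by (simp add: u_def star_simps F_scaleR S_simps P_S[OF yP] r)
      have vu: "F ((v a)\<^sup>\<star> * u) = 0" if "a < N" for a
        using orth[OF that] by (simp add: u_def F_scaleR S_simps P_S[OF yP] P_S[OF v[OF that]])
      have uv: "F (u\<^sup>\<star> * v a) = 0" if "a < N" for a
        using F_star[of "(v a)\<^sup>\<star> * u"] vu[OF that] by (simp add: star_simps S_simps P_S u v that)
      have "orthonormal (Suc N) (v(N := u))"
        using v u ip uu vu uv by (auto simp: orthonormal_def less_Suc_eq)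
      then show False using N by (auto simp: L_def)
    qed
    then show "(\<Sum>a<N. v a * F ((v a)\<^sup>\<star> * x)) = x" by (simp add: y_def)
  qed
qed

end

text \<open>Averaging \<open>c \<in> R' \<inter> S1\<close> over the basis \<open>l\<close> of \<open>S\<close> gives an element of \<open>S' \<inter> S1\<close>, to which the balance condition
  of \<open>F1\<close> applies; \<open>F1\<close> maps this element to the average of \<open>F1 c \<in> R' \<inter> S\<close>.\<close>

lemma balanced_compose:
  assumes "balanced_expectation S R F I l t" "balanced_expectation S1 S F1 I1 l1 t1"
  shows "balanced_expectation S1 R (\<lambda>x. F (F1 x)) (I1 \<times> I) (\<lambda>(j, i). l1 j * l i) (t1 * t)"
proof -
  interpret a: balanced_expectation S R F I l t by fact
  interpret b: balanced_expectation S1 S F1 I1 l1 t1 by fact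
  note SI = b.S_intros b.R_sub_S[OF a.basis_in]
  have basis: "(\<Sum>ji\<in>I1 \<times> I. (case ji of (j, i) \<Rightarrow> l1 j * l i) *
      F (F1 ((case ji of (j, i) \<Rightarrow> l1 j * l i)\<^sup>\<star> * x))) = x" if x: "x \<in> S1" for x
  proof -
    have "(\<Sum>ji\<in>I1 \<times> I. (case ji of (j, i) \<Rightarrow> l1 j * l i) *
        F (F1 ((case ji of (j, i) \<Rightarrow> l1 j * l i)\<^sup>\<star> * x))) =
        (\<Sum>j\<in>I1. \<Sum>i\<in>I. l1 j * l i * F (F1 ((l i)\<^sup>\<star> * ((l1 j)\<^sup>\<star> * x))))"
      unfolding sum.cartesian_product by (intro sum.cong refl) (auto simp: star_simps mult.assoc)
    also have "\<dots> = (\<Sum>j\<in>I1. l1 j * (\<Sum>i\<in>I. l i * F ((l i)\<^sup>\<star> * F1 ((l1 j)\<^sup>\<star> * x))))"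
      unfolding sum_distrib_left
      by (intro sum.cong refl) (simp add: b.F_left a.S_simps SI x mult.assoc)
    also have "\<dots> = (\<Sum>j\<in>I1. l1 j * F1 ((l1 j)\<^sup>\<star> * x))"
      by (intro sum.cong refl) (simp add: a.basis SI x)
    also have "\<dots> = x" by (rule b.basis[OF x])
    finally show ?thesis .
  qed
  show ?thesis
  proof (unfold_locales)
    show "cstar_subalgebra S1" "cstar_subalgebra R" "finite (I1 \<times> I)" "0 < t1 * t"
      using b.subalgebra_S a.subalgebra_R a.finite_I b.finite_I a.t_pos b.t_pos by auto
    show "\<exists>k. c = k *\<^sub>C 1" if "c \<in> R" "\<And>b. b \<in> R \<Longrightarrow> c * b = b * c" for c
      using a.centre_R that by blast
    show "(case ji of (j, i) \<Rightarrow> l1 j * l i) \<in> S1" if "ji \<in> I1 \<times> I" for ji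
      using that by (auto intro!: SI a.basis_in)
    show "conditional_expectation S1 R (\<lambda>x. F (F1 x))"
      unfolding conditional_expectation_def cstar_positive_iff
    proof (intro conjI ballI allI)
      show "R \<subseteq> S1" using a.R_sub_S b.R_sub_S by blast
      fix x assume x: "x \<in> S1"
      have Fx: "F1 x \<in> S" using x by (rule b.F_in)
      show "F (F1 x) \<in> R" by (intro a.F_in Fx)
      show "F (F1 (c *\<^sub>C x)) = c *\<^sub>C F (F1 x)" for c by (simp add: b.F_scaleC x a.F_scaleC Fx)
      show "F (F1 (x + y)) = F (F1 x) + F (F1 y)" if "y \<in> S1" for y
        by (simp add: b.F_add x a.F_add Fx that b.F_in)
      have "positive (F1 (x\<^sup>\<star> * x))" "F1 (x\<^sup>\<star> * x) \<in> S" using x by (auto intro!: b.F_positive SI)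
      then obtain s where "s \<in> S" "s\<^sup>\<star> = s" "s * s = F1 (x\<^sup>\<star> * x)"
        using positive_sqrt[OF a.subalgebra_S] positive_selfadjoint by metis
      then show "positive (F (F1 (x\<^sup>\<star> * x)))" using a.F_positive[of s] by simp
    next
      fix r r' x assume "r \<in> R" "r' \<in> R" "x \<in> S1"
      then show "F (F1 (r * x * r')) = r * F (F1 x) * r'"
        by (simp add: b.F_bimodule a.F_bimodule a.R_sub_S b.F_in)
    qed (simp add: b.F_id a.F_id a.R_sub_S)
    show "(\<Sum>ji\<in>I1 \<times> I. (case ji of (j, i) \<Rightarrow> l1 j * l i) *
      F (F1 ((case ji of (j, i) \<Rightarrow> l1 j * l i)\<^sup>\<star> * x))) = x" if "x \<in> S1" for x
      by (rule basis[OF that])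
    fix c assume c: "c \<in> rel_commutant R S1"
    then have cS: "c \<in> S1" and cc: "\<And>b. b \<in> R \<Longrightarrow> c * b = b * c" by (auto simp: rel_commutant_def)
    have g: "a.average c \<in> b.P"
      using a.average_commute[of c] cc cS by (auto simp: rel_commutant_def intro!: SI a.basis_in)
    have Fc: "F1 c \<in> a.P"
    proof -
      have "F1 c * b = b * F1 c" if "b \<in> R" for b
        using b.F_left[of b c] b.F_right[of b c] cc[OF that] that cS by (simp add: a.R_sub_S)
      then show ?thesis using cS by (simp add: rel_commutant_def b.F_in)
    qed
    obtain k where k: "F (F1 c) = k *\<^sub>C 1" using a.F_scalar[OF Fc] by blast
    have "(\<Sum>ji\<in>I1 \<times> I. (case ji of (j, i) \<Rightarrow> l1 j * l i) * c * (case ji of (j, i) \<Rightarrow> l1 j * l i)\<^sup>\<star>) =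
        (\<Sum>j\<in>I1. \<Sum>i\<in>I. l1 j * (l i * c * (l i)\<^sup>\<star>) * (l1 j)\<^sup>\<star>)"
      unfolding sum.cartesian_product by (intro sum.cong refl) (auto simp: star_simps mult.assoc)
    also have "\<dots> = b.average (a.average c)"
      by (simp add: sum_distrib_left sum_distrib_right)
    also have "\<dots> = (1 / t1) *\<^sub>R F1 (a.average c)" by (rule b.balance[OF g])
    also have "F1 (a.average c) = (\<Sum>i\<in>I. F1 (l i * c * (l i)\<^sup>\<star>))"
      by (intro b.F_sum SI cS a.basis_in)
    also have "\<dots> = a.average (F1 c)"
      by (intro sum.cong refl b.F_bimodule a.S_intros cS)
    also have "\<dots> = (1 / t) *\<^sub>R F (F1 c)" by (rule a.balance[OF Fc])
    finally show "(\<Sum>ji\<in>I1 \<times> I. (case ji of (j, i) \<Rightarrow> l1 j * l i) * c * (case ji of (j, i) \<Rightarrow> l1 j * l i)\<^sup>\<star>) =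
        (1 / (t1 * t)) *\<^sub>R F (F1 c)" by simp
  qed
qed


section \<open>Minimal expectations are balanced\<close>

lemma exp_in_closed:
  fixes x :: "'a::unital_cstar_algebra"
  assumes "closed X" "\<And>n. (\<Sum>k<n. x ^ k /\<^sub>R fact k) \<in> X"
  shows "exp x \<in> X"
  using closed_sequentially[OF assms(1) _ exp_converges[of x, unfolded sums_def]] assms(2) by simp

lemma exp_in_subalgebra: "cstar_subalgebra S \<Longrightarrow> x \<in> S \<Longrightarrow> exp x \<in> S"
  by (rule exp_in_closed) (auto intro!: subalg_closed subalg_intros)

lemma star_exp: "x\<^sup>\<star> = x \<Longrightarrow> (exp x)\<^sup>\<star> = exp (x::'a::unital_cstar_algebra)"
  using exp_in_closed[OF closed_selfadjoint, of x] by (simp add: star_simps star_power)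

text \<open>The functionals to be differentiated, the scalars of \<open>E x\<close> and of \<open>\<Sum>\<^sub>i l\<^sub>i x l\<^sub>i\<^sup>*\<close>, are linear only on a subalgebra
  and are bounded there on self-adjoint elements, so the remainder of the exponential is estimated directly.\<close>

lemma derivative_exp_functional:
  fixes \<phi> :: "'a::unital_cstar_algebra \<Rightarrow> real"
  assumes P: "cstar_subalgebra P" and c: "c \<in> P" "c\<^sup>\<star> = c"
    and add: "\<And>x y. x \<in> P \<Longrightarrow> y \<in> P \<Longrightarrow> \<phi> (x + y) = \<phi> x + \<phi> y"
    and scale: "\<And>r x. x \<in> P \<Longrightarrow> \<phi> (r *\<^sub>R x) = r * \<phi> x"
    and bound: "\<And>x. x \<in> P \<Longrightarrow> x\<^sup>\<star> = x \<Longrightarrow> \<bar>\<phi> x\<bar> \<le> K * norm x"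
  shows "((\<lambda>s. \<phi> (exp (s *\<^sub>R c))) has_real_derivative \<phi> c) (at 0)"
proof -
  define \<rho> where "\<rho> h = exp (h *\<^sub>R c) - 1 - h *\<^sub>R c" for h
  have "((\<lambda>s. exp (s *\<^sub>R c)) has_vector_derivative c) (at 0)"
    using exp_scaleR_has_vector_derivative_right[of c 0 UNIV] by simp
  then have lim: "((\<lambda>h. norm (\<rho> h) / norm h) \<longlongrightarrow> 0) (at 0)"
    by (simp add: has_vector_derivative_def has_derivative_at \<rho>_def)
  have eP: "exp (h *\<^sub>R c) \<in> P" for h by (intro exp_in_subalgebra P subalg_intros[OF P] c)
  have \<rho>P: "\<rho> h \<in> P" for h unfolding \<rho>_def by (intro subalg_intros[OF P] c eP)
  have \<rho>s: "(\<rho> h)\<^sup>\<star> = \<rho> h" for h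
    by (simp add: \<rho>_def star_simps c star_exp)
  have "\<phi> (exp (h *\<^sub>R c)) - \<phi> 1 - \<phi> c * h = \<phi> (\<rho> h)" for h
  proof -
    have "exp (h *\<^sub>R c) = \<rho> h + (1 + h *\<^sub>R c)" by (simp add: \<rho>_def)
    then have "\<phi> (exp (h *\<^sub>R c)) = \<phi> (\<rho> h + (1 + h *\<^sub>R c))" by simp
    also have "\<dots> = \<phi> (\<rho> h) + (\<phi> 1 + h * \<phi> c)"
      by (simp add: add scale \<rho>P c subalg_intros[OF P])
    finally show ?thesis by simp
  qed
  moreover have "((\<lambda>h. norm (\<phi> (\<rho> h)) / norm h) \<longlongrightarrow> 0) (at 0)"
  proof (rule tendsto_0_le[OF lim, where K = K])
    show "\<forall>\<^sub>F h in at 0. norm (norm (\<phi> (\<rho> h)) / norm h) \<le> norm (norm (\<rho> h) / norm h) * K"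
      using bound[OF \<rho>P \<rho>s] by (intro always_eventually) (auto simp: divide_right_mono mult.commute)
  qed
  ultimately show ?thesis
    by (simp add: has_field_derivative_def has_derivative_at bounded_linear_mult_right)
qed

text \<open>For self-adjoint \<open>c\<close> in the relative commutant and small \<open>s\<close>, the map
  \<open>x \<mapsto> E (exp (s c / 2) x exp (s c / 2)) / E (exp (s c))\<close> is a conditional expectation of index
  \<open>E (exp (s c)) \<cdot> \<Sum>\<^sub>i l\<^sub>i exp (- s c) l\<^sub>i\<^sup>*\<close>.  By minimality this function of \<open>s\<close> has a minimum at \<open>0\<close>, and its
  derivative there is \<open>E (c) \<cdot> \<Sum>\<^sub>i l\<^sub>i l\<^sub>i\<^sup>* - \<Sum>\<^sub>i l\<^sub>i c l\<^sub>i\<^sup>*\<close>.\<close>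

lemma minimal_expectation_balanced:
  assumes simple_B: "simple_cstar B" and simple_A: "simple_cstar A"
    and min: "minimal_expectation A B E" and qb: "quasi_basis A E n l"
  shows "balanced_expectation A B E {..<n} l (tau A E)"
proof -
  have A: "cstar_subalgebra A" and B: "cstar_subalgebra B"
    using simple_A simple_B by (simp_all add: simple_cstar_def)
  have ce: "conditional_expectation A B E"
    using min by (simp add: minimal_expectation_def index_finite_type_def)
  interpret index_expectation A B E "{..<n}" l
    by (rule index_expectation_of_quasi_basis[OF A B ce qb])
  let ?P = "rel_commutant B A"
  have P: "cstar_subalgebra ?P"
    by (rule cstar_subalgebra_rel_commutant[OF A subalg_star[OF B]])
  have PA: "c \<in> A" if "c \<in> ?P" for c using that by (simp add: rel_commutant_def)
  have Pc: "c * b = b * c" if "c \<in> ?P" "b \<in> B" for b c using that by (simp add: rel_commutant_def)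
  have centre: "\<exists>k. c = k *\<^sub>C 1" if "c \<in> B" "\<And>b. b \<in> B \<Longrightarrow> c * b = b * c" for c
    by (rule simple_central_scalar[OF simple_B]) (use that in auto)
  have Esc: "\<exists>k. E c = k *\<^sub>C 1" if "c \<in> ?P" for c
    using centre[of "E c"] F_commute[OF that] F_in[OF PA[OF that]] by blast
  have Asc: "\<exists>k. average c = k *\<^sub>C 1" if "c \<in> ?P" for c
    by (rule simple_central_scalar[OF simple_A average_in[OF PA[OF that]]], rule average_commute)
      (simp_all add: Pc[OF that])
  define ev where "ev x = scalar_value (E x)" for x
  define av where "av x = scalar_value (average x)" for x
  have E_ev: "E x = ev x *\<^sub>C 1" if "x \<in> ?P" for x using Esc[OF that] by (auto simp: ev_def)
  have A_av: "average x = av x *\<^sub>C 1" if "x \<in> ?P" for x using Asc[OF that] by (auto simp: av_def)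
  have evI: "ev x = k" if "E x = k *\<^sub>C 1" for x k using that by (simp add: ev_def)
  have avI: "av x = k" if "average x = k *\<^sub>C 1" for x k using that by (simp add: av_def)
  have one: "1 \<in> ?P" by (rule subalg_one[OF P])
  have index: "watatani_index A E = average 1" using watatani_index_eq[OF qb] by simp
  have "positive (average 1)" by (intro positive_sum) (simp add: positive_mult_star_self)
  then have av1: "Im (av 1) = 0" "0 \<le> Re (av 1)"
    using positive_scalar[of "av 1", where 'a = 'a] A_av[OF one] by simp_all
  have "av 1 \<noteq> 0" using A_av[OF one] average_one_nonzero by auto
  then have av1_pos: "0 < Re (av 1)" using av1 by (auto simp: complex_eq_iff less_le)
  have tau: "tau A E = inverse (Re (av 1))" by (simp add: tau_def index av_def)
  have av_add: "average (x + y) = average x + average y" for x y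
    by (simp add: algebra_simps sum.distrib)
  have av_sc: "average (k *\<^sub>C x) = k *\<^sub>C average x" for k x
    by (simp add: scaleC_mult_left scaleC_mult_right scaleC_sum_right)
  have av_scR: "average (r *\<^sub>R x) = r *\<^sub>R average x" for r x
    by (simp add: scaleR_sum_right)
  have real_value: "E x = Re (ev x) *\<^sub>R 1" "average x = Re (av x) *\<^sub>R 1" if x: "x \<in> ?P" "x\<^sup>\<star> = x" for x
  proof -
    have "(E x)\<^sup>\<star> = E x" using F_star[OF PA[OF x(1)]] x by simp
    then have "cnj (ev x) = ev x" by (simp add: E_ev[OF x(1)] star_scaleC)
    then have "ev x = of_real (Re (ev x))" by (simp add: complex_eq_iff)
    then show "E x = Re (ev x) *\<^sub>R 1" using E_ev[OF x(1)] scaleC_of_real by metis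
    have "(average x)\<^sup>\<star> = average x" by (simp add: star_simps x mult.assoc)
    then have "cnj (av x) = av x" by (simp add: A_av[OF x(1)] star_scaleC)
    then have "av x = of_real (Re (av x))" by (simp add: complex_eq_iff)
    then show "average x = Re (av x) *\<^sub>R 1" using A_av[OF x(1)] scaleC_of_real by metis
  qed
  have ev_bound: "\<bar>Re (ev x)\<bar> \<le> 1 * norm x" if x: "x \<in> ?P" "x\<^sup>\<star> = x" for x
  proof -
    have le: "Re (ev y) \<le> norm y" if y: "y \<in> ?P" "y\<^sup>\<star> = y" for y
    proof -
      have "norm y *\<^sub>R 1 - y \<in> A" "positive (norm y *\<^sub>R 1 - y)"
        using y PA by (auto intro!: positive_norm_diff S_intros)
      then obtain s where s: "s \<in> A" "s\<^sup>\<star> = s" "s * s = norm y *\<^sub>R 1 - y"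
        using positive_sqrt[OF A] positive_selfadjoint by metis
      have "E (norm y *\<^sub>R 1 - y) = norm y *\<^sub>R 1 - Re (ev y) *\<^sub>R 1"
        using y PA by (simp add: F_diff F_scaleR F_one S_simps flip: real_value(1))
      also have "\<dots> = complex_of_real (norm y - Re (ev y)) *\<^sub>C 1"
        by (simp only: scaleC_of_real scaleR_left_diff_distrib)
      finally have "positive (complex_of_real (norm y - Re (ev y)) *\<^sub>C (1::'a))"
        using F_positive[OF s(1)] s by simp
      from positive_scalar(2)[OF this] show ?thesis by simp
    qed
    have "ev (- x) = - ev x"
      by (rule evI) (simp only: F_minus[OF PA[OF x(1)]] E_ev[OF x(1)] scaleC_minus_left)
    then show ?thesis using le[OF x] le[of "- x"] x by (simp add: star_simps subalg_intros[OF P])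
  qed
  define K where "K = (\<Sum>i<n. norm (l i) * norm (l i))"
  have av_bound: "\<bar>Re (av x)\<bar> \<le> K * norm x" if x: "x \<in> ?P" "x\<^sup>\<star> = x" for x
  proof -
    have "\<bar>Re (av x)\<bar> = norm (average x)" unfolding real_value(2)[OF x] by simp
    also have "\<dots> \<le> (\<Sum>i<n. norm (l i) * norm (l i) * norm x)"
    proof (rule sum_norm_le)
      fix i
      have "norm (l i * x * (l i)\<^sup>\<star>) \<le> norm (l i * x) * norm ((l i)\<^sup>\<star>)" by (rule norm_mult_ineq)
      also have "\<dots> \<le> (norm (l i) * norm x) * norm (l i)"
        by (simp add: mult_right_mono norm_mult_ineq)
      finally show "norm (l i * x * (l i)\<^sup>\<star>) \<le> norm (l i) * norm (l i) * norm x" by (simp add: mult_ac)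
    qed
    finally show ?thesis by (simp add: K_def sum_distrib_right)
  qed
  have sa_balance: "average c = Re (av 1) *\<^sub>R E c" if c: "c \<in> ?P" "c\<^sup>\<star> = c" for c
  proof -
    define f where "f s = Re (ev (exp (s *\<^sub>R c)))" for s
    define g where "g s = Re (av (exp (s *\<^sub>R (- c))))" for s
    have mc: "- c \<in> ?P" "(- c)\<^sup>\<star> = - c" using c by (simp_all add: star_simps subalg_intros[OF P])
    have exP: "exp (s *\<^sub>R c) \<in> ?P" "exp (s *\<^sub>R (- c)) \<in> ?P" for s
      by (intro exp_in_subalgebra P subalg_intros[OF P] c)+
    have exs: "(exp (s *\<^sub>R c))\<^sup>\<star> = exp (s *\<^sub>R c)" "(exp (s *\<^sub>R (- c)))\<^sup>\<star> = exp (s *\<^sub>R (- c))" for s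
      by (intro star_exp, simp add: star_simps c)+
    have df: "(f has_real_derivative Re (ev c)) (at 0)"
      unfolding f_def[abs_def]
    proof (rule derivative_exp_functional[OF P c _ _ ev_bound])
      fix x y r assume x: "x \<in> ?P"
      show "Re (ev (x + y)) = Re (ev x) + Re (ev y)" if y: "y \<in> ?P"
      proof -
        have "ev (x + y) = ev x + ev y"
          by (rule evI) (simp only: F_add[OF PA[OF x] PA[OF y]] E_ev[OF x] E_ev[OF y] scaleC_add_left)
        then show ?thesis by simp
      qed
      have "ev (r *\<^sub>R x) = of_real r * ev x"
        by (rule evI) (simp only: F_scaleC[OF PA[OF x]] E_ev[OF x] scaleC_of_real[symmetric] scaleC_scaleC)
      then show "Re (ev (r *\<^sub>R x)) = r * Re (ev x)" by simp
    qed
    have dg: "(g has_real_derivative Re (av (- c))) (at 0)"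
      unfolding g_def[abs_def]
    proof (rule derivative_exp_functional[OF P mc _ _ av_bound])
      fix x y r assume x: "x \<in> ?P"
      show "Re (av (x + y)) = Re (av x) + Re (av y)" if y: "y \<in> ?P"
      proof -
        have "av (x + y) = av x + av y"
          by (rule avI) (simp only: av_add A_av[OF x] A_av[OF y] scaleC_add_left)
        then show ?thesis by simp
      qed
      have "av (r *\<^sub>R x) = of_real r * av x"
        by (rule avI) (simp only: av_sc A_av[OF x] scaleC_of_real[symmetric] scaleC_scaleC)
      then show "Re (av (r *\<^sub>R x)) = r * Re (av x)" by simp
    qed
    have "ev 1 = 1" by (rule evI) (simp add: F_one)
    then have f0: "f 0 = 1" by (simp add: f_def)
    have g0: "g 0 = Re (av 1)" by (simp add: g_def)
    have "(f \<longlongrightarrow> 1) (at 0)" using DERIV_isCont[OF df] by (simp add: isCont_def f0)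
    then have "\<forall>\<^sub>F s in at 0. 0 < f s" by (rule order_tendstoD) simp
    then obtain \<delta> where \<delta>: "0 < \<delta>" "\<And>s. s \<noteq> 0 \<Longrightarrow> dist s 0 < \<delta> \<Longrightarrow> 0 < f s"
      by (auto simp: eventually_at)
    have ge: "f 0 * g 0 \<le> f s * g s" if s: "\<bar>0 - s\<bar> < \<delta>" for s
    proof -
      have fs: "0 < f s" using \<delta>(2)[of s] s f0 by (cases "s = 0") auto
      define k where "k = exp ((s / 2) *\<^sub>R c)"
      define m where "m = exp ((s / 2) *\<^sub>R (- c))"
      have k: "k \<in> ?P" "k\<^sup>\<star> = k" and m: "m \<in> ?P" "m\<^sup>\<star> = m"
        using exP exs by (simp_all only: k_def m_def)
      note kA = PA[OF k(1)] and mA = PA[OF m(1)]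
      have half: "exp ((s / 2) *\<^sub>R x) * exp ((s / 2) *\<^sub>R x) = exp (s *\<^sub>R x)" for x :: 'a
        by (simp add: exp_add_commuting[symmetric] flip: scaleR_left.add)
      have kk: "k * k = exp (s *\<^sub>R c)" and mm: "m * m = exp (s *\<^sub>R (- c))"
        by (simp_all only: k_def m_def half)
      have km: "k * m = 1" by (simp add: k_def m_def exp_minus_inverse)
      have Ekk: "E (k * k) = f s *\<^sub>R 1"
        unfolding kk f_def by (rule real_value(1)[OF exP(1) exs(1)])
      define E' where "E' x = (1 / f s) *\<^sub>R E (k * x * k)" for x
      define l' where "l' i = sqrt (f s) *\<^sub>R (l i * m)" for i
      have ce': "conditional_expectation A B E'"
        unfolding conditional_expectation_def cstar_positive_iff
      proof (intro conjI ballI allI)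
        show "B \<subseteq> A" using R_sub_S by blast
        fix x assume x: "x \<in> A"
        show "E' x \<in> B" unfolding E'_def by (intro R_intros F_in S_intros kA x)
        show "E' (x + y) = E' x + E' y" if "y \<in> A" for y
          using that x kA by (simp add: E'_def algebra_simps F_add S_simps)
        show "E' (r *\<^sub>C x) = r *\<^sub>C E' x" for r
          using x kA by (simp add: E'_def scaleC_mult_left scaleC_mult_right F_scaleC S_simps scaleC_scaleC
              mult.commute flip: scaleC_of_real)
        have "k * (x\<^sup>\<star> * x) * k = (x * k)\<^sup>\<star> * (x * k)" by (simp add: star_simps k mult.assoc)
        then have "positive (E (k * (x\<^sup>\<star> * x) * k))" using F_positive[of "x * k"] x kA by (simp add: S_simps)
        then show "positive (E' (x\<^sup>\<star> * x))" unfolding E'_def using fs by (intro positive_scaleR) auto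
      next
        fix b assume b: "b \<in> B"
        have "k * b * k = b * (k * k)" using Pc[OF k(1) b] by (simp add: mult.assoc)
        then show "E' b = b" using fs by (simp add: E'_def F_left b S_simps kA Ekk)
      next
        fix b b' x assume b: "b \<in> B" "b' \<in> B" and x: "x \<in> A"
        have "k * (b * x * b') * k = b * (k * x * k) * b'"
          using Pc[OF k(1) b(1)] Pc[OF k(1) b(2)] by (metis mult.assoc)
        then show "E' (b * x * b') = b * E' x * b'"
          by (simp add: E'_def F_bimodule b S_simps kA x)
      qed
      have qb': "quasi_basis A E' n l'"
        unfolding quasi_basis_def
      proof (intro conjI allI impI ballI)
        show "l' i \<in> A" if "i < n" for i unfolding l'_def using that by (intro S_intros mA) simp
        fix x assume x: "x \<in> A"
        have "(\<Sum>i<n. l' i * E' ((l' i)\<^sup>\<star> * x)) = (\<Sum>i<n. l i * E ((l i)\<^sup>\<star> * (x * k))) * m"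
          unfolding sum_distrib_right
        proof (intro sum.cong refl)
          fix i assume "i \<in> {..<n}"
          then have iA: "l i \<in> A" by (rule basis_in)
          have e1: "k * ((l' i)\<^sup>\<star> * x) * k = sqrt (f s) *\<^sub>R ((l i)\<^sup>\<star> * (x * k))"
            by (simp add: l'_def star_simps m km mult.assoc) (metis km mult.assoc mult_1_left)
          have "E' ((l' i)\<^sup>\<star> * x) = (sqrt (f s) / f s) *\<^sub>R E ((l i)\<^sup>\<star> * (x * k))"
            unfolding E'_def e1 using iA x kA by (simp add: F_scaleR S_simps)
          then have "l' i * E' ((l' i)\<^sup>\<star> * x) = l i * (m * E ((l i)\<^sup>\<star> * (x * k)))"
            using fs by (simp add: l'_def mult.assoc)
          also have "m * E ((l i)\<^sup>\<star> * (x * k)) = E ((l i)\<^sup>\<star> * (x * k)) * m"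
            by (intro Pc m F_in S_intros iA x kA)
          finally show "l' i * E' ((l' i)\<^sup>\<star> * x) = l i * E ((l i)\<^sup>\<star> * (x * k)) * m" by (simp add: mult.assoc)
        qed
        also have "\<dots> = x * k * m" by (simp add: basis S_simps x kA)
        finally show "x = (\<Sum>i<n. l' i * E' ((l' i)\<^sup>\<star> * x))" by (simp add: mult.assoc km)
      qed
      interpret e': index_expectation A B E' "{..<n}" l'
        by (rule index_expectation_of_quasi_basis[OF A B ce' qb'])
      have "watatani_index A E' = (\<Sum>i<n. l' i * (l' i)\<^sup>\<star>)" by (rule e'.watatani_index_eq[OF qb'])
      also have "\<dots> = f s *\<^sub>R average (m * m)"
        using fs by (simp add: l'_def star_simps m mult.assoc scaleR_sum_right)
      also have "\<dots> = (f s * g s) *\<^sub>R 1"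
        unfolding mm g_def by (simp only: real_value(2)[OF exP(2) exs(2)] scaleR_scaleR)
      finally have "watatani_index A E' = (f s * g s) *\<^sub>R 1" .
      moreover have "watatani_index A E = Re (av 1) *\<^sub>R 1"
        using real_value(2)[OF one] by (simp add: index)
      moreover have "positive (watatani_index A E' - watatani_index A E)"
        using min ce' qb' by (auto simp: minimal_expectation_def index_finite_type_def cstar_positive_iff)
      ultimately have "positive (complex_of_real (f s * g s - Re (av 1)) *\<^sub>C (1::'a))"
        by (simp only: scaleC_of_real scaleR_left_diff_distrib)
      from positive_scalar(2)[OF this] show ?thesis by (simp add: f0 g0)
    qed
    have "((\<lambda>s. f s * g s) has_real_derivative Re (ev c) * g 0 + Re (av (- c)) * f 0) (at 0)"
      by (rule DERIV_mult[OF df dg])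
    then have "Re (ev c) * g 0 + Re (av (- c)) * f 0 = 0"
      by (rule DERIV_local_min[OF _ \<delta>(1)]) (use ge in blast)
    moreover have "av (- c) = - av c"
      by (rule avI) (simp only: minus_mult_left[symmetric] minus_mult_right[symmetric] sum_negf
          A_av[OF c(1)] scaleC_minus_left)
    ultimately have "Re (av c) = Re (av 1) * Re (ev c)" by (simp add: f0 g0 mult.commute)
    then show ?thesis by (simp only: real_value[OF c] scaleR_scaleR)
  qed
  show ?thesis
  proof (unfold_locales)
    show "0 < tau A E" using av1_pos by (simp add: tau)
    fix c assume c: "c \<in> ?P"
    define a b where "a = (1/2) *\<^sub>R (c + c\<^sup>\<star>)" and "b = (1/2) *\<^sub>R (\<i> *\<^sub>C (c\<^sup>\<star> - c))"
    have ab: "a \<in> ?P" "b \<in> ?P" unfolding a_def b_def by (intro subalg_intros[OF P] c)+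
    have absa: "a\<^sup>\<star> = a" "b\<^sup>\<star> = b"
      by (simp_all add: a_def b_def star_simps scaleC_minus_left scaleC_diff_right add.commute)
    have c_eq: "c = a + \<i> *\<^sub>C b"
    proof -
      have "\<i> *\<^sub>C b = (1/2) *\<^sub>R (c - c\<^sup>\<star>)"
        unfolding b_def
        by (simp add: scaleC_scaleC scaleC_minus_left mult.left_commute flip: scaleC_of_real)
          (simp add: scaleC_diff_right)
      then have "a + \<i> *\<^sub>C b = (1/2) *\<^sub>R ((c + c\<^sup>\<star>) + (c - c\<^sup>\<star>))"
        by (simp only: a_def scaleR_add_right)
      then show ?thesis by simp
    qed
    have "average c = Re (av 1) *\<^sub>R E c"
      unfolding c_eq av_add av_sc sa_balance[OF ab(1) absa(1)] sa_balance[OF ab(2) absa(2)]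
      using PA[OF ab(1)] PA[OF ab(2)]
      by (simp add: F_add F_scaleC S_simps scaleC_add_right scaleC_scaleC mult.commute flip: scaleC_of_real)
    then show "average c = (1 / tau A E) *\<^sub>R E c" by (simp add: tau inverse_eq_divide)
  qed (auto intro: centre)
qed


section \<open>One step of the basic construction\<close>

definition dual_basis ::
    "('i \<Rightarrow> 'a) \<Rightarrow> real \<Rightarrow> 'a \<Rightarrow> 'i \<Rightarrow> 'a::unital_cstar_algebra" where
  "dual_basis l t e i = (1 / sqrt t) *\<^sub>R (l i * e)"

locale jones_step = balanced_expectation S R F I l t
  for S R :: "'a::unital_cstar_algebra set" and F :: "'a \<Rightarrow> 'a" and I :: "'i set" and l :: "'i \<Rightarrow> 'a"
    and t :: real +
  fixes S1 :: "'a set" and e :: 'a and F1 :: "'a \<Rightarrow> 'a"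
  assumes basic: "basic_construction S F S1 e"
    and dual: "dual_expectation t S S1 e F1"
    and centre_S: "\<And>c. c \<in> S \<Longrightarrow> (\<And>b. b \<in> S \<Longrightarrow> c * b = b * c) \<Longrightarrow> \<exists>k. c = k *\<^sub>C 1"
begin

lemma subalgebra_S1: "cstar_subalgebra S1"
  using basic cstar_subalgebra_cstar_generated unfolding basic_construction_def by metis

lemma e_in: "e \<in> S1" and S_sub_S1: "x \<in> S \<Longrightarrow> x \<in> S1"
  using basic_construction_subset[OF basic] by auto

lemmas S1_intros = subalg_intros[OF subalgebra_S1]

lemmas e_idem = jones_projection_relations(1)[OF basic expectation subalgebra_S subalgebra_R]
lemmas e_sandwich = jones_projection_relations(2)[OF basic expectation subalgebra_S subalgebra_R]
lemmas e_commute = jones_projection_relations(3)[OF basic expectation subalgebra_S subalgebra_R]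

text \<open>All three facts are read off from the faithful representation on the Hilbert module \<open>S\<close>: \<open>e\<close>
  acts as \<open>F\<close>, and \<open>x e\<close> acts as left multiplication by \<open>x \<cdot> 1\<close> after \<open>F\<close> since adjointable operators are
  right \<open>R\<close>-linear.\<close>

lemma basic_construction_structure:
  shows e_star: "e\<^sup>\<star> = e"
    and e_absorb: "x \<in> S1 \<Longrightarrow> \<exists>a\<in>S. x * e = a * e"
    and resolution: "(\<Sum>i\<in>I. l i * e * (l i)\<^sup>\<star>) = 1"
proof -
  obtain \<pi> where rep: "module_representation S F S1 \<pi>"
    and inj: "\<And>s. s \<in> S1 \<Longrightarrow> (\<And>x. x \<in> S \<Longrightarrow> \<pi> s x = 0) \<Longrightarrow> s = 0"
    and \<pi>S: "\<And>a x. a \<in> S \<Longrightarrow> x \<in> S \<Longrightarrow> \<pi> a x = a * x"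
    and \<pi>e: "\<And>x. x \<in> S \<Longrightarrow> \<pi> e x = F x"
    using basic unfolding basic_construction_def by blast
  have \<pi>in: "\<pi> s x \<in> S" if "s \<in> S1" "x \<in> S" for s x
    using rep that by (simp add: module_representation_def)
  have \<pi>add: "\<pi> (s + r) x = \<pi> s x + \<pi> r x" and \<pi>mult: "\<pi> (s * r) x = \<pi> s (\<pi> r x)"
    if "s \<in> S1" "r \<in> S1" "x \<in> S" for s r x
    using rep that by (simp_all add: module_representation_def)
  have \<pi>sc: "\<pi> (c *\<^sub>C s) x = c *\<^sub>C \<pi> s x" if "s \<in> S1" "x \<in> S" for c s x
    using rep that by (simp add: module_representation_def)
  have adj: "F ((\<pi> s x)\<^sup>\<star> * y) = F (x\<^sup>\<star> * \<pi> (s\<^sup>\<star>) y)" if "s \<in> S1" "x \<in> S" "y \<in> S" for s x y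
    using rep that by (simp add: module_representation_def)
  have \<pi>0: "\<pi> 0 x = 0" if "x \<in> S" for x
    using \<pi>sc[OF S1_intros(1) that, of 0] by simp
  have \<pi>sum: "\<pi> (\<Sum>i\<in>J. f i) x = (\<Sum>i\<in>J. \<pi> (f i) x)" if "\<And>i. i \<in> J \<Longrightarrow> f i \<in> S1" "x \<in> S"
    for J :: "'i set" and f x
    using that
    by (induction J rule: infinite_finite_induct) (simp_all add: \<pi>0 \<pi>add S1_intros)
  have eqI: "s = r" if s: "s \<in> S1" and r: "r \<in> S1" and eq: "\<And>x. x \<in> S \<Longrightarrow> \<pi> s x = \<pi> r x" for s r
  proof -
    have "s + (- 1) *\<^sub>C r = 0"
    proof (rule inj)
      show "s + (- 1) *\<^sub>C r \<in> S1" by (intro S1_intros s r)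
      show "\<pi> (s + (- 1) *\<^sub>C r) x = 0" if x: "x \<in> S" for x
        by (simp only: \<pi>add[OF s S1_intros(8)[OF r] x] \<pi>sc[OF r x] eq[OF x])
          (simp add: scaleC_minus_left)
    qed
    then show ?thesis by (simp add: scaleC_minus_left)
  qed
  have moduleI: "u = v" if "u \<in> S" "v \<in> S" "\<And>x. x \<in> S \<Longrightarrow> F (x\<^sup>\<star> * u) = F (x\<^sup>\<star> * v)" for u v
    using F_eqI[OF that(1,2)] that(3) by (metis S_intros(7) star_star)
  show "e\<^sup>\<star> = e"
  proof (rule eqI)
    show "e\<^sup>\<star> \<in> S1" "e \<in> S1" by (intro S1_intros e_in)+
    fix y assume y: "y \<in> S"
    show "\<pi> (e\<^sup>\<star>) y = \<pi> e y"
    proof (rule moduleI)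
      show "\<pi> (e\<^sup>\<star>) y \<in> S" "\<pi> e y \<in> S" by (intro \<pi>in S1_intros e_in y)+
      fix x assume x: "x \<in> S"
      have "F (x\<^sup>\<star> * \<pi> (e\<^sup>\<star>) y) = F ((F x)\<^sup>\<star> * y)" by (simp add: adj[symmetric] e_in x y \<pi>e)
      also have "\<dots> = F (x\<^sup>\<star>) * F y" using x y by (simp add: F_left F_star[symmetric] S_intros)
      also have "\<dots> = F (x\<^sup>\<star> * \<pi> e y)" using x y by (simp add: \<pi>e F_right S_intros)
      finally show "F (x\<^sup>\<star> * \<pi> (e\<^sup>\<star>) y) = F (x\<^sup>\<star> * \<pi> e y)" .
    qed
  qed
  have linear: "\<pi> s (y * b) = \<pi> s y * b" if s: "s \<in> S1" and y: "y \<in> S" and b: "b \<in> R" for s y b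
  proof (rule moduleI)
    show "\<pi> s (y * b) \<in> S" "\<pi> s y * b \<in> S" by (intro \<pi>in S_intros s y R_sub_S[OF b])+
    fix x assume x: "x \<in> S"
    have ss: "s\<^sup>\<star> \<in> S1" by (intro S1_intros s)
    have "F (x\<^sup>\<star> * \<pi> s (y * b)) = F ((\<pi> (s\<^sup>\<star>) x)\<^sup>\<star> * y * b)"
      using adj[OF ss x, of "y * b"] y b by (simp add: star_star S_simps mult.assoc)
    also have "\<dots> = F ((\<pi> (s\<^sup>\<star>) x)\<^sup>\<star> * y) * b" by (intro F_right b S_intros \<pi>in ss x y)
    also have "F ((\<pi> (s\<^sup>\<star>) x)\<^sup>\<star> * y) = F (x\<^sup>\<star> * \<pi> s y)" using adj[OF ss x y] by (simp add: star_star)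
    also have "\<dots> * b = F (x\<^sup>\<star> * (\<pi> s y * b))"
      using x y s b by (simp add: F_right S_intros \<pi>in flip: mult.assoc)
    finally show "F (x\<^sup>\<star> * \<pi> s (y * b)) = F (x\<^sup>\<star> * (\<pi> s y * b))" .
  qed
  show "\<exists>a\<in>S. x * e = a * e" if x: "x \<in> S1"
  proof
    show aS: "\<pi> x 1 \<in> S" by (intro \<pi>in x S_intros)
    show "x * e = \<pi> x 1 * e"
    proof (rule eqI)
      show "x * e \<in> S1" "\<pi> x 1 * e \<in> S1" by (intro S1_intros x e_in S_sub_S1 aS)+
      fix y assume y: "y \<in> S"
      have "\<pi> (x * e) y = \<pi> x (1 * F y)" by (simp add: \<pi>mult x e_in y \<pi>e)
      also have "\<dots> = \<pi> x 1 * F y" by (intro linear x S_intros F_in y)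
      also have "\<dots> = \<pi> (\<pi> x 1 * e) y" by (simp add: \<pi>mult S_sub_S1 aS e_in y \<pi>e \<pi>S S_intros)
      finally show "\<pi> (x * e) y = \<pi> (\<pi> x 1 * e) y" .
    qed
  qed
  show "(\<Sum>i\<in>I. l i * e * (l i)\<^sup>\<star>) = 1"
  proof (rule eqI)
    note in1 = S1_intros e_in S_sub_S1[OF basis_in]
    show "(\<Sum>i\<in>I. l i * e * (l i)\<^sup>\<star>) \<in> S1" by (intro in1)
    show "1 \<in> S1" by (intro in1)
    fix y assume y: "y \<in> S"
    have "\<pi> (\<Sum>i\<in>I. l i * e * (l i)\<^sup>\<star>) y = (\<Sum>i\<in>I. \<pi> (l i * e * (l i)\<^sup>\<star>) y)"
      by (intro \<pi>sum in1 y)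
    also have "\<dots> = (\<Sum>i\<in>I. l i * F ((l i)\<^sup>\<star> * y))"
      by (intro sum.cong refl) (simp add: \<pi>mult in1 y \<pi>in \<pi>e \<pi>S S_intros S_sub_S1)
    also have "\<dots> = \<pi> 1 y" by (simp add: basis y \<pi>S S_intros)
    finally show "\<pi> (\<Sum>i\<in>I. l i * e * (l i)\<^sup>\<star>) y = \<pi> 1 y" .
  qed
qed

lemma S1_span:
  assumes x: "x \<in> S1"
  shows "\<exists>a. (\<forall>i\<in>I. a i \<in> S) \<and> x = (\<Sum>i\<in>I. a i * e * (l i)\<^sup>\<star>)"
proof -
  have "\<forall>i\<in>I. \<exists>a\<in>S. x * l i * e = a * e"
    by (intro ballI e_absorb S1_intros x S_sub_S1[OF basis_in])
  then obtain a where a: "\<And>i. i \<in> I \<Longrightarrow> a i \<in> S" "\<And>i. i \<in> I \<Longrightarrow> x * l i * e = a i * e" by metis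
  have "x = x * (\<Sum>i\<in>I. l i * e * (l i)\<^sup>\<star>)" by (simp only: resolution mult_1_right)
  also have "\<dots> = (\<Sum>i\<in>I. x * l i * e * (l i)\<^sup>\<star>)" by (simp add: sum_distrib_left mult.assoc)
  also have "\<dots> = (\<Sum>i\<in>I. a i * e * (l i)\<^sup>\<star>)" by (intro sum.cong refl) (simp add: a)
  finally show ?thesis using a(1) by (intro exI[of _ a]) simp
qed

lemma F1_expectation: "conditional_expectation S1 S F1"
  and F1_dual: "a \<in> S \<Longrightarrow> b \<in> S \<Longrightarrow> F1 (a * e * b) = t *\<^sub>R (a * b)"
  using dual by (simp_all add: dual_expectation_def)

lemma F1_sum: "(\<And>j. j \<in> J \<Longrightarrow> f j \<in> S1) \<Longrightarrow> F1 (\<Sum>j\<in>J. f j) = (\<Sum>j\<in>J. F1 (f j))"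
proof -
  have z: "F1 0 = 0" and a: "\<And>x y. x \<in> S1 \<Longrightarrow> y \<in> S1 \<Longrightarrow> F1 (x + y) = F1 x + F1 y"
    using F1_expectation by (auto simp: conditional_expectation_def S_intros)
  show "(\<And>j. j \<in> J \<Longrightarrow> f j \<in> S1) \<Longrightarrow> ?thesis"
    by (induction J rule: infinite_finite_induct) (simp_all add: z a S1_intros)
qed

abbreviation m :: "'i \<Rightarrow> 'a" where "m \<equiv> dual_basis l t e"

lemma dual_index_expectation: "index_expectation S1 S F1 I m"
proof
  show "m i \<in> S1" if "i \<in> I" for i
    unfolding dual_basis_def using that by (intro S1_intros e_in S_sub_S1[OF basis_in])
  fix x assume xS1: "x \<in> S1"
  obtain a where a: "\<And>j. j \<in> I \<Longrightarrow> a j \<in> S" and x: "x = (\<Sum>j\<in>I. a j * e * (l j)\<^sup>\<star>)"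
    using S1_span[OF xS1] by (elim exE conjE) (rule that, erule (1) bspec, assumption)
  have F1m: "F1 ((m i)\<^sup>\<star> * x) = (sqrt t) *\<^sub>R (\<Sum>j\<in>I. F ((l i)\<^sup>\<star> * a j) * (l j)\<^sup>\<star>)" if i: "i \<in> I" for i
  proof -
    have "(m i)\<^sup>\<star> * x = (\<Sum>j\<in>I. (1 / sqrt t) *\<^sub>R (F ((l i)\<^sup>\<star> * a j)) * e * (l j)\<^sup>\<star>)"
      unfolding x sum_distrib_left
    proof (intro sum.cong refl)
      fix j assume j: "j \<in> I"
      have "(m i)\<^sup>\<star> * (a j * e * (l j)\<^sup>\<star>) = (1 / sqrt t) *\<^sub>R (e * ((l i)\<^sup>\<star> * a j) * e * (l j)\<^sup>\<star>)"
        by (simp add: dual_basis_def star_simps e_star mult.assoc)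
      also have "e * ((l i)\<^sup>\<star> * a j) * e = F ((l i)\<^sup>\<star> * a j) * e"
        by (intro e_sandwich S_intros i a j)
      finally show "(m i)\<^sup>\<star> * (a j * e * (l j)\<^sup>\<star>) = (1 / sqrt t) *\<^sub>R (F ((l i)\<^sup>\<star> * a j)) * e * (l j)\<^sup>\<star>"
        by simp
    qed
    also have "F1 \<dots> = (\<Sum>j\<in>I. F1 ((1 / sqrt t) *\<^sub>R (F ((l i)\<^sup>\<star> * a j)) * e * (l j)\<^sup>\<star>))"
      by (intro F1_sum S1_intros e_in S_sub_S1 S_intros a i)
    also have "\<dots> = (\<Sum>j\<in>I. t *\<^sub>R ((1 / sqrt t) *\<^sub>R (F ((l i)\<^sup>\<star> * a j)) * (l j)\<^sup>\<star>))"
      by (intro sum.cong refl F1_dual S_intros a i)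
    also have "\<dots> = (sqrt t) *\<^sub>R (\<Sum>j\<in>I. F ((l i)\<^sup>\<star> * a j) * (l j)\<^sup>\<star>)"
      using t_pos by (simp add: scaleR_sum_right real_div_sqrt)
    finally show ?thesis .
  qed
  have "(\<Sum>i\<in>I. m i * F1 ((m i)\<^sup>\<star> * x)) = (\<Sum>i\<in>I. \<Sum>j\<in>I. l i * F ((l i)\<^sup>\<star> * a j) * (e * (l j)\<^sup>\<star>))"
  proof (intro sum.cong refl)
    fix i assume i: "i \<in> I"
    have "m i * F1 ((m i)\<^sup>\<star> * x) = (\<Sum>j\<in>I. l i * (e * F ((l i)\<^sup>\<star> * a j)) * (l j)\<^sup>\<star>)"
      unfolding F1m[OF i] using t_pos
      by (simp add: dual_basis_def sum_distrib_left mult.assoc scaleR_sum_right)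
    also have "\<dots> = (\<Sum>j\<in>I. l i * F ((l i)\<^sup>\<star> * a j) * (e * (l j)\<^sup>\<star>))"
      by (intro sum.cong refl) (simp add: e_commute S_intros a i mult.assoc)
    finally show "m i * F1 ((m i)\<^sup>\<star> * x) = (\<Sum>j\<in>I. l i * F ((l i)\<^sup>\<star> * a j) * (e * (l j)\<^sup>\<star>))" .
  qed
  also have "\<dots> = (\<Sum>j\<in>I. (\<Sum>i\<in>I. l i * F ((l i)\<^sup>\<star> * a j)) * (e * (l j)\<^sup>\<star>))"
    by (subst sum.swap) (simp add: sum_distrib_right)
  also have "\<dots> = x" unfolding x by (intro sum.cong refl) (simp add: basis a mult.assoc)
  finally show "(\<Sum>i\<in>I. m i * F1 ((m i)\<^sup>\<star> * x)) = x" .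
qed (use subalgebra_S1 subalgebra_S F1_expectation finite_I in auto)

sublocale dual: index_expectation S1 S F1 I m
  by (rule dual_index_expectation)

lemma F1_e: "a \<in> S \<Longrightarrow> F1 (a * e) = t *\<^sub>R a"
  using F1_dual[of a 1] by (simp add: S_intros)

lemma e_cancel: assumes "a \<in> S" "b \<in> S" "a * e = b * e" shows "a = b"
proof -
  have "t *\<^sub>R a = t *\<^sub>R b" by (simp only: F1_e[OF assms(1), symmetric] F1_e[OF assms(2), symmetric] assms(3))
  then show ?thesis using t_pos by simp
qed

lemma absorbed_in_commutant:
  assumes c: "\<And>b. b \<in> R \<Longrightarrow> c * b = b * c" and a: "a \<in> S" "c * e = a * e"
  shows "a \<in> P"
proof -
  have "a * b = b * a" if b: "b \<in> R" for b
  proof (rule e_cancel)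
    have "a * b * e = (a * e) * b" by (simp only: mult.assoc e_commute[OF b])
    also have "\<dots> = c * b * e" by (simp only: a(2)[symmetric] mult.assoc e_commute[OF b])
    also have "\<dots> = b * (c * e)" by (simp only: c[OF b] mult.assoc)
    finally show "a * b * e = b * a * e" by (simp only: a(2) mult.assoc)
    show "a * b \<in> S" "b * a \<in> S" using R_sub_S[OF b] a by (simp_all add: S_intros)
  qed
  then show ?thesis using a(1) by (simp add: rel_commutant_def)
qed

text \<open>The pushdown formula \<open>e x = t\<^sup>-\<^sup>1 e F1 (e x)\<close>: it replaces \<open>x \<in> S1\<close> by an element of \<open>S\<close> behind \<open>e\<close>.\<close>

lemma pushdown: assumes "x \<in> S1" shows "e * F1 (e * x) = t *\<^sub>R (e * x)"
proof -
  obtain a where a: "\<And>j. j \<in> I \<Longrightarrow> a j \<in> S" and x: "x = (\<Sum>j\<in>I. a j * e * (l j)\<^sup>\<star>)"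
    using S1_span[OF assms] by (elim exE conjE) (rule that, erule (1) bspec, assumption)
  have ex: "e * x = (\<Sum>j\<in>I. F (a j) * e * (l j)\<^sup>\<star>)"
    unfolding x sum_distrib_left by (intro sum.cong refl) (simp add: a flip: mult.assoc e_sandwich)
  have "F1 (e * x) = (\<Sum>j\<in>I. F1 (F (a j) * e * (l j)\<^sup>\<star>))"
    unfolding ex by (intro F1_sum S1_intros e_in S_sub_S1 S_intros a)
  also have "\<dots> = (\<Sum>j\<in>I. t *\<^sub>R (F (a j) * (l j)\<^sup>\<star>))"
    by (intro sum.cong refl F1_dual S_intros a)
  finally have "e * F1 (e * x) = (\<Sum>j\<in>I. t *\<^sub>R (e * F (a j) * (l j)\<^sup>\<star>))"
    by (simp add: sum_distrib_left mult.assoc)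
  also have "\<dots> = (\<Sum>j\<in>I. t *\<^sub>R (F (a j) * e * (l j)\<^sup>\<star>))"
    by (intro sum.cong refl) (simp add: e_commute F_in a)
  finally show ?thesis by (simp add: ex scaleR_sum_right)
qed

lemma centre_S1:
  assumes c: "c \<in> S1" and cc: "\<And>x. x \<in> S1 \<Longrightarrow> c * x = x * c"
  shows "\<exists>k. c = k *\<^sub>C 1"
proof -
  obtain a where a: "a \<in> S" "c * e = a * e" using e_absorb[OF c] by blast
  have "a * e = c * (e * e)" by (simp only: a(2) e_idem)
  also have "\<dots> = (c * e) * e" by (simp only: mult.assoc)
  also have "\<dots> = e * c * e" by (simp only: cc[OF e_in])
  also have "\<dots> = e * a * e" by (simp only: a(2) mult.assoc)
  also have "\<dots> = F a * e" by (rule e_sandwich[OF a(1)])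
  finally have aF: "a = F a" by (rule e_cancel[OF a(1) R_sub_S[OF F_in[OF a(1)]]])
  have "a \<in> P" by (rule absorbed_in_commutant[OF cc a]) (intro S_sub_S1 R_sub_S)
  then obtain k where k: "a = k *\<^sub>C 1" using F_scalar aF by metis
  have "c = c * (\<Sum>i\<in>I. l i * e * (l i)\<^sup>\<star>)" by (simp only: resolution mult_1_right)
  also have "\<dots> = (\<Sum>i\<in>I. l i * (c * e) * (l i)\<^sup>\<star>)"
    unfolding sum_distrib_left
    by (intro sum.cong refl) (simp add: cc S_sub_S1[OF basis_in] mult.assoc[symmetric])
  also have "\<dots> = k *\<^sub>C (\<Sum>i\<in>I. l i * e * (l i)\<^sup>\<star>)"
    by (simp add: a(2) k scaleC_mult_left scaleC_mult_right scaleC_sum_right)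
  also have "\<dots> = k *\<^sub>C 1" by (simp only: resolution)
  finally show ?thesis by blast
qed

text \<open>If \<open>c \<in> S' \<inter> S1\<close> and \<open>c e = a e\<close>, then \<open>a \<in> R' \<inter> S\<close>, and both \<open>F1 c\<close> and \<open>e c e\<close> are given by the scalar
  \<open>F a\<close>, the former because of the balance condition for \<open>F\<close>.\<close>

lemma dual_balanced: "balanced_expectation S1 S F1 I m t"
proof
  show "0 < t" by (rule t_pos)
  show "\<exists>k. c = k *\<^sub>C 1" if "c \<in> S" "\<And>b. b \<in> S \<Longrightarrow> c * b = b * c" for c
    using that by (rule centre_S)
  fix c assume "c \<in> rel_commutant S S1"
  then have c: "c \<in> S1" and cc: "\<And>b. b \<in> S \<Longrightarrow> c * b = b * c" by (auto simp: rel_commutant_def)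
  obtain a where a: "a \<in> S" "c * e = a * e" using e_absorb[OF c] by blast
  have aP: "a \<in> P" by (rule absorbed_in_commutant[OF cc a]) (rule R_sub_S)
  obtain k where k: "F a = k *\<^sub>C 1" using F_scalar[OF aP] by blast
  have "c = c * (\<Sum>i\<in>I. l i * e * (l i)\<^sup>\<star>)" by (simp only: resolution mult_1_right)
  also have "\<dots> = (\<Sum>i\<in>I. l i * (c * e) * (l i)\<^sup>\<star>)"
    unfolding sum_distrib_left
    by (intro sum.cong refl) (simp add: cc basis_in mult.assoc[symmetric])
  finally have c_eq: "c = (\<Sum>i\<in>I. l i * a * e * (l i)\<^sup>\<star>)" by (simp add: a(2) mult.assoc)
  have "F1 c = (\<Sum>i\<in>I. F1 (l i * a * e * (l i)\<^sup>\<star>))"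
    by (subst c_eq) (intro F1_sum S1_intros e_in S_sub_S1[OF a(1)] S_sub_S1[OF basis_in])
  also have "\<dots> = (\<Sum>i\<in>I. t *\<^sub>R (l i * a * (l i)\<^sup>\<star>))"
    by (intro sum.cong refl F1_dual S_intros a)
  also have "\<dots> = F a" using balance[OF aP] t_pos by (simp flip: scaleR_sum_right)
  finally have F1c: "F1 c = k *\<^sub>C 1" by (simp add: k)
  have ece: "e * c * e = k *\<^sub>C e"
    using e_sandwich[OF a(1)] by (simp add: a(2) k scaleC_mult_left mult.assoc)
  have "dual.average c = (1 / t) *\<^sub>R (\<Sum>i\<in>I. l i * (e * c * e) * (l i)\<^sup>\<star>)"
    using t_pos by (simp add: dual_basis_def star_simps e_star mult.assoc scaleR_sum_right)
  also have "(\<Sum>i\<in>I. l i * (e * c * e) * (l i)\<^sup>\<star>) = k *\<^sub>C (\<Sum>i\<in>I. l i * e * (l i)\<^sup>\<star>)"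
    by (simp add: ece scaleC_mult_left scaleC_mult_right scaleC_sum_right)
  also have "\<dots> = F1 c" by (simp only: resolution F1c)
  finally show "dual.average c = (1 / t) *\<^sub>R F1 c" .
qed

sublocale dual: balanced_expectation S1 S F1 I m t
  by (rule dual_balanced)

text \<open>Multiplication by \<open>e\<close> undoes averaging: \<open>e l\<^sub>i e = F (l\<^sub>i) e\<close>, and the coefficient \<open>F (l\<^sub>i)\<close> moves past \<open>z\<close>.\<close>

lemma e_average:
  assumes z: "\<And>b. b \<in> R \<Longrightarrow> b * z = z * b"
  shows "e * average (e * z) = e * z"
proof -
  have "e * average (e * z) = (\<Sum>i\<in>I. e * z * (F (l i) * (l i)\<^sup>\<star>))"
    unfolding sum_distrib_left
  proof (intro sum.cong refl)
    fix i assume i: "i \<in> I"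
    have FR: "F (l i) \<in> R" by (intro F_in basis_in i)
    have "e * (l i * (e * z) * (l i)\<^sup>\<star>) = (e * l i * e) * z * (l i)\<^sup>\<star>" by (simp only: mult.assoc)
    also have "\<dots> = (F (l i) * e) * z * (l i)\<^sup>\<star>" by (simp only: e_sandwich[OF basis_in[OF i]])
    also have "\<dots> = (e * F (l i)) * z * (l i)\<^sup>\<star>" by (simp only: e_commute[OF FR])
    also have "\<dots> = e * (F (l i) * z) * (l i)\<^sup>\<star>" by (simp only: mult.assoc)
    also have "\<dots> = e * z * (F (l i) * (l i)\<^sup>\<star>)" by (simp only: z[OF FR] mult.assoc)
    finally show "e * (l i * (e * z) * (l i)\<^sup>\<star>) = e * z * (F (l i) * (l i)\<^sup>\<star>)" .
  qed
  also have "\<dots> = e * z" using basis'[OF S_intros(1)] by (simp flip: sum_distrib_left)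
  finally show ?thesis .
qed

lemma average_e:
  assumes z: "\<And>b. b \<in> R \<Longrightarrow> b * z = z * b"
  shows "average (z * e) * e = z * e"
proof -
  have zs: "b * z\<^sup>\<star> = z\<^sup>\<star> * b" if "b \<in> R" for b
    using z[of "b\<^sup>\<star>"] that by (metis R_intros(7) star_mult star_star)
  have "average (z * e) * e = (e * average (e * z\<^sup>\<star>))\<^sup>\<star>"
    by (simp add: star_simps e_star mult.assoc)
  also have "\<dots> = z * e" by (subst e_average) (simp_all add: zs star_simps e_star)
  finally show ?thesis .
qed

text \<open>The coefficients \<open>F (l\<^sub>i\<^sup>* l\<^sub>j)\<close> that appear between the two factors move past \<open>p\<close>, and reduce the double sum.\<close>

lemma average_mult_average:
  assumes p: "\<And>b. b \<in> R \<Longrightarrow> b * p = p * b"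
  shows "average (p * e) * average (e * q) = average (p * e * q)"
proof -
  have "average (p * e) * average (e * q) =
      (\<Sum>i\<in>I. \<Sum>j\<in>I. l i * F ((l i)\<^sup>\<star> * l j) * (p * e * q * (l j)\<^sup>\<star>))"
    unfolding sum_product
  proof (intro sum.cong refl)
    fix i j assume i: "i \<in> I" and j: "j \<in> I"
    have FR: "F ((l i)\<^sup>\<star> * l j) \<in> R" by (intro S_intros i j)
    have "l i * (p * e) * (l i)\<^sup>\<star> * (l j * (e * q) * (l j)\<^sup>\<star>) =
        l i * p * (e * ((l i)\<^sup>\<star> * l j) * e) * (q * (l j)\<^sup>\<star>)" by (simp only: mult.assoc)
    also have "e * ((l i)\<^sup>\<star> * l j) * e = F ((l i)\<^sup>\<star> * l j) * e" by (intro e_sandwich S_intros i j)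
    also have "l i * p * (F ((l i)\<^sup>\<star> * l j) * e) * (q * (l j)\<^sup>\<star>) =
        l i * (p * F ((l i)\<^sup>\<star> * l j)) * (e * q * (l j)\<^sup>\<star>)" by (simp only: mult.assoc)
    also have "\<dots> = l i * F ((l i)\<^sup>\<star> * l j) * (p * e * q * (l j)\<^sup>\<star>)"
      by (simp only: p[OF FR, symmetric] mult.assoc)
    finally show "l i * (p * e) * (l i)\<^sup>\<star> * (l j * (e * q) * (l j)\<^sup>\<star>) =
        l i * F ((l i)\<^sup>\<star> * l j) * (p * e * q * (l j)\<^sup>\<star>)" .
  qed
  also have "\<dots> = (\<Sum>j\<in>I. \<Sum>i\<in>I. l i * F ((l i)\<^sup>\<star> * l j) * (p * e * q * (l j)\<^sup>\<star>))"
    by (rule sum.swap)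
  also have "\<dots> = (\<Sum>j\<in>I. l j * (p * e * q * (l j)\<^sup>\<star>))"
    by (intro sum.cong refl) (simp add: basis basis_in flip: sum_distrib_right)
  finally show ?thesis by (simp add: mult.assoc)
qed

end


section \<open>Expectations onto relative commutants\<close>

context balanced_expectation
begin

lemma average_of_commutant:
  assumes "\<And>y. y \<in> S \<Longrightarrow> q * y = y * q"
  shows "t *\<^sub>R average q = q"
proof -
  have "average q = q * average 1"
    unfolding sum_distrib_left
    by (intro sum.cong refl) (simp add: assms S_intros flip: mult.assoc)
  also have "average 1 = (1 / t) *\<^sub>R 1" using balance[of 1] by (simp add: P_intros F_one)
  finally show ?thesis using t_pos by simp
qed

lemma commutant_expectation:
  assumes D: "cstar_subalgebra D" and SD: "S \<subseteq> D"
  shows "conditional_expectation (rel_commutant R D) (rel_commutant S D) (\<lambda>x. t *\<^sub>R average x)"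
  unfolding conditional_expectation_def cstar_positive_iff
proof (intro conjI ballI allI)
  note DI = subalg_intros[OF D]
  show "rel_commutant S D \<subseteq> rel_commutant R D" using R_sub_S by (auto simp: rel_commutant_def)
  fix x assume x: "x \<in> rel_commutant R D"
  then have xD: "x \<in> D" and xc: "\<And>b. b \<in> R \<Longrightarrow> b * x = x * b" by (auto simp: rel_commutant_def)
  have "average x \<in> D" using SD basis_in xD by (intro DI) auto
  then show "t *\<^sub>R average x \<in> rel_commutant S D"
    using average_commute[OF xc] by (simp add: rel_commutant_def DI)
  show "t *\<^sub>R average (x + y) = t *\<^sub>R average x + t *\<^sub>R average y" for y
    by (simp add: algebra_simps sum.distrib)
  show "t *\<^sub>R average (c *\<^sub>C x) = c *\<^sub>C t *\<^sub>R average x" for c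
    by (simp add: scaleC_mult_left scaleC_mult_right scaleC_sum_right[symmetric] scaleC_scaleC mult.commute
        flip: scaleC_of_real)
  have "average (x\<^sup>\<star> * x) = (\<Sum>i\<in>I. (x * (l i)\<^sup>\<star>)\<^sup>\<star> * (x * (l i)\<^sup>\<star>))"
    by (simp add: star_simps mult.assoc)
  then show "positive (t *\<^sub>R average (x\<^sup>\<star> * x))"
    using t_pos by (simp add: positive_scaleR positive_sum positive_star_mult_self)
next
  fix b assume "b \<in> rel_commutant S D"
  then show "t *\<^sub>R average b = b" by (intro average_of_commutant) (simp add: rel_commutant_def)
next
  fix b b' x assume b: "b \<in> rel_commutant S D" and b': "b' \<in> rel_commutant S D"
  have "average (b * x * b') = b * average x * b'"
    unfolding sum_distrib_left sum_distrib_right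
  proof (intro sum.cong refl)
    fix i assume i: "i \<in> I"
    have "b * l i = l i * b" "b' * (l i)\<^sup>\<star> = (l i)\<^sup>\<star> * b'"
      using b b' basis_in[OF i] S_intros(7)[OF basis_in[OF i]] by (simp_all add: rel_commutant_def)
    then show "l i * (b * x * b') * (l i)\<^sup>\<star> = b * (l i * x * (l i)\<^sup>\<star>) * b'"
      by (metis mult.assoc)
  qed
  then show "t *\<^sub>R average (b * x * b') = b * (t *\<^sub>R average x) * b'" by simp
qed

text \<open>\<open>H\<close> commutes with averaging by bimodularity, and maps \<open>x\<close> into \<open>R' \<inter> S\<close>, where balance evaluates the average.\<close>

lemma average_trace:
  assumes H: "index_expectation D S H J k" and x: "x \<in> rel_commutant R D"
  shows "F (H (t *\<^sub>R average x)) = F (H x)"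
proof -
  interpret H: index_expectation D S H J k by fact
  have xD: "x \<in> D" and xc: "\<And>b. b \<in> R \<Longrightarrow> x * b = b * x" using x by (auto simp: rel_commutant_def)
  have Hx: "H x \<in> P"
    using H.F_left[OF R_sub_S xD] H.F_right[OF R_sub_S xD] xc by (simp add: rel_commutant_def H.F_in xD)
  have av: "average x \<in> D" by (intro H.S_intros H.R_sub_S[OF basis_in] xD)
  have "H (average x) = average (H x)"
    using H.R_sub_S[OF basis_in] xD
    by (subst H.F_sum) (auto intro!: H.S_intros sum.cong H.F_bimodule S_intros)
  then have "H (t *\<^sub>R average x) = F (H x)"
    using balance[OF Hx] t_pos by (simp add: H.F_scaleR av)
  then show ?thesis by (simp add: F_id F_in H.F_in xD)
qed

text \<open>An orthonormal basis of \<open>P\<close> is a quasi-basis of the restriction of \<open>F\<close>, whose range is the centre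
  of \<open>R\<close>.\<close>

lemma commutant_index_nonzero:
  shows "watatani_index P F \<in> P" "watatani_index P F \<noteq> 0"
proof -
  obtain N v where on: "orthonormal N v" and bas: "\<And>x. x \<in> P \<Longrightarrow> (\<Sum>a<N. v a * F ((v a)\<^sup>\<star> * x)) = x"
    using orthonormal_basis by blast
  have v: "v a \<in> P" if "a < N" for a using on that by (simp add: orthonormal_def)
  let ?Z = "rel_commutant R R"
  have Z: "cstar_subalgebra ?Z"
    by (rule cstar_subalgebra_rel_commutant[OF subalgebra_R subalg_star[OF subalgebra_R]])
  have ZP: "b \<in> P" "b \<in> R" if "b \<in> ?Z" for b using that R_sub_S by (auto simp: rel_commutant_def)
  have "conditional_expectation P ?Z F"
    unfolding conditional_expectation_def cstar_positive_iff
  proof (intro conjI ballI allI)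
    show "?Z \<subseteq> P" using ZP by blast
    fix x y c assume x: "x \<in> P"
    show "F x \<in> ?Z" using F_commute[OF x] F_in[OF P_S[OF x]] by (simp add: rel_commutant_def)
    show "F (x + y) = F x + F y" if "y \<in> P" by (intro F_add P_S x that)
    show "F (c *\<^sub>C x) = c *\<^sub>C F x" by (intro F_scaleC P_S x)
    show "positive (F (x\<^sup>\<star> * x))" by (intro F_positive P_S x)
  next
    fix b b' x assume "b \<in> ?Z" "b' \<in> ?Z" "x \<in> P"
    then show "F (b * x * b') = b * F x * b'" by (simp add: F_bimodule[OF ZP(2) ZP(2) P_S])
  qed (intro F_id ZP)
  moreover have qb: "quasi_basis P F N v" using v bas by (auto simp: quasi_basis_def)
  ultimately interpret Z: index_expectation P ?Z F "{..<N}" v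
    by (intro index_expectation_of_quasi_basis subalgebra_P Z)
  have eq: "watatani_index P F = Z.average 1" using Z.watatani_index_eq[OF qb] by simp
  show "watatani_index P F \<noteq> 0" unfolding eq by (rule Z.average_one_nonzero)
  show "watatani_index P F \<in> P" unfolding eq by (intro Z.average_in P_intros)
qed

end

text \<open>The difference \<open>d\<close> of the two values lies in \<open>Q\<close>, so \<open>d\<^sup>*\<close> can be moved inside both expectations, and
  \<open>tr (d\<^sup>* d) = 0\<close>.\<close>

lemma trace_preserving_expectation_eq:
  assumes F: "conditional_expectation P Q F" and G: "conditional_expectation P Q G"
    and P: "cstar_subalgebra P" and Q: "cstar_subalgebra Q"
    and tF: "\<And>x. x \<in> P \<Longrightarrow> tr (F x) = tr x" and tG: "\<And>x. x \<in> P \<Longrightarrow> tr (G x) = tr x"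
    and diff: "\<And>x y. x \<in> P \<Longrightarrow> y \<in> P \<Longrightarrow> tr (x - y) = (tr x - tr y :: complex)"
    and faithful: "\<And>x. x \<in> P \<Longrightarrow> tr (x\<^sup>\<star> * x) = 0 \<Longrightarrow> x = 0"
    and x: "x \<in> P"
  shows "F x = G x"
proof -
  have QP: "q \<in> P" if "q \<in> Q" for q using F that by (auto simp: conditional_expectation_def)
  have in_Q: "F x \<in> Q" "G x \<in> Q" using F G x by (auto simp: conditional_expectation_def)
  define d where "d = F x - G x"
  have d: "d \<in> Q" unfolding d_def by (intro subalg_intros[OF Q] in_Q)
  have ds: "d\<^sup>\<star> \<in> Q" by (intro subalg_intros[OF Q] d)
  have left: "H (d\<^sup>\<star> * x) = d\<^sup>\<star> * H x" if "conditional_expectation P Q H" for H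
  proof -
    have "H (d\<^sup>\<star> * x * 1) = d\<^sup>\<star> * H x * 1"
      using that ds x subalg_one[OF Q] unfolding conditional_expectation_def by blast
    then show ?thesis by simp
  qed
  have dx: "d\<^sup>\<star> * x \<in> P" by (intro subalg_intros[OF P] QP[OF d] x)
  have "d\<^sup>\<star> * d = d\<^sup>\<star> * F x - d\<^sup>\<star> * G x" by (simp add: d_def right_diff_distrib)
  also have "tr \<dots> = tr (d\<^sup>\<star> * F x) - tr (d\<^sup>\<star> * G x)"
    by (intro diff subalg_intros[OF P] QP d in_Q)
  also have "\<dots> = 0" using tF[OF dx] tG[OF dx] by (simp add: left F G)
  finally have "d = 0" by (intro faithful QP d)
  then show ?thesis by (simp add: d_def)
qed


section \<open>Three steps of the tower\<close>

locale three_steps =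
  s0: jones_step A0 B E0 I l t A1 e1 E1 +
  s1: jones_step A1 A0 E1 I "dual_basis l t e1" t A2 e2 E2 +
  s2: jones_step A2 A1 E2 I "dual_basis (dual_basis l t e1) t e2" t A3 e3 E3
  for B A0 A1 A2 A3 :: "'a::unital_cstar_algebra set" and E0 E1 E2 E3 :: "'a \<Rightarrow> 'a"
    and e1 e2 e3 :: 'a and I :: "'i set" and l :: "'i \<Rightarrow> 'a" and t :: real
begin

abbreviation "m1 \<equiv> dual_basis l t e1"
abbreviation "m2 \<equiv> dual_basis m1 t e2"
abbreviation "m3 \<equiv> dual_basis m2 t e3"

text \<open>\<open>E\<^sub>1 E\<^sub>2\<close>, \<open>E\<^sub>2 E\<^sub>3\<close> and \<open>E\<^sub>1 E\<^sub>2 E\<^sub>3\<close>; the first and the last give the trace on \<open>A\<^sub>0' \<inter> A\<^sub>2\<close> and \<open>A\<^sub>0' \<inter> A\<^sub>3\<close>.\<close>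

sublocale E12: balanced_expectation A2 A0 "\<lambda>x. E1 (E2 x)" "I \<times> I" "\<lambda>(j, i). m2 j * m1 i" "t * t"
  by (rule balanced_compose) unfold_locales

sublocale E23: balanced_expectation A3 A1 "\<lambda>x. E2 (E3 x)" "I \<times> I" "\<lambda>(j, i). m3 j * m2 i" "t * t"
  by (rule balanced_compose) unfold_locales

sublocale E123: balanced_expectation A3 A0 "\<lambda>x. E1 (E2 (E3 x))" "I \<times> (I \<times> I)"
    "\<lambda>(j, i). m3 j * (case i of (j, i) \<Rightarrow> m2 j * m1 i)" "t * (t * t)"
  by (rule balanced_compose) unfold_locales

lemma t_pos: "0 < t" by (rule s0.t_pos)

lemma sub01: "x \<in> A0 \<Longrightarrow> x \<in> A1" and sub12: "x \<in> A1 \<Longrightarrow> x \<in> A2" and sub23: "x \<in> A2 \<Longrightarrow> x \<in> A3"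
  and subB0: "x \<in> B \<Longrightarrow> x \<in> A0"
  by (fact s0.S_sub_S1 s1.S_sub_S1 s2.S_sub_S1 s0.R_sub_S)+

lemmas A1_intros = s0.dual.S_intros sub01 s0.e_in
lemmas A2_intros = s1.dual.S_intros sub12 s1.e_in

lemma e2_commute: "b \<in> A0 \<Longrightarrow> e2 * b = b * e2"
  and e3_commute: "b \<in> A1 \<Longrightarrow> e3 * b = b * e3"
  and e1_commute: "b \<in> B \<Longrightarrow> e1 * b = b * e1"
  by (fact s1.e_commute s2.e_commute s0.e_commute)+

lemma e2_e1_e2: "e2 * e1 * e2 = t *\<^sub>R e2"
proof -
  have "E1 e1 = t *\<^sub>R 1" using s0.F1_e[of 1] by (simp add: s0.S_intros)
  then show ?thesis using s1.e_sandwich[OF s0.e_in] by simp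
qed

lemma e3_e2_e3: "e3 * e2 * e3 = t *\<^sub>R e3"
proof -
  have "E2 e2 = t *\<^sub>R 1" using s1.F1_e[of 1] by (simp add: s0.dual.S_intros)
  then show ?thesis using s2.e_sandwich[OF s1.e_in] by simp
qed

text \<open>By the pushdown formula both sides agree after multiplication by \<open>a e\<^sub>2\<close> for every \<open>a \<in> A\<^sub>1\<close>.\<close>

lemma e1_e2_e1: "e1 * e2 * e1 = t *\<^sub>R e1"
proof -
  have *: "e1 * e2 * e1 * (a * e2) = t *\<^sub>R e1 * (a * e2)" if a: "a \<in> A1" for a
  proof -
    have "e1 * e2 * e1 * (a * e2) = e1 * (e2 * (e1 * a) * e2)" by (simp only: mult.assoc)
    also have "e2 * (e1 * a) * e2 = E1 (e1 * a) * e2"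
      by (intro s1.e_sandwich s0.S1_intros s0.e_in a)
    also have "e1 * (E1 (e1 * a) * e2) = e1 * E1 (e1 * a) * e2" by (simp only: mult.assoc)
    also have "e1 * E1 (e1 * a) = t *\<^sub>R (e1 * a)" by (rule s0.pushdown[OF a])
    finally show ?thesis by (simp add: mult.assoc)
  qed
  have "e1 * e2 * e1 = e1 * e2 * e1 * (\<Sum>i\<in>I. m1 i * e2 * (m1 i)\<^sup>\<star>)"
    by (simp only: s1.resolution mult_1_right)
  also have "\<dots> = (\<Sum>i\<in>I. e1 * e2 * e1 * (m1 i * e2) * (m1 i)\<^sup>\<star>)"
    by (simp only: sum_distrib_left mult.assoc)
  also have "\<dots> = (\<Sum>i\<in>I. t *\<^sub>R e1 * (m1 i * e2) * (m1 i)\<^sup>\<star>)"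
    by (intro sum.cong refl) (simp only: *[OF s0.dual.basis_in])
  also have "\<dots> = t *\<^sub>R e1 * (\<Sum>i\<in>I. m1 i * e2 * (m1 i)\<^sup>\<star>)"
    by (simp only: sum_distrib_left mult.assoc)
  finally show ?thesis by (simp only: s1.resolution mult_1_right)
qed

abbreviation U :: "'a set" where "U \<equiv> rel_commutant B A1"
abbreviation V :: "'a set" where "V \<equiv> rel_commutant A0 A2"

lemma U_in: "y \<in> U \<Longrightarrow> y \<in> A1" and U_comm: "y \<in> U \<Longrightarrow> b \<in> B \<Longrightarrow> y * b = b * y"
  and V_in: "w \<in> V \<Longrightarrow> w \<in> A2" and V_comm: "w \<in> V \<Longrightarrow> b \<in> A0 \<Longrightarrow> w * b = b * w"
  by (auto simp: rel_commutant_def)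

lemma subalgebra_U: "cstar_subalgebra U"
  by (rule cstar_subalgebra_rel_commutant[OF s0.subalgebra_S1 subalg_star[OF s0.subalgebra_R]])

text \<open>\<open>\<Psi> y\<close> is the expectation of \<open>e\<^sub>1 e\<^sub>2 y\<close> onto the relative commutant of \<open>A\<^sub>0\<close>.\<close>

definition \<Psi> :: "'a \<Rightarrow> 'a" where "\<Psi> y = t *\<^sub>R s0.average (e1 * (e2 * y))"

lemma e2_U_comm: assumes "y \<in> U" "b \<in> B" shows "b * (e2 * y) = e2 * y * b"
  using e2_commute[OF subB0[OF assms(2)]] U_comm[OF assms] by (metis mult.assoc)

lemma e1_e2_U_comm: assumes "y \<in> U" "b \<in> B" shows "b * (e1 * (e2 * y)) = e1 * (e2 * y) * b"
  using e1_commute[OF assms(2)] e2_U_comm[OF assms] by (metis mult.assoc)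

lemma \<Psi>_in: assumes y: "y \<in> U" shows "\<Psi> y \<in> V"
proof -
  have "e1 * (e2 * y) \<in> rel_commutant B A2"
    using e1_e2_U_comm[OF y] U_in[OF y] by (simp add: rel_commutant_def A2_intros s0.e_in)
  moreover have "A0 \<subseteq> A2" using sub01 sub12 by blast
  ultimately show ?thesis
    using s0.commutant_expectation[OF s1.subalgebra_S1]
    unfolding \<Psi>_def conditional_expectation_def by blast
qed

lemma e1_\<Psi>: "y \<in> U \<Longrightarrow> e1 * \<Psi> y = t *\<^sub>R (e1 * (e2 * y))"
  unfolding \<Psi>_def mult_scaleR_right by (subst s0.e_average) (auto simp: e2_U_comm)

text \<open>The inverse of \<open>\<Psi>\<close>.\<close>

definition \<Phi> :: "'a \<Rightarrow> 'a" where "\<Phi> w = (1 / (t * t * t)) *\<^sub>R E2 (e2 * (e1 * w))"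

lemma \<Phi>_in: assumes w: "w \<in> V" shows "\<Phi> w \<in> U"
proof -
  have ew: "e2 * (e1 * w) \<in> A2" by (intro A2_intros s0.e_in V_in w)
  have "e2 * (e1 * w) * b = b * (e2 * (e1 * w))" if b: "b \<in> B" for b
    using e2_commute[OF subB0[OF b]] e1_commute[OF b] V_comm[OF w subB0[OF b]] by (metis mult.assoc)
  then have "E2 (e2 * (e1 * w)) * b = b * E2 (e2 * (e1 * w))" if "b \<in> B" for b
    using s1.dual.F_left[OF sub01[OF subB0[OF that]] ew] s1.dual.F_right[OF sub01[OF subB0[OF that]] ew] that by simp
  then show ?thesis using ew by (simp add: \<Phi>_def rel_commutant_def A1_intros s1.dual.F_in)
qed

lemma \<Psi>_\<Phi>: assumes w: "w \<in> V" shows "\<Psi> (\<Phi> w) = w"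
proof -
  have e1w: "e1 * w \<in> A2" by (intro A2_intros s0.e_in V_in w)
  have "e2 * \<Phi> w = (1 / (t * t)) *\<^sub>R (e2 * (e1 * w))"
    unfolding \<Phi>_def mult_scaleR_right s1.pushdown[OF e1w] using t_pos by simp
  then have "e1 * (e2 * \<Phi> w) = (1 / (t * t)) *\<^sub>R (e1 * e2 * e1 * w)" by (simp add: mult.assoc)
  also have "\<dots> = (1 / t) *\<^sub>R (e1 * w)" using t_pos by (simp add: e1_e2_e1)
  finally have "\<Psi> (\<Phi> w) = (\<Sum>i\<in>I. l i * (e1 * w) * (l i)\<^sup>\<star>)"
    using t_pos by (simp add: \<Psi>_def scaleR_sum_right)
  also have "\<dots> = (\<Sum>i\<in>I. l i * e1 * (l i)\<^sup>\<star>) * w"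
    unfolding sum_distrib_right
    by (intro sum.cong refl) (simp add: V_comm[OF w] s0.S_intros mult.assoc)
  finally show ?thesis by (simp only: s0.resolution mult_1_left)
qed

text \<open>The pairing of \<open>B' \<inter> A\<^sub>1\<close> and \<open>A\<^sub>0' \<inter> A\<^sub>2\<close> is the inner product on the latter, transported by \<open>\<Psi>\<close>.\<close>

lemma trace_\<Psi>:
  assumes y: "y \<in> U" and a: "a \<in> V"
  shows "E0 (E1 (E2 ((\<Psi> y)\<^sup>\<star> * a))) = E0 (E1 (E2 (y\<^sup>\<star> * e2 * e1 * a)))"
proof -
  define c where "c = y\<^sup>\<star> * e2 * e1 * a"
  have "(\<Psi> y)\<^sup>\<star> * a = t *\<^sub>R s0.average c"
    unfolding \<Psi>_def c_def star_scaleR star_sum scaleR_left_commute mult_scaleR_left sum_distrib_right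
  proof (intro arg_cong[of _ _ "scaleR t"] sum.cong refl)
    fix i assume i: "i \<in> I"
    have "(l i)\<^sup>\<star> * a = a * (l i)\<^sup>\<star>" by (intro V_comm[OF a, symmetric] s0.S_intros i)
    then show "(l i * (e1 * (e2 * y)) * (l i)\<^sup>\<star>)\<^sup>\<star> * a = l i * (y\<^sup>\<star> * e2 * e1 * a) * (l i)\<^sup>\<star>"
      by (simp add: star_simps s0.e_star s1.e_star mult.assoc)
  qed
  moreover have "c \<in> rel_commutant B A2"
  proof -
    have "y\<^sup>\<star> \<in> U" by (intro subalg_star[OF subalgebra_U] y)
    then have "c * b = b * c" if b: "b \<in> B" for b
      using U_comm[OF _ b] e2_commute[OF subB0[OF b]] e1_commute[OF b] V_comm[OF a subB0[OF b]]
      unfolding c_def by (metis mult.assoc)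
    moreover have "c \<in> A2" unfolding c_def by (intro A2_intros s0.e_in U_in y V_in a)
    ultimately show ?thesis by (simp add: rel_commutant_def)
  qed
  ultimately show ?thesis
    using s0.average_trace[OF E12.index_expectation_axioms] by (simp add: c_def)
qed

abbreviation tr3 :: "'a \<Rightarrow> complex" where "tr3 x \<equiv> scalar_value (E0 (E1 (E2 (E3 x))))"

lemma E0_scalar: "E0 (k *\<^sub>C 1) = k *\<^sub>C 1"
  by (rule s0.F_id) (rule s0.R_intros)+

lemma E123_scalar: assumes "x \<in> E123.P" shows "E1 (E2 (E3 x)) = tr3 x *\<^sub>C 1"
proof -
  obtain k where "E1 (E2 (E3 x)) = k *\<^sub>C 1" using E123.F_scalar[OF assms] by blast
  then show ?thesis by (simp only: E0_scalar scalar_value_scaleC)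
qed

lemma trace_preserving_expectation_eq_average:
  assumes x: "x \<in> rel_commutant A0 A3"
  shows "trace_preserving_expectation tr3 (rel_commutant A0 A3) (rel_commutant A1 A3) x = t *\<^sub>R s0.dual.average x"
proof -
  let ?G = "\<lambda>x. t *\<^sub>R s0.dual.average x"
  let ?F = "trace_preserving_expectation tr3 (rel_commutant A0 A3) (rel_commutant A1 A3)"
  have "A1 \<subseteq> A3" using sub12 sub23 by blast
  then have G: "conditional_expectation (rel_commutant A0 A3) (rel_commutant A1 A3) ?G"
    by (rule s0.dual.commutant_expectation[OF s2.subalgebra_S1])
  have tG: "tr3 (?G x) = tr3 x" if "x \<in> rel_commutant A0 A3" for x
    by (simp only: s0.dual.average_trace[OF E23.index_expectation_axioms that])
  have F: "conditional_expectation (rel_commutant A0 A3) (rel_commutant A1 A3) ?F \<and>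
      (\<forall>x\<in>rel_commutant A0 A3. tr3 (?F x) = tr3 x)"
    unfolding trace_preserving_expectation_def
    by (rule someI[of _ ?G]) (use G tG in auto)
  show ?thesis
  proof (rule trace_preserving_expectation_eq[OF conjunct1[OF F] G, where tr = tr3])
    show "cstar_subalgebra (rel_commutant A0 A3)" by (rule E123.subalgebra_P)
    show "cstar_subalgebra (rel_commutant A1 A3)" by (rule E23.subalgebra_P)

    fix x assume x: "x \<in> rel_commutant A0 A3"
    show "tr3 (?F x) = tr3 x" using F x by blast
    show "tr3 (?G x) = tr3 x" by (rule tG[OF x])
    show "x = 0" if "tr3 (x\<^sup>\<star> * x) = 0"
    proof (rule E123.F_faithful[OF x])
      have "x\<^sup>\<star> * x \<in> E123.P" by (intro E123.P_intros x)
      then have "E1 (E2 (E3 (x\<^sup>\<star> * x))) = tr3 (x\<^sup>\<star> * x) *\<^sub>C 1" by (rule E123_scalar)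
      also have "\<dots> = 0" by (simp only: that scaleC_zero_left)
      finally show "E1 (E2 (E3 (x\<^sup>\<star> * x))) = 0" .
    qed
    show "tr3 (x - y) = tr3 x - tr3 y" if y: "y \<in> rel_commutant A0 A3" for y
    proof -
      have "E1 (E2 (E3 (x - y))) = (tr3 x - tr3 y) *\<^sub>C 1"
        unfolding scaleC_diff_left E123_scalar[OF x, symmetric] E123_scalar[OF y, symmetric]
        by (intro E123.F_diff E123.P_S x y)
      then show ?thesis by (simp only: E0_scalar scalar_value_scaleC)
    qed
  qed (rule x)
qed

text \<open>The expectation of \<open>w e\<^sub>3 e\<^sub>2\<close> onto \<open>A\<^sub>1' \<inter> A\<^sub>3\<close>, with the basis \<open>t\<^sup>-\<^sup>1\<^sup>/\<^sup>2 l\<^sub>i e\<^sub>1\<close> of \<open>E\<^sub>1\<close> inserted.\<close>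

definition G :: "'a \<Rightarrow> 'a" where "G w = s0.average (e1 * (w * (e3 * (e2 * e1))))"

lemma V_e3_e2_in: assumes w: "w \<in> V" shows "w * e3 * e2 \<in> rel_commutant A0 A3"
proof -
  have "w * e3 * e2 * b = b * (w * e3 * e2)" if b: "b \<in> A0" for b
    using V_comm[OF w b] e3_commute[OF sub01[OF b]] e2_commute[OF b] by (metis mult.assoc)
  moreover have "w * e3 * e2 \<in> A3" by (intro s2.S1_intros s2.e_in sub23 V_in w s1.e_in)
  ultimately show ?thesis by (simp add: rel_commutant_def)
qed

lemma trace_preserving_expectation_G:
  assumes w: "w \<in> V"
  shows "trace_preserving_expectation tr3 (rel_commutant A0 A3) (rel_commutant A1 A3) (w * e3 * e2) = G w"
  unfolding trace_preserving_expectation_eq_average[OF V_e3_e2_in[OF w]] using t_pos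
  by (simp add: G_def dual_basis_def star_simps s0.e_star mult.assoc scaleR_sum_right)

lemma w_comm:
  assumes w: "w \<in> V" and b: "b \<in> B"
  shows "b * (e1 * (w * (e3 * e2))) = e1 * (w * (e3 * e2)) * b"
  using V_comm[OF w subB0[OF b]] e3_commute[OF sub01[OF subB0[OF b]]] e2_commute[OF subB0[OF b]]
    e1_commute[OF b] by (metis mult.assoc)

text \<open>\<open>w\<close> is recovered from \<open>G w\<close> by multiplying \<open>G w e\<^sub>1 = e\<^sub>1 w e\<^sub>3 e\<^sub>2 e\<^sub>1\<close> by \<open>e\<^sub>2 e\<^sub>3\<close> from the right and
  applying \<open>E\<^sub>3\<close>, which yields \<open>e\<^sub>1 w\<close>.\<close>

lemma inj_on_G: "inj_on G V"
proof (rule inj_onI)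
  have recover: "e1 * w = (1 / (t * t * t)) *\<^sub>R E3 (G w * e1 * e2 * e3)" if w: "w \<in> V" for w
  proof -
    have "G w * e1 = e1 * (w * (e3 * e2)) * e1"
      using s0.average_e[of "e1 * (w * (e3 * e2))"] w_comm[OF w] by (simp add: G_def mult.assoc)
    then have "G w * e1 * e2 * e3 = e1 * w * e3 * (e2 * e1 * e2) * e3" by (simp only: mult.assoc)
    also have "\<dots> = t *\<^sub>R (e1 * w * (e3 * e2 * e3))"
      by (simp only: e2_e1_e2 mult_scaleR_left mult_scaleR_right) (simp only: mult.assoc)
    also have "\<dots> = (t * t) *\<^sub>R (e1 * w * e3)" by (simp add: e3_e2_e3)
    finally have eq: "G w * e1 * e2 * e3 = (t * t) *\<^sub>R (e1 * w) * e3" by simp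
    have "E3 (G w * e1 * e2 * e3) = t *\<^sub>R ((t * t) *\<^sub>R (e1 * w))"
      unfolding eq by (intro s2.F1_e A2_intros s0.e_in V_in w)
    then show ?thesis using t_pos by simp
  qed
  have "w = (\<Sum>i\<in>I. l i * (e1 * w) * (l i)\<^sup>\<star>)" if w: "w \<in> V" for w
  proof -
    have "w = (\<Sum>i\<in>I. l i * e1 * (l i)\<^sup>\<star>) * w" by (simp only: s0.resolution mult_1_left)
    also have "\<dots> = (\<Sum>i\<in>I. l i * (e1 * w) * (l i)\<^sup>\<star>)"
      unfolding sum_distrib_right
      by (intro sum.cong refl) (simp add: V_comm[OF w] s0.S_intros mult.assoc)
    finally show ?thesis .
  qed
  then show "w = w'" if "w \<in> V" "w' \<in> V" "G w = G w'" for w w'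
    using that recover by metis
qed

lemma G_\<Psi>: "y \<in> U \<Longrightarrow> G (\<Psi> y) = t *\<^sub>R s0.average (e1 * (e2 * (y * (e3 * (e2 * e1)))))"
proof -
  assume y: "y \<in> U"
  have "e1 * (\<Psi> y * (e3 * (e2 * e1))) = t *\<^sub>R (e1 * (e2 * (y * (e3 * (e2 * e1)))))"
    using e1_\<Psi>[OF y] by (simp flip: mult.assoc)
  then show ?thesis by (simp add: G_def scaleR_sum_right)
qed

text \<open>\<open>y \<mapsto> t\<^sup>-\<^sup>2 \<Sum>\<^sub>i l\<^sub>i e\<^sub>1 e\<^sub>2 y e\<^sub>3 e\<^sub>2 e\<^sub>1 l\<^sub>i\<^sup>*\<close> is the canonical shift of \<open>B' \<inter> A\<^sub>1\<close> onto \<open>A\<^sub>1' \<inter> A\<^sub>3\<close>; it is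
  multiplicative by the Temperley-Lieb relations.\<close>

lemma G_\<Psi>_mult:
  assumes y: "y \<in> U" and z: "z \<in> U"
  shows "G (\<Psi> z) * G (\<Psi> y) = (t * t * t) *\<^sub>R G (\<Psi> (z * y))"
proof -
  define p where "p = e1 * (e2 * (z * (e3 * e2)))"
  define q where "q = e2 * (y * (e3 * (e2 * e1)))"
  have p_comm: "b * p = p * b" if b: "b \<in> B" for b
  proof -
    have left: "u * (b * x) = b * (u * x)" if "u * b = b * u" for u x
      using that by (simp flip: mult.assoc)
    note comm = e3_commute[OF sub01[OF subB0[OF b]]] e2_commute[OF subB0[OF b]] e1_commute[OF b] U_comm[OF z b]
    show ?thesis by (simp only: p_def mult.assoc comm comm[THEN left])
  qed
  have "G (\<Psi> z) * G (\<Psi> y) = (t * t) *\<^sub>R (s0.average (p * e1) * s0.average (e1 * q))"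
    by (simp only: G_\<Psi>[OF y] G_\<Psi>[OF z] p_def q_def mult.assoc mult_scaleR_left mult_scaleR_right
        scaleR_scaleR)
  also have "s0.average (p * e1) * s0.average (e1 * q) = s0.average (p * e1 * q)"
    by (rule s0.average_mult_average[OF p_comm])
  also have "p * e1 * q = (t * t) *\<^sub>R (e1 * (e2 * (z * y * (e3 * (e2 * e1)))))"
  proof -
    have "p * e1 * q = e1 * e2 * z * e3 * (e2 * e1 * e2) * y * e3 * e2 * e1"
      by (simp only: p_def q_def mult.assoc)
    also have "\<dots> = t *\<^sub>R (e1 * e2 * z * e3 * e2 * (y * e3) * e2 * e1)"
      by (simp only: e2_e1_e2 mult_scaleR_left mult_scaleR_right) (simp only: mult.assoc)
    also have "y * e3 = e3 * y" by (rule e3_commute[OF U_in[OF y], symmetric])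
    also have "e1 * e2 * z * e3 * e2 * (e3 * y) * e2 * e1 = e1 * e2 * z * (e3 * e2 * e3) * y * e2 * e1"
      by (simp only: mult.assoc)
    also have "\<dots> = t *\<^sub>R (e1 * e2 * z * (e3 * y) * e2 * e1)"
      by (simp only: e3_e2_e3 mult_scaleR_left mult_scaleR_right) (simp only: mult.assoc)
    also have "e3 * y = y * e3" by (rule e3_commute[OF U_in[OF y]])
    finally show ?thesis by (simp add: mult.assoc)
  qed
  finally show ?thesis
    using G_\<Psi>[OF subalg_mult[OF subalgebra_U z y]] by (simp add: scaleR_sum_right mult.assoc)
qed

end


section \<open>Tensors determined by an inner product\<close>

locale finite_inner_product =
  fixes V :: "'a::unital_cstar_algebra set" and ip :: "'a \<Rightarrow> 'a \<Rightarrow> complex" and N :: nat and v :: "nat \<Rightarrow> 'a"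
  assumes V_add: "x \<in> V \<Longrightarrow> y \<in> V \<Longrightarrow> x + y \<in> V"
    and V_scale: "x \<in> V \<Longrightarrow> c *\<^sub>C x \<in> V"
    and V_zero: "0 \<in> V"
    and ip_scale: "x \<in> V \<Longrightarrow> z \<in> V \<Longrightarrow> ip z (c *\<^sub>C x) = c * ip z x"
    and ip_cnj: "x \<in> V \<Longrightarrow> y \<in> V \<Longrightarrow> cnj (ip x y) = ip y x"
    and v_in: "p < N \<Longrightarrow> v p \<in> V"
    and expand: "x \<in> V \<Longrightarrow> (\<Sum>p<N. ip (v p) x *\<^sub>C v p) = x"
begin

lemma ip_scale_left: "x \<in> V \<Longrightarrow> z \<in> V \<Longrightarrow> ip (c *\<^sub>C x) z = cnj c * ip x z"
  using ip_cnj[of z "c *\<^sub>C x"] ip_scale[of x z c] ip_cnj[of z x] by (simp add: V_scale)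

lemma bilinear_expand:
  assumes \<beta>: "bilinear_form_on V \<beta>" and x: "x \<in> V" and y: "y \<in> V"
  shows "\<beta> x y = (\<Sum>p<N. \<Sum>q<N. ip (v p) x * ip (v q) y * \<beta> (v p) (v q))"
proof -
  have add: "\<beta> (a + b) z = \<beta> a z + \<beta> b z" "\<beta> z (a + b) = \<beta> z a + \<beta> z b"
    if "a \<in> V" "b \<in> V" "z \<in> V" for a b z
    using \<beta> that by (auto simp: bilinear_form_on_def)
  have sc: "\<beta> (c *\<^sub>C a) z = c * \<beta> a z" "\<beta> z (c *\<^sub>C a) = c * \<beta> z a"
    if "a \<in> V" "z \<in> V" for a z c
    using \<beta> that by (auto simp: bilinear_form_on_def)
  have z0: "\<beta> 0 z = 0" "\<beta> z 0 = 0" if "z \<in> V" for z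
    using sc[OF V_zero that, of 0] by simp_all
  have V_sum: "(\<Sum>p<k. c p *\<^sub>C v p) \<in> V" if "k \<le> N" for k c
    using that by (induction k) (auto simp: V_zero intro!: V_add V_scale v_in)
  have left: "\<beta> (\<Sum>p<k. c p *\<^sub>C v p) z = (\<Sum>p<k. c p * \<beta> (v p) z)" if "k \<le> N" "z \<in> V" for k c z
    using that by (induction k) (simp_all add: z0 add sc V_sum V_scale v_in)
  have right: "\<beta> z (\<Sum>p<k. c p *\<^sub>C v p) = (\<Sum>p<k. c p * \<beta> z (v p))" if "k \<le> N" "z \<in> V" for k c z
    using that by (induction k) (simp_all add: z0 add sc V_sum V_scale v_in)
  have "\<beta> x y = (\<Sum>p<N. ip (v p) x * \<beta> (v p) y)"
    using left[OF order.refl y, of "\<lambda>p. ip (v p) x"] by (simp only: expand[OF x])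
  also have "\<dots> = (\<Sum>p<N. ip (v p) x * (\<Sum>q<N. ip (v q) y * \<beta> (v p) (v q)))"
  proof (intro sum.cong refl arg_cong2[of _ _ _ _ "(*)"])
    fix p assume "p \<in> {..<N}"
    then have "v p \<in> V" by (simp add: v_in)
    from right[OF order.refl this, of "\<lambda>q. ip (v q) y"]
    show "\<beta> (v p) y = (\<Sum>q<N. ip (v q) y * \<beta> (v p) (v q))" by (simp only: expand[OF y])
  qed
  also have "\<dots> = (\<Sum>p<N. \<Sum>q<N. ip (v p) x * ip (v q) y * \<beta> (v p) (v q))"
    by (simp add: sum_distrib_left mult.assoc)
  finally show ?thesis .
qed

lemma sum_list_tensor:
  "(\<Sum>(a, b)\<leftarrow>xs. f a b) = (\<Sum>i<length xs. f (fst (xs ! i)) (snd (xs ! i)))"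
  by (simp add: sum_list_sum_nth atLeast0LessThan case_prod_beta)

text \<open>The form is conjugate linear in its first argument, hence the conjugated coefficients in the representing tensor.\<close>

lemma tensor_exists:
  assumes \<beta>: "bilinear_form_on V \<beta>"
  shows "\<exists>xs. set xs \<subseteq> V \<times> V \<and>
    (\<forall>x\<in>V. \<forall>y\<in>V. (\<Sum>(a, b)\<leftarrow>xs. ip a x * ip b y) = \<beta> x y)"
proof -
  define xs where "xs = map (\<lambda>(p, q). (cnj (\<beta> (v p) (v q)) *\<^sub>C v p, v q)) (List.product [0..<N] [0..<N])"
  have "(\<Sum>(a, b)\<leftarrow>xs. ip a x * ip b y) = \<beta> x y" if x: "x \<in> V" and y: "y \<in> V" for x y
  proof -
    have "(\<Sum>(a, b)\<leftarrow>xs. ip a x * ip b y) =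
        (\<Sum>(p, q)\<leftarrow>List.product [0..<N] [0..<N]. ip (cnj (\<beta> (v p) (v q)) *\<^sub>C v p) x * ip (v q) y)"
      by (simp add: xs_def o_def case_prod_unfold)
    also have "\<dots> = (\<Sum>(p, q)\<in>{..<N} \<times> {..<N}. ip (cnj (\<beta> (v p) (v q)) *\<^sub>C v p) x * ip (v q) y)"
      by (subst sum_list_distinct_conv_sum_set) (auto simp: distinct_product atLeast0LessThan)
    also have "\<dots> = (\<Sum>p<N. \<Sum>q<N. ip (v p) x * ip (v q) y * \<beta> (v p) (v q))"
      unfolding sum.cartesian_product
      by (intro sum.cong refl) (auto simp: ip_scale_left v_in x)
    also have "\<dots> = \<beta> x y" by (rule bilinear_expand[OF \<beta> x y, symmetric])
    finally show ?thesis .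
  qed
  moreover have "set xs \<subseteq> V \<times> V" by (auto simp: xs_def V_scale v_in)
  ultimately show ?thesis by blast
qed

lemma tensor_unique:
  assumes xs: "set xs \<subseteq> V \<times> V" and ys: "set ys \<subseteq> V \<times> V"
    and eq: "\<And>x y. x \<in> V \<Longrightarrow> y \<in> V \<Longrightarrow>
      (\<Sum>(a, b)\<leftarrow>xs. ip a x * ip b y) = (\<Sum>(a, b)\<leftarrow>ys. ip a x * ip b y)"
  shows "tensor_sum V xs = tensor_sum V ys"
proof
  fix \<beta>
  have expansion: "(\<Sum>(a, b)\<leftarrow>zs. \<beta> a b) =
      (\<Sum>p<N. \<Sum>q<N. cnj (\<Sum>(a, b)\<leftarrow>zs. ip a (v p) * ip b (v q)) * \<beta> (v p) (v q))"
    if \<beta>: "bilinear_form_on V \<beta>" and zs: "set zs \<subseteq> V \<times> V" for zs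
  proof -
    have z: "fst (zs ! i) \<in> V" "snd (zs ! i) \<in> V" if "i < length zs" for i
      using zs nth_mem[OF that] by auto
    have "(\<Sum>(a, b)\<leftarrow>zs. \<beta> a b) = (\<Sum>i<length zs. \<Sum>p<N. \<Sum>q<N.
        ip (v p) (fst (zs ! i)) * ip (v q) (snd (zs ! i)) * \<beta> (v p) (v q))"
      unfolding sum_list_tensor by (intro sum.cong refl bilinear_expand \<beta> z) simp_all
    also have "\<dots> = (\<Sum>p<N. \<Sum>i<length zs. \<Sum>q<N.
        ip (v p) (fst (zs ! i)) * ip (v q) (snd (zs ! i)) * \<beta> (v p) (v q))"
      by (rule sum.swap)
    also have "\<dots> = (\<Sum>p<N. \<Sum>q<N. \<Sum>i<length zs.
        ip (v p) (fst (zs ! i)) * ip (v q) (snd (zs ! i)) * \<beta> (v p) (v q))"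
      by (intro sum.cong[OF refl]) (rule sum.swap)
    also have "\<dots> = (\<Sum>p<N. \<Sum>q<N. cnj (\<Sum>(a, b)\<leftarrow>zs. ip a (v p) * ip b (v q)) * \<beta> (v p) (v q))"
      unfolding sum_list_tensor cnj_sum sum_distrib_right
      by (intro sum.cong refl) (simp add: ip_cnj z v_in)
    finally show ?thesis .
  qed
  show "tensor_sum V xs \<beta> = tensor_sum V ys \<beta>"
  proof (cases "bilinear_form_on V \<beta>")
    case True
    then show ?thesis
      unfolding tensor_sum_def
      by (simp only: if_True expansion[OF True xs] expansion[OF True ys])
        (intro sum.cong refl, simp add: eq v_in)
  qed (simp add: tensor_sum_def)
qed

lemma tensor_sum_scale:
  assumes "set xs \<subseteq> V \<times> V"
  shows "tensor_sum V (map (\<lambda>(a, b). (c *\<^sub>C a, b)) xs) = tensor_scale c (tensor_sum V xs)"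
proof
  fix \<beta>
  have "(\<Sum>(a, b)\<leftarrow>map (\<lambda>(a, b). (c *\<^sub>C a, b)) xs. \<beta> a b) = c * (\<Sum>(a, b)\<leftarrow>xs. \<beta> a b)"
    if "bilinear_form_on V \<beta>"
    using assms that by (induction xs) (auto simp: bilinear_form_on_def algebra_simps)
  then show "tensor_sum V (map (\<lambda>(a, b). (c *\<^sub>C a, b)) xs) \<beta> = tensor_scale c (tensor_sum V xs) \<beta>"
    by (simp add: tensor_sum_def tensor_scale_def)
qed

end


section \<open>Convolution and the dual of the product\<close>

context three_steps
begin

abbreviation ip :: "'a \<Rightarrow> 'a \<Rightarrow> complex" where "ip x y \<equiv> scalar_value (E0 (E1 (E2 (x\<^sup>\<star> * y))))"

lemma ip_eq: assumes "x \<in> V" "y \<in> V" shows "E1 (E2 (x\<^sup>\<star> * y)) = ip x y *\<^sub>C 1"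
proof -
  have "x\<^sup>\<star> * y \<in> V" by (intro E12.P_intros assms)
  then obtain k where "E1 (E2 (x\<^sup>\<star> * y)) = k *\<^sub>C 1" using E12.F_scalar by blast
  then show ?thesis by (simp only: E0_scalar scalar_value_scaleC)
qed

lemma ipI: "E1 (E2 (x\<^sup>\<star> * y)) = k *\<^sub>C 1 \<Longrightarrow> ip x y = k"
  by (simp add: E0_scalar)

lemma finite_inner_product_ip: "\<exists>N v. finite_inner_product V ip N v"
proof -
  obtain N v where on: "E12.orthonormal N v"
    and bas: "\<And>x. x \<in> V \<Longrightarrow> (\<Sum>a<N. v a * E1 (E2 ((v a)\<^sup>\<star> * x))) = x"
    using E12.orthonormal_basis by blast
  have v: "v a \<in> V" if "a < N" for a using on that by (simp add: E12.orthonormal_def)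
  have "finite_inner_product V ip N v"
  proof
    show "x + y \<in> V" if "x \<in> V" "y \<in> V" for x y using that by (intro E12.P_intros)
    show "c *\<^sub>C x \<in> V" if "x \<in> V" for x c using that by (intro E12.P_intros)
    show "0 \<in> V" by (intro E12.P_intros)
    show "v p \<in> V" if "p < N" for p by (rule v[OF that])
    fix x assume x: "x \<in> V"
    show "(\<Sum>p<N. ip (v p) x *\<^sub>C v p) = x"
    proof -
      have "(\<Sum>p<N. ip (v p) x *\<^sub>C v p) = (\<Sum>a<N. v a * E1 (E2 ((v a)\<^sup>\<star> * x)))"
      proof (intro sum.cong refl)
        fix p assume "p \<in> {..<N}"
        then have "E1 (E2 ((v p)\<^sup>\<star> * x)) = ip (v p) x *\<^sub>C 1" using v x by (intro ip_eq) auto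
        then have "v p * E1 (E2 ((v p)\<^sup>\<star> * x)) = v p * (ip (v p) x *\<^sub>C 1)" by (rule arg_cong)
        then show "ip (v p) x *\<^sub>C v p = v p * E1 (E2 ((v p)\<^sup>\<star> * x))" by (simp only: scaleC_mult_right mult_1_right)
      qed
      then show ?thesis by (simp only: bas[OF x])
    qed
    fix z assume z: "z \<in> V"
    show "ip z (c *\<^sub>C x) = c * ip z x" for c
    proof (rule ipI)
      have "E1 (E2 (z\<^sup>\<star> * c *\<^sub>C x)) = c *\<^sub>C E1 (E2 (z\<^sup>\<star> * x))"
        unfolding scaleC_mult_right by (intro E12.F_scaleC E12.P_S E12.P_intros x z)
      also have "\<dots> = c *\<^sub>C ip z x *\<^sub>C 1" by (rule arg_cong[OF ip_eq[OF z x]])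
      finally show "E1 (E2 (z\<^sup>\<star> * c *\<^sub>C x)) = (c * ip z x) *\<^sub>C 1" by (simp only: scaleC_scaleC)
    qed
    have "E1 (E2 (z\<^sup>\<star> * x)) = (E1 (E2 (x\<^sup>\<star> * z)))\<^sup>\<star>"
      using E12.F_star[of "x\<^sup>\<star> * z"] E12.P_S[OF x] E12.P_S[OF z] by (simp add: star_simps E12.S_intros)
    also have "\<dots> = (ip x z *\<^sub>C 1)\<^sup>\<star>" by (rule arg_cong[OF ip_eq[OF x z]])
    finally have "ip z x = cnj (ip x z)" by (intro ipI) (simp only: star_scaleC star_one)
    then show "cnj (ip x z) = ip z x" by (rule sym)
  qed
  then show ?thesis by blast
qed

definition fourier :: "'a \<Rightarrow> 'a" where
  "fourier w = (t powr (- 3 / 2)) *\<^sub>R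
    trace_preserving_expectation tr3 (rel_commutant A0 A3) (rel_commutant A1 A3) (w * e3 * e2)"

definition conv :: "'a \<Rightarrow> 'a \<Rightarrow> 'a" where
  "conv w' w'' = inv_into V fourier (fourier w'' * fourier w')"

lemma fourier_G: "w \<in> V \<Longrightarrow> fourier w = (t powr (- 3 / 2)) *\<^sub>R G w"
  by (simp only: fourier_def trace_preserving_expectation_G)

lemma conv_\<Psi>:
  assumes y: "y \<in> U" and z: "z \<in> U"
  shows "conv (\<Psi> y) (\<Psi> z) = (t powr (3 / 2)) *\<^sub>R \<Psi> (z * y)"
proof -
  have zy: "z * y \<in> U" by (rule subalg_mult[OF subalgebra_U z y])
  have w: "(t powr (3 / 2)) *\<^sub>R \<Psi> (z * y) \<in> V" by (intro E12.P_intros \<Psi>_in zy)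
  have inj: "inj_on fourier V"
    using inj_on_G t_pos by (auto simp: inj_on_def fourier_G)
  have p3: "t powr (- 3 / 2) * t powr (- 3 / 2) * (t * t * t) = 1"
  proof -
    have t3: "t * t * t = t powr 3" using t_pos powr_realpow[of t 3] by (simp add: power3_eq_cube)
    show ?thesis unfolding t3 powr_add[symmetric] using t_pos by simp
  qed
  have p0: "t powr (- 3 / 2) * t powr (3 / 2) = 1" using t_pos by (simp flip: powr_add)
  have "fourier (\<Psi> z) * fourier (\<Psi> y) = (t powr (- 3 / 2) * t powr (- 3 / 2)) *\<^sub>R (G (\<Psi> z) * G (\<Psi> y))"
    by (simp add: fourier_G \<Psi>_in y z)
  also have "\<dots> = (t powr (- 3 / 2) * t powr (- 3 / 2) * (t * t * t)) *\<^sub>R G (\<Psi> (z * y))"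
    unfolding G_\<Psi>_mult[OF y z] scaleR_scaleR ..
  also have "\<dots> = (t powr (- 3 / 2) * t powr (3 / 2)) *\<^sub>R G (\<Psi> (z * y))" by (simp only: p3 p0)
  also have "\<dots> = fourier ((t powr (3 / 2)) *\<^sub>R \<Psi> (z * y))"
    by (simp add: fourier_G[OF w] G_def scaleR_sum_right)
  finally show ?thesis unfolding conv_def by (simp only: inv_into_f_f[OF inj w])
qed

definition pairing :: "real \<Rightarrow> 'a \<Rightarrow> 'a \<Rightarrow> complex" where
  "pairing d x w = complex_of_real (d * t powr (- 2)) * scalar_value (E0 (E1 (E2 (x * e2 * e1 * w))))"

lemma pairing_\<Psi>: "y \<in> U \<Longrightarrow> a \<in> V \<Longrightarrow> pairing d (y\<^sup>\<star>) a = complex_of_real (d / t\<^sup>2) * ip (\<Psi> y) a"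
  unfolding pairing_def
  using t_pos by (simp only: trace_\<Psi>) (simp add: powr_minus powr_numeral divide_inverse)

text \<open>Both conditions are evaluated at \<open>x\<^sub>1 = y\<^sup>*\<close>, \<open>x\<^sub>2 = z\<^sup>*\<close>, \<open>w' = \<Psi>(y)\<close>, \<open>w'' = \<Psi>(z)\<close>, where they become complex
  conjugates of each other up to a nonzero factor.\<close>

lemma pairing_condition_iff:
  assumes d: "0 < d" and w: "w \<in> V" and xs: "set xs \<subseteq> V \<times> V"
  shows "(\<forall>x1\<in>U. \<forall>x2\<in>U. pairing d (x1 * x2) w = (\<Sum>(a, b)\<leftarrow>xs. pairing d x1 a * pairing d x2 b)) \<longleftrightarrow>
    (\<forall>w'\<in>V. \<forall>w''\<in>V.
      (\<Sum>(a, b)\<leftarrow>map (\<lambda>(a, b). (complex_of_real d *\<^sub>C a, b)) xs. ip a w' * ip b w'') =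
      complex_of_real (sqrt t) * ip w (conv w' w''))"
proof -
  obtain N v where "finite_inner_product V ip N v" using finite_inner_product_ip by blast
  then interpret ip: finite_inner_product V ip N v .
  define c where "c = complex_of_real (d / t\<^sup>2)"
  have c0: "c \<noteq> 0" using d t_pos by (simp add: c_def)
  have single: "pairing d (y\<^sup>\<star> * z\<^sup>\<star>) w = (\<Sum>(a, b)\<leftarrow>xs. pairing d (y\<^sup>\<star>) a * pairing d (z\<^sup>\<star>) b) \<longleftrightarrow>
      (\<Sum>(a, b)\<leftarrow>map (\<lambda>(a, b). (complex_of_real d *\<^sub>C a, b)) xs. ip a (\<Psi> y) * ip b (\<Psi> z)) =
      complex_of_real (sqrt t) * ip w (conv (\<Psi> y) (\<Psi> z))"
    if y: "y \<in> U" and z: "z \<in> U" for y z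
  proof -
    note yV = \<Psi>_in[OF y] and zV = \<Psi>_in[OF z]
    have zy: "z * y \<in> U" by (rule subalg_mult[OF subalgebra_U z y])
    note zyV = \<Psi>_in[OF zy]
    define s where "s = (\<Sum>(a, b)\<leftarrow>xs. ip a (\<Psi> y) * ip b (\<Psi> z))"
    have pc: "pairing d (y\<^sup>\<star>) a = c * ip (\<Psi> y) a" "pairing d (z\<^sup>\<star>) a = c * ip (\<Psi> z) a" if "a \<in> V" for a
      unfolding c_def by (rule pairing_\<Psi>[OF y that], rule pairing_\<Psi>[OF z that])
    have "(\<Sum>(a, b)\<leftarrow>xs. pairing d (y\<^sup>\<star>) a * pairing d (z\<^sup>\<star>) b) = c * c * cnj s"
      unfolding s_def using xs
      by (induction xs) (auto simp: pc ip.ip_cnj yV zV distrib_left mult_ac)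
    moreover have "pairing d (y\<^sup>\<star> * z\<^sup>\<star>) w = c * cnj (ip w (\<Psi> (z * y)))"
      using pairing_\<Psi>[OF zy w, of d] by (simp only: star_mult c_def ip.ip_cnj[OF w zyV])
    moreover have "(\<Sum>(a, b)\<leftarrow>map (\<lambda>(a, b). (complex_of_real d *\<^sub>C a, b)) xs. ip a (\<Psi> y) * ip b (\<Psi> z)) =
        complex_of_real d * s"
      unfolding s_def using xs
      by (induction xs) (auto simp: ip.ip_scale_left yV distrib_left mult_ac)
    moreover have "complex_of_real (sqrt t) * ip w (conv (\<Psi> y) (\<Psi> z)) =
        complex_of_real (t\<^sup>2) * ip w (\<Psi> (z * y))"
    proof -
      have "ip w (conv (\<Psi> y) (\<Psi> z)) = complex_of_real (t powr (3 / 2)) * ip w (\<Psi> (z * y))"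
        by (simp only: conv_\<Psi>[OF y z] scaleC_of_real[symmetric] ip.ip_scale[OF zyV w])
      moreover have "sqrt t * t powr (3 / 2) = t\<^sup>2"
        using t_pos by (simp add: powr_half_sqrt[symmetric] powr_add[symmetric] powr_numeral)
      ultimately show ?thesis by (simp only: mult.assoc[symmetric] of_real_mult[symmetric])
    qed
    moreover have "c * cnj (ip w (\<Psi> (z * y))) = c * c * cnj s \<longleftrightarrow>
        complex_of_real d * s = complex_of_real (t\<^sup>2) * ip w (\<Psi> (z * y))"
    proof -
      have "c * cnj (ip w (\<Psi> (z * y))) = c * c * cnj s \<longleftrightarrow> cnj (ip w (\<Psi> (z * y))) = c * cnj s"
        using c0 by simp
      also have "\<dots> \<longleftrightarrow> ip w (\<Psi> (z * y)) = c * s"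
        by (metis c_def complex_cnj_cnj complex_cnj_complex_of_real complex_cnj_mult)
      also have "\<dots> \<longleftrightarrow> complex_of_real (t\<^sup>2) * ip w (\<Psi> (z * y)) = complex_of_real (t\<^sup>2) * (c * s)"
        using t_pos by simp
      also have "complex_of_real (t\<^sup>2) * (c * s) = complex_of_real d * s"
        using t_pos by (simp add: c_def)
      finally show ?thesis by (simp only: eq_commute)
    qed
    ultimately show ?thesis by (simp only:)
  qed
  have Us: "x\<^sup>\<star> \<in> U" if "x \<in> U" for x using that by (rule subalg_star[OF subalgebra_U])
  show ?thesis (is "?N \<longleftrightarrow> ?C")
  proof
    assume ?N
    show ?C
    proof (intro ballI)
      fix w' w'' assume w': "w' \<in> V" and w'': "w'' \<in> V"
      from single[OF \<Phi>_in[OF w'] \<Phi>_in[OF w'']] \<open>?N\<close> Us[OF \<Phi>_in[OF w']] Us[OF \<Phi>_in[OF w'']]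
      show "(\<Sum>(a, b)\<leftarrow>map (\<lambda>(a, b). (complex_of_real d *\<^sub>C a, b)) xs. ip a w' * ip b w'') =
          complex_of_real (sqrt t) * ip w (conv w' w'')"
        unfolding \<Psi>_\<Phi>[OF w'] \<Psi>_\<Phi>[OF w''] by blast
    qed
  next
    assume ?C
    show ?N
    proof (intro ballI)
      fix x1 x2 assume x1: "x1 \<in> U" and x2: "x2 \<in> U"
      from single[OF Us[OF x1] Us[OF x2]] \<open>?C\<close> \<Psi>_in[OF Us[OF x1]] \<Psi>_in[OF Us[OF x2]]
      show "pairing d (x1 * x2) w = (\<Sum>(a, b)\<leftarrow>xs. pairing d x1 a * pairing d x2 b)"
        unfolding star_star by blast
    qed
  qed
qed

lemma \<Psi>_add: "\<Psi> (y + z) = \<Psi> y + \<Psi> z"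
  by (simp add: \<Psi>_def algebra_simps sum.distrib)

lemma \<Psi>_scaleC: "\<Psi> (c *\<^sub>C y) = c *\<^sub>C \<Psi> y"
  by (simp add: \<Psi>_def scaleC_mult_left scaleC_mult_right scaleC_sum_right[symmetric] scaleC_scaleC mult.commute
      flip: scaleC_of_real)

lemma \<Phi>_add: "w \<in> V \<Longrightarrow> w' \<in> V \<Longrightarrow> \<Phi> (w + w') = \<Phi> w + \<Phi> w'"
  using s1.dual.F_add[of "e2 * (e1 * w)" "e2 * (e1 * w')"]
  by (simp add: \<Phi>_def algebra_simps A2_intros s0.e_in V_in)

lemma \<Phi>_scaleC: "w \<in> V \<Longrightarrow> \<Phi> (c *\<^sub>C w) = c *\<^sub>C \<Phi> w"
  using s1.dual.F_scaleC[of "e2 * (e1 * w)" c]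
  by (simp add: \<Phi>_def scaleC_mult_left scaleC_mult_right A2_intros s0.e_in V_in scaleC_scaleC mult.commute
      flip: scaleC_of_real)

lemma bilinear_conv:
  assumes w: "w \<in> V"
  shows "bilinear_form_on V (\<lambda>w' w''. complex_of_real (sqrt t) * ip w (conv w' w''))"
proof -
  obtain N v where "finite_inner_product V ip N v" using finite_inner_product_ip by blast
  then interpret ip: finite_inner_product V ip N v .
  have conv: "conv a b = (t powr (3 / 2)) *\<^sub>R \<Psi> (\<Phi> b * \<Phi> a)" if "a \<in> V" "b \<in> V" for a b
    using conv_\<Psi>[OF \<Phi>_in[OF that(1)] \<Phi>_in[OF that(2)]] by (simp only: \<Psi>_\<Phi> that)
  have conv_in: "conv a b \<in> V" if "a \<in> V" "b \<in> V" for a b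
    unfolding conv[OF that] by (intro E12.P_intros \<Psi>_in subalg_mult[OF subalgebra_U] \<Phi>_in that)
  have add: "ip w (a + b) = ip w a + ip w b" if "a \<in> V" "b \<in> V" for a b
  proof (rule ipI)
    have "E1 (E2 (w\<^sup>\<star> * (a + b))) = E1 (E2 (w\<^sup>\<star> * a)) + E1 (E2 (w\<^sup>\<star> * b))"
      unfolding distrib_left by (intro E12.F_add E12.P_S E12.P_intros w that)
    also have "\<dots> = ip w a *\<^sub>C 1 + ip w b *\<^sub>C 1"
      by (rule arg_cong2[OF ip_eq[OF w that(1)] ip_eq[OF w that(2)]])
    finally show "E1 (E2 (w\<^sup>\<star> * (a + b))) = (ip w a + ip w b) *\<^sub>C 1" by (simp only: scaleC_add_left)
  qed
  have VI: "a + b \<in> V" "c *\<^sub>C a \<in> V" if "a \<in> V" "b \<in> V" for a b c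
    using that by (simp_all add: ip.V_add ip.V_scale)
  have c1: "conv (a + b) z = conv a z + conv b z" "conv z (a + b) = conv z a + conv z b"
    if "a \<in> V" "b \<in> V" "z \<in> V" for a b z
    using that by (simp_all add: conv VI \<Phi>_add \<Psi>_add distrib_left distrib_right scaleR_add_right)
  have c2: "conv (c *\<^sub>C a) z = c *\<^sub>C conv a z" "conv z (c *\<^sub>C a) = c *\<^sub>C conv z a"
    if "a \<in> V" "z \<in> V" for a z c
    using that
    by (simp_all add: conv ip.V_scale \<Phi>_scaleC \<Psi>_scaleC scaleC_mult_left scaleC_mult_right scaleC_scaleC
        mult.commute flip: scaleC_of_real)
  show ?thesis
    unfolding bilinear_form_on_def
  proof (intro conjI ballI allI)
    fix a b z assume V: "a \<in> V" "b \<in> V" "z \<in> V"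
    show "complex_of_real (sqrt t) * ip w (conv (a + b) z) =
        complex_of_real (sqrt t) * ip w (conv a z) + complex_of_real (sqrt t) * ip w (conv b z)"
      unfolding c1[OF V] add[OF conv_in[OF V(1,3)] conv_in[OF V(2,3)]] by (rule distrib_left)
    show "complex_of_real (sqrt t) * ip w (conv z (a + b)) =
        complex_of_real (sqrt t) * ip w (conv z a) + complex_of_real (sqrt t) * ip w (conv z b)"
      unfolding c1[OF V] add[OF conv_in[OF V(3,1)] conv_in[OF V(3,2)]] by (rule distrib_left)
  next
    fix c a z assume V: "a \<in> V" "z \<in> V"
    show "complex_of_real (sqrt t) * ip w (conv (c *\<^sub>C a) z) = c * (complex_of_real (sqrt t) * ip w (conv a z))"
      unfolding c2[OF V] ip.ip_scale[OF conv_in[OF V] w] by (rule mult.left_commute)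
    show "complex_of_real (sqrt t) * ip w (conv a (c *\<^sub>C z)) = c * (complex_of_real (sqrt t) * ip w (conv a z))"
      unfolding c2[OF V(2,1)] ip.ip_scale[OF conv_in[OF V] w] by (rule mult.left_commute)
  qed
qed

text \<open>A tensor represents the bilinear form \<open>w', w'' \<mapsto> t\<^sup>1\<^sup>/\<^sup>2 \<langle>w, w' \<star>\<^sub>1 w''\<rangle>\<close> iff its \<open>1 / d\<close>-fold satisfies the
  condition of the pairing.  So existence and uniqueness for the former carry over to the latter.\<close>

lemma comult_scale:
  assumes d: "0 < d" and w: "w \<in> V"
  shows "(THE T. \<exists>xs. set xs \<subseteq> V \<times> V \<and> T = tensor_sum V xs \<and>
      (\<forall>w'\<in>V. \<forall>w''\<in>V. (\<Sum>(a, b)\<leftarrow>xs. ip a w' * ip b w'') =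
        complex_of_real (sqrt t) * ip w (conv w' w''))) =
    tensor_scale (complex_of_real d) (THE T. \<exists>xs. set xs \<subseteq> V \<times> V \<and> T = tensor_sum V xs \<and>
      (\<forall>x1\<in>U. \<forall>x2\<in>U. pairing d (x1 * x2) w = (\<Sum>(a, b)\<leftarrow>xs. pairing d x1 a * pairing d x2 b)))"
    (is "(THE T. ?C T) = tensor_scale _ (THE T. ?N T)")
proof -
  obtain N v where "finite_inner_product V ip N v" using finite_inner_product_ip by blast
  then interpret ip: finite_inner_product V ip N v .
  let ?c = "complex_of_real d"
  define sc where "sc k = map (\<lambda>(a :: 'a, b :: 'a). (k *\<^sub>C a, b))" for k
  define condC where "condC xs \<longleftrightarrow> (\<forall>w'\<in>V. \<forall>w''\<in>V. (\<Sum>(a, b)\<leftarrow>xs. ip a w' * ip b w'') =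
      complex_of_real (sqrt t) * ip w (conv w' w''))" for xs
  define condN where "condN xs \<longleftrightarrow> (\<forall>x1\<in>U. \<forall>x2\<in>U. pairing d (x1 * x2) w =
      (\<Sum>(a, b)\<leftarrow>xs. pairing d x1 a * pairing d x2 b))" for xs
  have sc_in: "set (sc k xs) \<subseteq> V \<times> V" if "set xs \<subseteq> V \<times> V" for k xs
    using that by (auto simp: sc_def ip.V_scale)
  have iff: "condN xs \<longleftrightarrow> condC (sc ?c xs)" if "set xs \<subseteq> V \<times> V" for xs
    unfolding condN_def condC_def sc_def by (rule pairing_condition_iff[OF d w that])
  have uniqC: "tensor_sum V xs = tensor_sum V ys"
    if "set xs \<subseteq> V \<times> V" "condC xs" "set ys \<subseteq> V \<times> V" "condC ys" for xs ys
    by (rule ip.tensor_unique[OF that(1,3)]) (simp only: that(2,4)[unfolded condC_def, rule_format])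
  obtain ys where ys: "set ys \<subseteq> V \<times> V" "condC ys"
    using ip.tensor_exists[OF bilinear_conv[OF w]] unfolding condC_def by blast
  define xs where "xs = sc (1 / ?c) ys"
  have xs: "set xs \<subseteq> V \<times> V" unfolding xs_def by (rule sc_in[OF ys(1)])
  have "sc ?c xs = ys" using d by (simp add: xs_def sc_def o_def case_prod_beta scaleC_scaleC)
  then have "condN xs" using iff[OF xs] ys by simp
  have scale: "tensor_sum V (sc ?c zs) = tensor_scale ?c (tensor_sum V zs)" if "set zs \<subseteq> V \<times> V" for zs
    unfolding sc_def by (rule ip.tensor_sum_scale[OF that])
  have uniqN: "tensor_sum V zs = tensor_sum V xs" if zs: "set zs \<subseteq> V \<times> V" "condN zs" for zs
  proof -
    have "tensor_sum V (sc ?c zs) = tensor_sum V (sc ?c xs)"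
      using zs xs \<open>condN xs\<close> iff by (intro uniqC sc_in) auto
    then have "tensor_scale ?c (tensor_sum V zs) = tensor_scale ?c (tensor_sum V xs)"
      by (simp only: scale[OF zs(1)] scale[OF xs])
    then show ?thesis using d by (auto simp: tensor_scale_def fun_eq_iff)
  qed
  have "(THE T. ?C T) = tensor_sum V ys"
    unfolding condC_def[symmetric]
  proof (rule the_equality)
    show "\<exists>xs. set xs \<subseteq> V \<times> V \<and> tensor_sum V ys = tensor_sum V xs \<and> condC xs" using ys by blast
    fix T assume "\<exists>xs. set xs \<subseteq> V \<times> V \<and> T = tensor_sum V xs \<and> condC xs"
    then show "T = tensor_sum V ys" using uniqC[OF _ _ ys] by blast
  qed
  also have "\<dots> = tensor_scale ?c (tensor_sum V xs)" using scale[OF xs] \<open>sc ?c xs = ys\<close> by simp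
  also have "tensor_sum V xs = (THE T. ?N T)"
    unfolding condN_def[symmetric]
  proof (rule the_equality[symmetric])
    show "\<exists>zs. set zs \<subseteq> V \<times> V \<and> tensor_sum V xs = tensor_sum V zs \<and> condN zs"
      using xs \<open>condN xs\<close> by blast
    fix T assume "\<exists>zs. set zs \<subseteq> V \<times> V \<and> T = tensor_sum V zs \<and> condN zs"
    then show "T = tensor_sum V xs" using uniqN by blast
  qed
  finally show ?thesis .
qed

end


section \<open>The comultiplications\<close>

lemma (in jones_tower) three_steps:
  assumes qb: "quasi_basis (A 0) (E 0) n l"
  shows "three_steps B (A 0) (A 1) (A 2) (A 3) (E 0) (E 1) (E 2) (E 3) (e 1) (e 2) (e 3) {..<n} l
    (tau (A 0) (E 0))"
proof -
  let ?t = "tau (A 0) (E 0)"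
  have centre: "\<exists>k. c = k *\<^sub>C 1" if "c \<in> A 0" "\<And>b. b \<in> A 0 \<Longrightarrow> c * b = b * c" for c
    by (rule simple_central_scalar[OF simple_A that(1)]) (simp add: that(2))
  interpret b0: balanced_expectation "A 0" B "E 0" "{..<n}" l ?t
    by (rule minimal_expectation_balanced[OF simple_B simple_A minimal qb])
  interpret s0: jones_step "A 0" B "E 0" "{..<n}" l ?t "A 1" "e 1" "E 1"
    using basic[of 0] dual[of 0] centre by unfold_locales simp_all
  interpret s1: jones_step "A 1" "A 0" "E 1" "{..<n}" "dual_basis l ?t (e 1)" ?t "A 2" "e 2" "E 2"
    using basic[of 1] dual[of 1] s0.centre_S1 by unfold_locales (simp_all add: numeral_2_eq_2)
  interpret s2: jones_step "A 2" "A 1" "E 2" "{..<n}" "dual_basis (dual_basis l ?t (e 1)) ?t (e 2)" ?t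
      "A 3" "e 3" "E 3"
    using basic[of 2] dual[of 2] s1.centre_S1 by unfold_locales (simp_all add: numeral_3_eq_3 numeral_2_eq_2)
  show ?thesis by unfold_locales
qed

theorem theorem3p9:
  fixes B :: "'a::unital_cstar_algebra set" and A :: "nat \<Rightarrow> 'a set"
    and e :: "nat \<Rightarrow> 'a" and E :: "nat \<Rightarrow> 'a \<Rightarrow> 'a"
  assumes "jones_tower B A e E"
  shows "\<forall>w\<in>rel_commutant (A 0) (A 2).
    comult A e E w = tensor_scale (complex_of_real (nv_const A E)) (comult_NV B A e E w)"
proof
  fix w assume w: "w \<in> rel_commutant (A 0) (A 2)"
  interpret jones_tower B A e E by fact
  obtain n l where "quasi_basis (A 0) (E 0) n l"
    using minimal by (auto simp: minimal_expectation_def index_finite_type_def)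
  then interpret three_steps B "A 0" "A 1" "A 2" "A 3" "E 0" "E 1" "E 2" "E 3" "e 1" "e 2" "e 3" "{..<n}" l
      "tau (A 0) (E 0)"
    by (rule three_steps)
  have tr1: "tower_trace E 1 x = scalar_value (E 0 (E 1 x))" for x
    by (simp add: tower_trace_def)
  have tr2: "tower_trace E 2 = (\<lambda>x. scalar_value (E 0 (E 1 (E 2 x))))"
    by (rule ext) (simp add: tower_trace_def numeral_2_eq_2)
  have tr3: "tower_trace E 3 = (\<lambda>x. scalar_value (E 0 (E 1 (E 2 (E 3 x)))))"
    by (rule ext) (simp add: tower_trace_def numeral_3_eq_3 numeral_2_eq_2)
  have d: "0 < nv_const A E"
  proof -
    define z where "z = watatani_index (rel_commutant (A 0) (A 1)) (E 1)"
    have z: "z \<in> rel_commutant (A 0) (A 1)" "z \<noteq> 0"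
      unfolding z_def by (fact s0.dual.commutant_index_nonzero)+
    define r where "r = Re (scalar_value (E 1 (z\<^sup>\<star> * z)))"
    have r: "E 1 (z\<^sup>\<star> * z) = r *\<^sub>R 1" "0 \<le> r"
      unfolding r_def by (fact s0.dual.F_norm_nonneg[OF z(1)])+
    have "r \<noteq> 0" using s0.dual.F_faithful[OF z(1)] r z(2) by auto
    moreover have "tower_trace E 1 (z\<^sup>\<star> * z) = of_real r"
      unfolding tr1 r(1) scaleR_one_eq_scaleC E0_scalar by simp
    ultimately show ?thesis using r(2) by (simp add: nv_const_def trace_norm2_def z_def)
  qed
  have conv: "conv1 A e E = conv"
    by (intro ext) (simp only: conv1_def conv_def fourier1_def[abs_def] fourier_def[abs_def] tr3)
  have nv: "nv_pairing A e E = pairing (nv_const A E)"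
    by (intro ext) (simp only: nv_pairing_def pairing_def tr2)
  show "comult A e E w = tensor_scale (complex_of_real (nv_const A E)) (comult_NV B A e E w)"
    unfolding comult_def comult_NV_def Let_def trace_inner_def nv tr2 conv
    by (rule comult_scale[OF d w])
qed

end
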